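(* Let $p>1$. The SDE–ODE system (S) of the context admits strong solutions, and these are pathwise unique. That is, for every $d$-dimensional Brownian motion $W$ and all initial data $(\overline X_0,\overline Y_0^1,\dots,\overline Y_0^m)\in L^p(\Omega;\mathbb R^d)\times(\mathbb R^d)^m$ (with $\overline X_0$ being $\mathcal F_0$-measurable) there exists a pathwise solution $(\overline X,\overline Y^1,\dots,\overline Y^m)$ of (S), and any two pathwise solutions with the same $W$ and the same initial data satisfy $\overline X_1=\overline X_2$ almost surely and $(\overline Y_1^1,\dots,\overline Y_1^m)=(\overline Y_2^1,\dots,\overline Y_2^m)$. Moreover, if $\overline X_0\in L^p(\Omega;\mathbb R^d)$, then there exists a constant $C=C(p,\overline Y_0^1,\dots,\overline Y_0^m,\mathrm{Law}(\overline X_0),L)>0$ such that $M_p(\overline\mu)\le C$, where $\overline\mu=\mathrm{Law}(\overline X)$.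
   Context: Fix $d,m\in\mathbb N$, $T>0$, $\sigma>0$ and a filtered probability space $(\Omega,\mathcal F,(\mathcal F_t),\mathbb P)$ carrying all random objects; Brownian motions are understood with respect to $(\mathcal F_t)$. For a Banach space $B$ and $p\ge1$, $\mathcal W_p(B)$ is the space of Borel probability measures $\mu$ on $B$ with $M_p(\mu):=\left(\int_B\|x\|^p\,d\mu\right)^{1/p}<\infty$, equipped with the $p$-Wasserstein distance, also denoted $\mathcal W_p$. For a random variable $X$, $\mathrm{Law}(X)=X_\sharp\mathbb P$. $\mathrm{ev}_t(f)=f(t)$ for $f\in C^0([0,T];\mathbb R^d)$. For a Lipschitz $H:\mathbb R^d\to\mathbb R^d$ and $\mu\in\mathcal W_1(\mathbb R^d)$, $H\ast\mu(x)=\int_{\mathbb R^d}H(x-y)\,d\mu(y)$. Assumptions: $H_1,H_2,K_1,K_2:\mathbb R^d\to\mathbb R^d$ are $L$-Lipschitz. The controls $u^i:[0,T]\times\mathcal W_1(\mathbb R^d)\to\mathbb R^d$, $i=1,\dots,m$, are Carathéodory functions (measurable in $t$, continuous in $\mu$, with $u^i(\cdot,\mu)\in L^1(0,T)$ for each $\mu$), and $u^i(t,\cdot)$ is $L$-Lipschitz for every $t$. System (S): $$\begin{cases} d\overline X(t)=\Big(H_1\ast\overline\mu_t(\overline X(t))+\frac1m\sum_{j=1}^mK_1(\overline Y^j(t)-\overline X(t))\Big)dt+\sqrt{2\sigma}\,dW(t)\\ \frac{d}{dt}\overline Y^i(t)=K_2\ast\overline\mu_t(\overline Y^i(t))+\frac1m\sum_{j=1}^mH_2(\overline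 Y^j(t)-\overline Y^i(t))+u^i(t,\overline\mu_t),\quad i=1,\dots,m\\ \overline X(0)=\overline X_0,\ \overline Y^i(0)=\overline Y^i_0,\quad i=1,\dots,m\\ \overline\mu=\mathrm{Law}(\overline X),\ \overline\mu_t=(\mathrm{ev}_t)_\sharp\overline\mu.\end{cases}$$ A pathwise (strong) solution is $(\overline X,\overline Y^1,\dots,\overline Y^m)$, with $\overline X$ a $C^0([0,T];\mathbb R^d)$-valued random variable and deterministic $\overline Y^i\in C^0([0,T];\mathbb R^d)$, such that (with $\overline\mu_t\in\mathcal W_1(\mathbb R^d)$, so that all terms make sense) almost surely, for all $t\in[0,T]$, $$\overline X(t)=\overline X_0+\int_0^t\Big(H_1\ast\overline\mu_s(\overline X(s))+\frac1m\sum_{j=1}^mK_1(\overline Y^j(s)-\overline X(s))\Big)ds+\sqrt{2\sigma}\,W(t),$$ and the $\overline Y^i$ are Carathéodory solutions (absolutely continuous, equation holding a.e.) of the ODEs in (S) with $\overline Y^i(0)=\overline Y^i_0$. The data $T,d,m,\sigma$, the functions $H_i,K_i$ and the integrals $\int_0^T|u^i(t,\delta_0)|\,dt$ are regarded as fixed; the dependence of $C$ on them is not displayed. *)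

theory Defs
  imports "HOL-Probability.Probability"
begin

section \<open>Wasserstein spaces\<close>

text \<open>
  The norm \<open>N\<close> is an explicit argument, since \<open>C\<^sup>0([0,T])\<close> depends on the term \<open>T\<close> and so is
  not a type of class \<open>banach\<close>.
\<close>

definition moment :: "real \<Rightarrow> ('a \<Rightarrow> real) \<Rightarrow> 'a measure \<Rightarrow> ennreal" where
  "moment p N \<mu> =
     (let I = (\<integral>\<^sup>+ x. ennreal (N x powr p) \<partial>\<mu>)
      in if I = \<infinity> then \<infinity> else ennreal (enn2real I powr (1 / p)))"

definition wasserstein_space :: "real \<Rightarrow> 'b::euclidean_space measure set" where
  "wasserstein_space p =
     {\<mu>. sets \<mu> = sets borel \<and> prob_space \<mu> \<and> moment p norm \<mu> < \<infinity>}"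

definition couplings :: "'b::euclidean_space measure \<Rightarrow> 'b measure \<Rightarrow> ('b \<times> 'b) measure set" where
  "couplings \<mu> \<nu> =
     {\<pi>. sets \<pi> = sets (borel \<Otimes>\<^sub>M borel) \<and> distr \<pi> borel fst = \<mu> \<and> distr \<pi> borel snd = \<nu>}"

text \<open>Only meaningful for \<open>\<mu>, \<nu> \<in> wasserstein_space p\<close>, where the infimum is finite.\<close>

definition wasserstein_dist :: "real \<Rightarrow> 'b::euclidean_space measure \<Rightarrow> 'b measure \<Rightarrow> real" where
  "wasserstein_dist p \<mu> \<nu> =
     enn2real (INF \<pi>\<in>couplings \<mu> \<nu>. \<integral>\<^sup>+ z. ennreal (dist (fst z) (snd z) powr p) \<partial>\<pi>) powr (1 / p)"


section \<open>The path space\<close>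

text \<open>
  The library's metric space of continuous functions on a topological space, with the supremum
  metric. Its elements are \<open>undefined\<close> outside \<open>[0,T]\<close>, so that HOL equality of paths is
  equality on \<open>[0,T]\<close>.
\<close>

definition C0 :: "real \<Rightarrow> (real \<Rightarrow> 'b::euclidean_space) metric" where
  "C0 T = cfunspace (top_of_set {0..T}) euclidean_metric"

definition path_borel :: "real \<Rightarrow> (real \<Rightarrow> 'b::euclidean_space) measure" where
  "path_borel T = sigma (mspace (C0 T)) {U. openin (mtopology_of (C0 T)) U}"

definition path_norm :: "real \<Rightarrow> (real \<Rightarrow> 'b::euclidean_space) \<Rightarrow> real" where
  "path_norm T f = (SUP t\<in>{0..T}. norm (f t))"

definition path_law :: "'w measure \<Rightarrow> real \<Rightarrow> ('w \<Rightarrow> real \<Rightarrow> 'b::euclidean_space)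
    \<Rightarrow> (real \<Rightarrow> 'b) measure" where
  "path_law M T X = distr M (path_borel T) X"

definition marginal :: "(real \<Rightarrow> 'b::euclidean_space) measure \<Rightarrow> real \<Rightarrow> 'b measure" where
  "marginal \<mu> t = distr \<mu> borel (\<lambda>f. f t)"


section \<open>Filtered probability spaces and Brownian motion\<close>

text \<open>
  Only the \<open>F t\<close> with \<open>t \<in> [0,T]\<close> matter below. No completeness or right-continuity is imposed.
\<close>

definition filtered_prob_space :: "'w measure \<Rightarrow> (real \<Rightarrow> 'w measure) \<Rightarrow> bool" where
  "filtered_prob_space M F \<longleftrightarrow>
     prob_space M \<and> filtration (space M) F \<and> (\<forall>t. subalgebra M (F t))"

definition brownian_motion :: "'w measure \<Rightarrow> (real \<Rightarrow> 'w measure) \<Rightarrow> real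
    \<Rightarrow> (real \<Rightarrow> 'w \<Rightarrow> 'b::euclidean_space) \<Rightarrow> bool" where
  "brownian_motion M F T W \<longleftrightarrow>
     (\<forall>t\<in>{0..T}. W t \<in> borel_measurable (F t)) \<and>
     (AE \<omega> in M. W 0 \<omega> = 0) \<and>
     (AE \<omega> in M. continuous_on {0..T} (\<lambda>t. W t \<omega>)) \<and>
     (\<forall>s t. 0 \<le> s \<and> s < t \<and> t \<le> T \<longrightarrow>
        prob_space.indep_set M
          (sets (vimage_algebra (space M) (\<lambda>\<omega>. W t \<omega> - W s \<omega>) borel)) (sets (F s)) \<and>
        distributed M lborel (\<lambda>\<omega>. W t \<omega> - W s \<omega>)
          (\<lambda>x. ennreal (\<Prod>b\<in>Basis. normal_density 0 (sqrt (t - s)) (x \<bullet> b))))"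

definition initial_datum :: "real \<Rightarrow> 'w measure \<Rightarrow> (real \<Rightarrow> 'w measure)
    \<Rightarrow> ('w \<Rightarrow> 'b::euclidean_space) \<Rightarrow> bool" where
  "initial_datum p M F X0 \<longleftrightarrow>
     X0 \<in> borel_measurable (F 0) \<and> integrable M (\<lambda>\<omega>. norm (X0 \<omega>) powr p)"


section \<open>Controls\<close>

text \<open>
  A control is only constrained on \<open>[0,T]\<close> and on the 1-Wasserstein space; measurability in
  time is Lebesgue measurability.
\<close>

definition caratheodory_fun :: "real \<Rightarrow> (real \<Rightarrow> 'b::euclidean_space measure \<Rightarrow> 'b) \<Rightarrow> bool" where
  "caratheodory_fun T v \<longleftrightarrow>
     (\<forall>\<mu>\<in>wasserstein_space 1. (\<lambda>t. v t \<mu>) \<in> borel_measurable (lebesgue_on {0..T})) \<and>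
     (\<forall>t\<in>{0..T}. \<forall>\<mu>\<in>wasserstein_space 1. \<forall>\<epsilon>>0. \<exists>\<delta>>0. \<forall>\<nu>\<in>wasserstein_space 1.
        wasserstein_dist 1 \<mu> \<nu> < \<delta> \<longrightarrow> dist (v t \<mu>) (v t \<nu>) < \<epsilon>) \<and>
     (\<forall>\<mu>\<in>wasserstein_space 1. set_integrable lebesgue {0..T} (\<lambda>t. v t \<mu>))"

definition admissible_control :: "real \<Rightarrow> real \<Rightarrow> (real \<Rightarrow> 'b::euclidean_space measure \<Rightarrow> 'b) \<Rightarrow> bool"
  where
  "admissible_control T L v \<longleftrightarrow>
     caratheodory_fun T v \<and>
     (\<forall>t\<in>{0..T}. \<forall>\<mu>\<in>wasserstein_space 1. \<forall>\<nu>\<in>wasserstein_space 1.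
        dist (v t \<mu>) (v t \<nu>) \<le> L * wasserstein_dist 1 \<mu> \<nu>)"


section \<open>The SDE--ODE system\<close>

definition conv :: "('b::euclidean_space \<Rightarrow> 'b) \<Rightarrow> 'b measure \<Rightarrow> 'b \<Rightarrow> 'b" where
  "conv H \<mu> x = (LINT y|\<mu>. H (x - y))"

definition abs_continuous_on :: "real set \<Rightarrow> (real \<Rightarrow> 'b::real_normed_vector) \<Rightarrow> bool" where
  "abs_continuous_on S f \<longleftrightarrow>
     (\<forall>\<epsilon>>0. \<exists>\<delta>>0. \<forall>D. D division_of \<Union>D \<and> \<Union>D \<subseteq> S \<and> (\<Sum>I\<in>D. Sup I - Inf I) < \<delta> \<longrightarrow>
        (\<Sum>I\<in>D. norm (f (Sup I) - f (Inf I))) < \<epsilon>)"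

definition drift_X :: "('b::euclidean_space \<Rightarrow> 'b) \<Rightarrow> ('b \<Rightarrow> 'b) \<Rightarrow> (real \<Rightarrow> 'b) measure
    \<Rightarrow> ('m::finite \<Rightarrow> real \<Rightarrow> 'b) \<Rightarrow> real \<Rightarrow> 'b \<Rightarrow> 'b" where
  "drift_X H1 K1 \<mu> Y t x =
     conv H1 (marginal \<mu> t) x + (1 / real CARD('m)) *\<^sub>R (\<Sum>j\<in>UNIV. K1 (Y j t - x))"

definition drift_Y :: "('b::euclidean_space \<Rightarrow> 'b) \<Rightarrow> ('b \<Rightarrow> 'b)
    \<Rightarrow> ('m::finite \<Rightarrow> real \<Rightarrow> 'b measure \<Rightarrow> 'b) \<Rightarrow> (real \<Rightarrow> 'b) measure
    \<Rightarrow> ('m \<Rightarrow> real \<Rightarrow> 'b) \<Rightarrow> 'm \<Rightarrow> real \<Rightarrow> 'b" where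
  "drift_Y H2 K2 u \<mu> Y i t =
     conv K2 (marginal \<mu> t) (Y i t)
     + (1 / real CARD('m)) *\<^sub>R (\<Sum>j\<in>UNIV. H2 (Y j t - Y i t))
     + u i t (marginal \<mu> t)"

text \<open>
  Integrability of the drift is demanded explicitly because the library's integral is total
  (it is \<open>0\<close> for non-integrable functions).
\<close>

definition pathwise_solution ::
  "real \<Rightarrow> real \<Rightarrow> ('b::euclidean_space \<Rightarrow> 'b) \<Rightarrow> ('b \<Rightarrow> 'b) \<Rightarrow> ('b \<Rightarrow> 'b) \<Rightarrow> ('b \<Rightarrow> 'b)
    \<Rightarrow> ('m::finite \<Rightarrow> real \<Rightarrow> 'b measure \<Rightarrow> 'b) \<Rightarrow> 'w measure \<Rightarrow> (real \<Rightarrow> 'w \<Rightarrow> 'b)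
    \<Rightarrow> ('w \<Rightarrow> 'b) \<Rightarrow> ('m \<Rightarrow> 'b) \<Rightarrow> ('w \<Rightarrow> real \<Rightarrow> 'b) \<Rightarrow> ('m \<Rightarrow> real \<Rightarrow> 'b) \<Rightarrow> bool"
where
  "pathwise_solution T \<sigma> H1 H2 K1 K2 u M W X0 Y0 X Y \<longleftrightarrow>
     X \<in> measurable M (path_borel T) \<and>
     (\<forall>i. Y i \<in> mspace (C0 T)) \<and>
     (let \<mu> = path_law M T X in
       (\<forall>t\<in>{0..T}. marginal \<mu> t \<in> wasserstein_space 1) \<and>
       (AE \<omega> in M. \<forall>t\<in>{0..T}.
          set_integrable lebesgue {0..t} (\<lambda>s. drift_X H1 K1 \<mu> Y s (X \<omega> s)) \<and>
          X \<omega> t = X0 \<omega> + (LINT s:{0..t}|lebesgue. drift_X H1 K1 \<mu> Y s (X \<omega> s))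
                   + sqrt (2 * \<sigma>) *\<^sub>R W t \<omega>) \<and>
       (\<forall>i. Y i 0 = Y0 i \<and> abs_continuous_on {0..T} (Y i) \<and>
          (AE t in lebesgue_on {0..T}. (Y i has_vector_derivative drift_Y H2 K2 u \<mu> Y i t) (at t))))"

end

(*
  The law of X enters the drifts only through its time marginals, and both drifts are Lipschitz
  in the pair (X_t, Y_t), the laws being compared in L^1: the distance W_1 of the laws of two
  random variables is at most the L^1 distance of the variables. Write the system as a fixed point
  equation for x = (X, Y) and measure differences by the smallest r with
  |x(omega,t) - x'(omega,t)| <= r K(omega) exp(l t), where K = 1 + |X_0| + sqrt(2 sigma) sup|W|
  is integrable, and K = 1 on the deterministic components. For l large the fixed point map is a
  contraction with factor 1/2 in this norm, pathwise for every omega. This gives existence and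
  uniqueness; comparison with x = 0 gives |X| <= C K, and the p-th moment of K is finite because
  sup|W| has moments of all orders (dyadic chaining, using only Gaussian increments).
*)
theory Submission
  imports Defs
begin

section \<open>Absolutely continuous functions\<close>

text \<open>The noise is additive, so it enters only through the continuous path
  \<open>\<xi>\<close> and no stochastic integral appears: the equation is solved for each outcome
  separately, the outcomes being coupled only through the marginal laws. This coupling dictates the
  weight. The expectation of a difference is at most r exp(l t) times the mean of \<open>K\<close>,
  so \<open>K\<close> must be integrable and a bound \<open>\<kappa>\<close> of its mean enters the
  rate; the mean-field and deterministic terms are common to all outcomes, so \<open>K\<close> must
  be at least 1 to absorb them. The weighted norm may be infinite, and a pathwise solution is only
  known to have W_1 marginals at each time, without uniformity in time or domination by
  \<open>K\<close>. Uniqueness therefore needs a separate argument that every solution has finite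
  weighted norm; only then can the factor 1/2 be iterated down to 0. As the ODE part is stated
  through absolute continuity and almost everywhere derivatives, passing to integral equations and
  back needs both halves of the Lebesgue fundamental theorem of calculus.\<close>

lemma division_length_sum:
  fixes D :: "real set set"
  assumes "D division_of S"
  shows "(\<Sum>I\<in>D. Sup I - Inf I) = measure lebesgue S"
proof -
  have "(\<Sum>I\<in>D. Sup I - Inf I) = (\<Sum>I\<in>D. measure lebesgue I)"
  proof (rule sum.cong[OF refl])
    fix I assume "I \<in> D"
    then obtain a b where "I = {a..b}" "a \<le> b"
      using division_ofD(3,4)[OF assms, of I] by (metis atLeastatMost_empty_iff box_real(2) not_le)
    then show "Sup I - Inf I = measure lebesgue I" by simp
  qed
  also have "\<dots> = measure lebesgue S" by (rule content_division[OF assms])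
  finally show ?thesis .
qed

text \<open>The intervals of \<open>p\<close> lie in \<open>U\<close>, so their total length is
  below \<open>d\<close> and the absolute continuity estimate applies. This handles the terms of a
  Riemann sum whose tags fall into a null set, where nothing is known about the derivative.\<close>

lemma abs_continuous_on_null_part:
  fixes f :: "real \<Rightarrow> 'a::real_normed_vector"
  assumes "\<And>D. D division_of \<Union>D \<Longrightarrow> \<Union>D \<subseteq> {a..b} \<Longrightarrow> (\<Sum>I\<in>D. Sup I - Inf I) < d \<Longrightarrow>
                 (\<Sum>I\<in>D. norm (f (Sup I) - f (Inf I))) < e"
    and p: "p tagged_partial_division_of {a..b}"
    and U: "U \<in> lmeasurable" "measure lebesgue U < d" "\<And>x K. (x, K) \<in> p \<Longrightarrow> K \<subseteq> U"
  shows "(\<Sum>(x, K)\<in>p. norm (f (Sup K) - f (Inf K))) < e"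
proof -
  let ?D = "snd ` p"
  have td: "p tagged_division_of \<Union>?D"
    using p by (simp add: tagged_partial_division_of_Union_self)
  have D: "?D division_of \<Union>?D" by (rule division_of_tagged_division[OF td])
  \<comment> \<open>A tagged division may repeat an interval with empty interior under several tags;
    passing from \<open>p\<close> to its set of intervals is harmless because \<open>h\<close>
    vanishes on those. The empty interval gets the value 0 by decree, its \<open>Sup\<close> and
    \<open>Inf\<close> being unspecified.\<close>
  define h where "h = (\<lambda>I. if I = {} then 0 else norm (f (Sup I) - f (Inf I)))"
  have "(\<Sum>(x, K)\<in>p. norm (f (Sup K) - f (Inf K))) = (\<Sum>(x, K)\<in>p. h K)"
    by (rule sum.cong) (auto simp: h_def dest: tagged_partial_division_ofD(2)[OF p])
  also have "\<dots> = sum h ?D"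
  proof (rule sum.over_tagged_division_lemma[OF td])
    fix u v :: real assume *: "box u v = {}"
    show "h (cbox u v) = 0"
    proof (cases "cbox u v = {}")
      case False
      with * have "u = v" by auto
      then show ?thesis by (simp add: h_def)
    qed (simp add: h_def)
  qed
  also have "\<dots> = (\<Sum>I\<in>?D. norm (f (Sup I) - f (Inf I)))"
    by (rule sum.cong) (auto simp: h_def dest: tagged_partial_division_ofD(2)[OF p])
  also have "\<dots> < e"
  proof (rule assms(1)[OF D])
    show "\<Union>?D \<subseteq> {a..b}" using tagged_partial_division_ofD(3)[OF p] by fastforce
    have "(\<Sum>I\<in>?D. Sup I - Inf I) = measure lebesgue (\<Union>?D)" by (rule division_length_sum[OF D])
    also have "\<dots> \<le> measure lebesgue U"
      using U(1) U(3) lmeasurable_division[OF D] by (intro measure_mono_fmeasurable) fastforce+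
    finally show "(\<Sum>I\<in>?D. Sup I - Inf I) < d" using U by simp
  qed
  finally show ?thesis .
qed

text \<open>Compares the increment of \<open>f\<close> with Riemann sums of \<open>g\<close>, which
  is \<open>f'\<close> changed to 0 on \<open>N\<close>. Intervals tagged outside \<open>N\<close>
  are handled by differentiability at the tag. Intervals tagged in \<open>N\<close> contribute only
  increments of \<open>f\<close>; the gauge forces them into an open set \<open>U\<close> containing
  \<open>N\<close> of measure below \<open>\<delta>\<close>, so absolute continuity makes their sum
  small.\<close>

lemma fundamental_theorem_of_calculus_abs_continuous:
  fixes f :: "real \<Rightarrow> 'a::euclidean_space"
  assumes ab: "a \<le> b" and ac: "abs_continuous_on {a..b} f" and N: "negligible N"
    and der: "\<And>x. x \<in> {a..b} - N \<Longrightarrow> (f has_vector_derivative f' x) (at x within {a..b})"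
  shows "(f' has_integral (f b - f a)) {a..b}"
proof -
  define g where "g = (\<lambda>x. if x \<in> N then 0 else f' x)"
  have "(g has_integral (f b - f a)) (cbox a b)"
    unfolding has_integral
  proof (intro allI impI)
    fix e :: real assume e: "e > 0"
    \<comment> \<open>The linearisation errors sum to at most \<open>\<epsilon> * (b - a)\<close>,
      which is at most half of \<open>e\<close>; the added 1 covers \<open>a = b\<close>.\<close>
    define \<epsilon> where "\<epsilon> = e / (2 * (b - a + 1))"
    have \<epsilon>: "\<epsilon> > 0" using e ab by (simp add: \<epsilon>_def)
    have "\<forall>x. \<exists>d>0. x \<in> {a..b} - N \<longrightarrow>
         (\<forall>y\<in>{a..b}. norm (y-x) < d \<longrightarrow> norm (f y - f x - (y-x) *\<^sub>R f' x) \<le> \<epsilon> * norm (y-x))"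
      using der[unfolded has_vector_derivative_def has_derivative_within_alt] \<epsilon> zero_less_one by metis
    then obtain d where d: "\<And>x. 0 < d x"
      "\<And>x y. \<lbrakk>x \<in> {a..b} - N; y \<in> {a..b}; norm (y-x) < d x\<rbrakk>
             \<Longrightarrow> norm (f y - f x - (y-x) *\<^sub>R f' x) \<le> \<epsilon> * norm (y-x)"
      by metis
    obtain \<delta> where \<delta>: "\<delta> > 0" and ac': "\<And>D. D division_of \<Union>D \<Longrightarrow> \<Union>D \<subseteq> {a..b} \<Longrightarrow>
         (\<Sum>I\<in>D. Sup I - Inf I) < \<delta> \<Longrightarrow> (\<Sum>I\<in>D. norm (f (Sup I) - f (Inf I))) < e/2"
      using ac[unfolded abs_continuous_on_def, rule_format, of "e/2"] e by auto
    have Nm: "N \<in> lmeasurable" "measure lebesgue N = 0"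
      using N by (auto simp: negligible_iff_measure)
    obtain U where U: "open U" "N \<subseteq> U" "U \<in> lmeasurable" "measure lebesgue U < \<delta>"
    proof -
      obtain U where U: "open U" "N \<subseteq> U" "U - N \<in> lmeasurable" "emeasure lebesgue (U - N) < ennreal \<delta>"
        using sets_lebesgue_outer_open[OF fmeasurableD[OF Nm(1)] \<delta>] by metis
      have UN: "U = N \<union> (U - N)" using U(2) by auto
      have "U \<in> lmeasurable" by (subst UN) (use U(3) Nm(1) in \<open>rule fmeasurable.Un[rotated]\<close>)
      moreover have "measure lebesgue U \<le> measure lebesgue N + measure lebesgue (U - N)"
        by (subst UN, rule measure_Un_le) (use U Nm in auto)
      moreover have "measure lebesgue (U - N) < \<delta>"
        using U(3,4) \<delta> by (simp add: emeasure_eq_measure2 ennreal_less_iff)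
      ultimately show ?thesis using that U Nm by auto
    qed
    define \<gamma> where "\<gamma> = (\<lambda>x. if x \<in> N then U else ball x (d x))"
    show "\<exists>\<gamma>. gauge \<gamma> \<and> (\<forall>p. p tagged_division_of cbox a b \<and> \<gamma> fine p \<longrightarrow>
              norm ((\<Sum>(x, k)\<in>p. measure lborel k *\<^sub>R g x) - (f b - f a)) < e)"
    proof (intro exI[of _ \<gamma>] conjI allI impI; (elim conjE)?)
      show "gauge \<gamma>" using U d(1) by (auto simp: gauge_def \<gamma>_def)
      fix p assume ptag: "p tagged_division_of cbox a b" and fine: "\<gamma> fine p"
      define h where "h = (\<lambda>(x, K). measure lborel K *\<^sub>R g x - (f (Sup K) - f (Inf K)))"
      define p1 where "p1 = {(x,K)\<in>p. x \<in> N}"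
      define p2 where "p2 = {(x,K)\<in>p. x \<notin> N}"
      have fin: "finite p" using ptag by auto
      have ba: "b - a = (\<Sum>(x,K)\<in>p. Sup K - Inf K)" "f b - f a = (\<Sum>(x,K)\<in>p. f(Sup K) - f(Inf K))"
        using additive_tagged_division_1[where f= "\<lambda>x. x"] additive_tagged_division_1[where f= f]
              ab ptag by auto
      have eq: "(\<Sum>(x, k)\<in>p. measure lborel k *\<^sub>R g x) - (f b - f a) = sum h p"
        unfolding ba h_def by (subst sum_subtractf[symmetric], rule sum.cong) auto
      have "p = p1 \<union> p2" "p1 \<inter> p2 = {}" by (auto simp: p1_def p2_def)
      then have split: "sum h p = sum h p1 + sum h p2"
        using fin sum.union_disjoint[of p1 p2 h] by (metis finite_Un)
      have ptag': "p tagged_partial_division_of {a..b}"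
        using ptag by (simp add: tagged_division_of_def)
      have "norm (sum h p1) \<le> (\<Sum>x\<in>p1. norm (h x))" by (rule norm_sum)
      also have "\<dots> = (\<Sum>(x, K)\<in>p1. norm (f (Sup K) - f (Inf K)))"
        by (rule sum.cong) (auto simp: p1_def h_def g_def norm_minus_commute)
      also have "\<dots> < e/2"
      proof (rule abs_continuous_on_null_part[OF ac'])
        show "p1 tagged_partial_division_of {a..b}"
          by (rule tagged_partial_division_subset[OF ptag']) (auto simp: p1_def)
        show "K \<subseteq> U" if "(x, K) \<in> p1" for x K
          using fineD[OF fine, of x K] that by (auto simp: p1_def \<gamma>_def)
      qed (use U in auto)
      finally have n1: "norm (sum h p1) < e/2" .
      have "norm (sum h p2) \<le> (\<Sum>n\<in>p2. \<epsilon> * (case n of (x, k) \<Rightarrow> Sup k - Inf k))"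
      proof (rule sum_norm_le, safe)
        fix x K assume xK: "(x, K) \<in> p2"
        then have xK': "(x,K) \<in> p" "x \<notin> N" by (auto simp: p2_def)
        then obtain u v where k: "K = cbox u v" and "x \<in> K" and kab: "K \<subseteq> cbox a b"
          using ptag by (meson tagged_division_ofD(2,3,4))
        have "u \<le> v" using \<open>x \<in> K\<close> unfolding k by auto
        have ball: "\<forall>y\<in>K. y \<in> ball x (d x)"
          using fineD[OF fine xK'(1)] xK'(2) by (auto simp: \<gamma>_def)
        have uv: "u \<in> K" "v \<in> K" by (simp_all add: \<open>u \<le> v\<close> k)
        have g: "g x = f' x" using xK' by (simp add: g_def)
        have xab: "x \<in> {a..b} - N" using xK' kab \<open>x \<in> K\<close> by auto
        \<comment> \<open>The tag lies between \<open>u\<close> and \<open>v\<close>, so the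
          linearisation errors at the two endpoints add up to
          \<open>\<epsilon> * (v - u)\<close>.\<close>
        have "norm ((v - u) *\<^sub>R f' x - (f v - f u)) = norm (f u - f x - (u - x) *\<^sub>R f' x - (f v - f x - (v - x) *\<^sub>R f' x))"
          by (auto simp: algebra_simps)
        also have "\<dots> \<le> norm (f u - f x - (u - x) *\<^sub>R f' x) + norm (f v - f x - (v - x) *\<^sub>R f' x)"
          by (rule norm_triangle_ineq4)
        also have "\<dots> \<le> \<epsilon> * norm (u - x) + \<epsilon> * norm (v - x)"
        proof (rule add_mono)
          show "norm (f u - f x - (u - x) *\<^sub>R f' x) \<le> \<epsilon> * norm (u - x)"
            by (rule d(2)[OF xab]) (use uv kab ball in \<open>auto simp: dist_norm norm_minus_commute\<close>)
          show "norm (f v - f x - (v - x) *\<^sub>R f' x) \<le> \<epsilon> * norm (v - x)"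
            by (rule d(2)[OF xab]) (use uv kab ball in \<open>auto simp: dist_norm norm_minus_commute\<close>)
        qed
        also have "\<dots> = \<epsilon> * (v - u)"
          using \<open>x \<in> K\<close> \<open>u \<le> v\<close> by (auto simp: k algebra_simps)
        finally show "norm (h (x, K)) \<le> \<epsilon> * (Sup K - Inf K)"
          using \<open>u \<le> v\<close> by (simp add: h_def g k)
      qed
      also have "\<dots> = \<epsilon> * (\<Sum>(x,k)\<in>p2. Sup k - Inf k)" by (simp add: sum_distrib_left)
      also have "\<dots> \<le> \<epsilon> * (b - a)"
      proof (rule mult_left_mono)
        show "(\<Sum>(x,k)\<in>p2. Sup k - Inf k) \<le> b - a"
          unfolding ba
        proof (rule sum_mono2[OF fin])
          fix z assume "z \<in> p - p2"
          then obtain x K where z: "z = (x,K)" "(x,K) \<in> p" by (cases z) auto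
          then obtain u v where k: "K = cbox u v" and "x \<in> K"
            using ptag by (meson tagged_division_ofD(2,4))
          then show "0 \<le> (case z of (x, K) \<Rightarrow> Sup K - Inf K)" using z by auto
        qed (auto simp: p2_def)
      qed (use \<epsilon> in auto)
      also have "\<dots> \<le> e/2"
      proof -
        have "\<epsilon> * (b - a) \<le> \<epsilon> * (b - a + 1)" using \<epsilon> by (intro mult_left_mono) auto
        also have "\<dots> = e/2" using ab by (simp add: \<epsilon>_def field_simps)
        finally show ?thesis .
      qed
      finally have "norm (sum h p2) \<le> e/2" .
      with n1 show "norm ((\<Sum>(x, k)\<in>p. measure lborel k *\<^sub>R g x) - (f b - f a)) < e"
        unfolding eq split using norm_triangle_ineq[of "sum h p1" "sum h p2"] by linarith
    qed
  qed
  then show ?thesis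
    unfolding box_real by (rule has_integral_spike[OF N, rotated]) (auto simp: g_def)
qed

text \<open>Cuts \<open>f\<close> at a height \<open>n\<close>: the part above \<open>n\<close> has
  integral below \<open>e / 2\<close> by dominated convergence, and the part below contributes at
  most \<open>n\<close> times the measure of the set.\<close>

lemma integral_small_on_small_sets:
  fixes f :: "'a \<Rightarrow> real"
  assumes f: "integrable M f" "\<And>x. 0 \<le> f x" and e: "e > 0"
  obtains d where "d > 0"
    "\<And>A. A \<in> fmeasurable M \<Longrightarrow> measure M A < d \<Longrightarrow> (LINT x:A|M. f x) < e"
proof -
  have lim: "(\<lambda>n. LINT x|M. max 0 (f x - real n)) \<longlonglongrightarrow> (LINT x|M. 0)"
  proof (rule integral_dominated_convergence[where w = f])
    show "AE x in M. (\<lambda>n. max 0 (f x - real n)) \<longlonglongrightarrow> 0"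
    proof (rule AE_I2)
      fix x
      obtain m :: nat where "f x \<le> real m" using real_arch_simple by blast
      then have "\<forall>\<^sub>F n in sequentially. max 0 (f x - real n) = 0"
        by (intro eventually_sequentiallyI[of m]) (auto simp: max_def)
      then show "(\<lambda>n. max 0 (f x - real n)) \<longlonglongrightarrow> 0" by (rule tendsto_eventually)
    qed
    show "AE x in M. norm (max 0 (f x - real n)) \<le> f x" for n
      using f(2) by (auto simp: max_def)
  qed (use f in auto)
  then have "\<forall>\<^sub>F n in sequentially. (LINT x|M. max 0 (f x - real n)) < e/2"
    using e by (intro order_tendstoD) auto
  then obtain n where n: "(LINT x|M. max 0 (f x - real n)) < e/2"
    by (auto simp: eventually_sequentially)
  have intn: "integrable M (\<lambda>x. max 0 (f x - real n))"
    by (rule Bochner_Integration.integrable_bound[OF f(1)]) (use f in \<open>auto simp: max_def\<close>)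
  define d where "d = e / (2 * (real n + 1))"
  have "d > 0" using e by (simp add: d_def)
  moreover have "(LINT x:A|M. f x) < e" if A: "A \<in> fmeasurable M" "measure M A < d" for A
  proof -
    have intA: "integrable M (\<lambda>x. indicator A x * real n)"
      using A by (intro integrable_mult_left) (auto simp: fmeasurable_def)
    have "(LINT x:A|M. f x) \<le> (LINT x|M. max 0 (f x - real n) + indicator A x * real n)"
      unfolding set_lebesgue_integral_def
    proof (rule integral_mono)
      show "integrable M (\<lambda>x. indicator A x *\<^sub>R f x)"
        using integrable_mult_indicator[of A M f] f A by (simp add: fmeasurable_def)
      show "integrable M (\<lambda>x. max 0 (f x - real n) + indicator A x * real n)"
        using intA intn by simp
    qed (auto split: split_indicator)
    also have "\<dots> = (LINT x|M. max 0 (f x - real n)) + measure M A * real n"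
      using intA intn A by (subst Bochner_Integration.integral_add) (auto simp: fmeasurable_def)
    also have "measure M A * real n \<le> d * (real n + 1)"
      using A \<open>d > 0\<close> by (intro mult_mono) auto
    also have "d * (real n + 1) = e/2" by (simp add: d_def field_simps)
    finally show ?thesis using n by linarith
  qed
  ultimately show ?thesis by (rule that)
qed

text \<open>The increment over each interval of a division is at most the integral of the norm of
  \<open>g\<close> over it; these add up to one integral over the union, which is small because the
  union has small measure.\<close>

lemma abs_continuous_on_indefinite_integral:
  fixes g :: "real \<Rightarrow> 'a::euclidean_space"
  assumes g: "g absolutely_integrable_on {a..b}"
    and f: "\<And>t. t \<in> {a..b} \<Longrightarrow> f t = v + integral {a..t} g"
  shows "abs_continuous_on {a..b} f"
  unfolding abs_continuous_on_def
proof (intro allI impI)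
  fix e :: real assume "e > 0"
  have gi: "integrable lebesgue (\<lambda>x. norm (indicator {a..b} x *\<^sub>R g x))"
    using g unfolding set_integrable_def by (rule integrable_norm)
  obtain d where d: "d > 0" "\<And>A. A \<in> lmeasurable \<Longrightarrow> measure lebesgue A < d \<Longrightarrow>
       (LINT x:A|lebesgue. norm (indicator {a..b} x *\<^sub>R g x)) < e"
    using integral_small_on_small_sets[OF gi _ \<open>e > 0\<close>] by auto
  show "\<exists>\<delta>>0. \<forall>D. D division_of \<Union>D \<and> \<Union>D \<subseteq> {a..b} \<and> (\<Sum>I\<in>D. Sup I - Inf I) < \<delta> \<longrightarrow>
        (\<Sum>I\<in>D. norm (f (Sup I) - f (Inf I))) < e"
  proof (intro exI[of _ d] conjI allI impI; (elim conjE)?)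
    fix D assume D: "D division_of \<Union>D" "\<Union>D \<subseteq> {a..b}" "(\<Sum>I\<in>D. Sup I - Inf I) < d"
    have ng: "(\<lambda>x. norm (g x)) absolutely_integrable_on {a..b}"
      using absolutely_integrable_norm[OF g] by (simp add: o_def)
    have ngU: "(\<lambda>x. norm (g x)) absolutely_integrable_on \<Union>D"
      by (rule set_integrable_subset[OF ng _ D(2)]) (use lmeasurable_division[OF D(1)] in auto)
    have "(\<Sum>I\<in>D. norm (f (Sup I) - f (Inf I))) \<le> (\<Sum>I\<in>D. integral I (\<lambda>x. norm (g x)))"
    proof (rule sum_mono)
      fix I assume I: "I \<in> D"
      then obtain u v where uv: "I = {u..v}" "u \<le> v"
        using division_ofD(3,4)[OF D(1), of I] by (metis atLeastatMost_empty_iff box_real(2) not_le)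
      have "{u..v} \<subseteq> {a..b}" using D(2) I uv(1) by blast
      then have sub: "a \<le> u" "v \<le> b" using uv(2) by auto
      have gi: "g integrable_on {a..v}" "g integrable_on {u..v}"
        using set_lebesgue_integral_eq_integral(1)[OF g] sub uv(2)
        by (meson atLeastatMost_subset_iff integrable_on_subinterval order_refl order_trans)+
      have "integral {a..u} g + integral {u..v} g = integral {a..v} g"
        by (rule Henstock_Kurzweil_Integration.integral_combine) (use sub uv gi in auto)
      then have "f v - f u = integral {u..v} g"
        using f[of u] f[of v] sub uv by (simp add: algebra_simps)
      also have "norm \<dots> \<le> integral {u..v} (\<lambda>x. norm (g x))"
      proof (rule integral_norm_bound_integral[OF gi(2)])
        show "(\<lambda>x. norm (g x)) integrable_on {u..v}"
          using set_lebesgue_integral_eq_integral(1)[OF ng] sub uv(2)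
          by (meson atLeastatMost_subset_iff integrable_on_subinterval)
      qed auto
      finally show "norm (f (Sup I) - f (Inf I)) \<le> integral I (\<lambda>x. norm (g x))"
        using uv by simp
    qed
    also have "\<dots> = integral (\<Union>D) (\<lambda>x. norm (g x))"
      by (rule integral_combine_division_topdown[OF _ D(1), symmetric])
        (rule set_lebesgue_integral_eq_integral(1)[OF ngU])
    also have "\<dots> = (LINT x:\<Union>D|lebesgue. norm (g x))"
      by (rule set_lebesgue_integral_eq_integral(2)[OF ngU, symmetric])
    also have "\<dots> = (LINT x:\<Union>D|lebesgue. norm (indicator {a..b} x *\<^sub>R g x))"
      unfolding set_lebesgue_integral_def using D(2)
      by (intro Bochner_Integration.integral_cong) (auto split: split_indicator)
    also have "\<dots> < e"
      using lmeasurable_division[OF D(1)] D(3) division_length_sum[OF D(1)] by (intro d(2)) auto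
    finally show "(\<Sum>I\<in>D. norm (f (Sup I) - f (Inf I))) < e" .
  qed (use d in auto)
qed

section \<open>Almost everywhere differentiation of indefinite integrals\<close>

lemma right_difference_quotient_integral:
  fixes g :: "real \<Rightarrow> 'a::euclidean_space"
  assumes g: "\<And>a b. g integrable_on {a..b}"
  obtains N where "negligible N"
    "\<And>x e. x \<notin> N \<Longrightarrow> e > 0 \<Longrightarrow> \<exists>d>0. \<forall>h. 0 < h \<and> h < d \<longrightarrow>
        norm (integral {x..x+h} g /\<^sub>R h - g x) < e"
  using integrable_ccontinuous_explicit[of g] g by (auto simp: box_real)

text \<open>The difference quotients available are those over intervals to the right of a point.
  Left quotients at \<open>t\<close> are right quotients of the reflected function at
  \<open>-t\<close>, so the exceptional set is a null set together with a reflected one. The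
  extension \<open>G\<close> by 0 provides integrability on every interval.\<close>

lemma indefinite_integral_has_vector_derivative_ae:
  fixes g :: "real \<Rightarrow> 'a::euclidean_space"
  assumes g: "g integrable_on {a..b}"
  obtains N where "negligible N"
    "\<And>t. t \<in> {a<..<b} - N \<Longrightarrow> ((\<lambda>t. integral {a..t} g) has_vector_derivative g t) (at t)"
proof -
  define G where "G = (\<lambda>t. if t \<in> {a..b} then g t else 0)"
  have GU: "G integrable_on UNIV" unfolding G_def using g by (subst integrable_restrict_UNIV)
  have Gi: "G integrable_on {u..v}" for u v
    using integrable_on_subcbox[OF GU, of u v] by simp
  have Ri: "(\<lambda>x. G (- x)) integrable_on {u..v}" for u v
    using Gi[of "-v" "-u"]
      Henstock_Kurzweil_Integration.integrable_reflect_real[where f = G and a = "-v" and b = "-u"] by simp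
  obtain N1 where N1: "negligible N1" "\<And>x e. x \<notin> N1 \<Longrightarrow> e > 0 \<Longrightarrow> \<exists>d>0. \<forall>h. 0 < h \<and> h < d \<longrightarrow>
        norm (integral {x..x+h} G /\<^sub>R h - G x) < e"
    using right_difference_quotient_integral[OF Gi] by metis
  obtain N2 where N2: "negligible N2" "\<And>x e. x \<notin> N2 \<Longrightarrow> e > 0 \<Longrightarrow> \<exists>d>0. \<forall>h. 0 < h \<and> h < d \<longrightarrow>
        norm (integral {x..x+h} (\<lambda>x. G (- x)) /\<^sub>R h - G (- x)) < e"
    using right_difference_quotient_integral[OF Ri] by metis
  define N where "N = N1 \<union> uminus ` N2"
  have "negligible N" unfolding N_def
    using N1 N2
    by (intro negligible_Un negligible_differentiable_image_negligible)
      (auto intro!: derivative_intros)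
  moreover have "((\<lambda>t. integral {a..t} g) has_vector_derivative g t) (at t)" if t: "t \<in> {a<..<b} - N" for t
    unfolding has_vector_derivative_def has_derivative_at_alt
  proof (intro conjI allI impI)
    show "bounded_linear (\<lambda>x. x *\<^sub>R g t)" by (rule bounded_linear_scaleR_left)
    fix e :: real assume e: "0 < e"
    have tN: "t \<notin> N1" "- t \<notin> N2" using t by (auto simp: N_def image_iff)
    obtain d1 where d1: "d1 > 0" "\<And>h. 0 < h \<Longrightarrow> h < d1 \<Longrightarrow> norm (integral {t..t+h} G /\<^sub>R h - G t) < e"
      using N1(2)[OF tN(1) e] by auto
    obtain d2 where d2: "d2 > 0" "\<And>h. 0 < h \<Longrightarrow> h < d2 \<Longrightarrow>
         norm (integral {-t..-t+h} (\<lambda>x. G (- x)) /\<^sub>R h - G t) < e"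
      using N2(2)[OF tN(2) e] by auto
    define d where "d = min (min d1 d2) (min (t - a) (b - t))"
    have "d > 0" using d1 d2 t by (auto simp: d_def)
    moreover have "norm (integral {a..y} g - integral {a..t} g - (y - t) *\<^sub>R g t) \<le> e * norm (y - t)"
      if y: "norm (y - t) < d" for y
    proof -
      have yab: "a < y" "y < b" using y t by (auto simp: d_def)
      have eqG: "integral {u..v} g = integral {u..v} G" if "a \<le> u" "v \<le> b" for u v
        using that by (intro Henstock_Kurzweil_Integration.integral_cong) (auto simp: G_def)
      have Gt: "G t = g t" using t by (auto simp: G_def)
      have q: "norm (I - h *\<^sub>R g t) \<le> e * h" if "norm (I /\<^sub>R h - g t) < e" "h > 0" for I :: 'a and h
      proof -
        have "I - h *\<^sub>R g t = h *\<^sub>R (I /\<^sub>R h - g t)" using that by (simp add: scaleR_right_diff_distrib)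
        then have "norm (I - h *\<^sub>R g t) = h * norm (I /\<^sub>R h - g t)" using that by simp
        then show ?thesis using that by (simp add: mult.commute)
      qed
      consider "y = t" | "y > t" | "y < t" by linarith
      then show ?thesis
      proof cases
        case 1 then show ?thesis by simp
      next
        case 2
        have "integral {a..t} g + integral {t..y} g = integral {a..y} g"
          using g yab t 2 by (intro Henstock_Kurzweil_Integration.integral_combine)
            (auto intro: integrable_on_subinterval)
        moreover have "norm (integral {t..t+(y-t)} G /\<^sub>R (y-t) - G t) < e"
          using 2 y by (intro d1) (auto simp: d_def)
        ultimately have "norm (integral {t..y} g - (y - t) *\<^sub>R g t) \<le> e * (y - t)"
          using q[where I = "integral {t..y} g" and h = "y - t"] 2 yab t eqG[of t y] Gt by simp
        moreover have "integral {a..y} g - integral {a..t} g - (y - t) *\<^sub>R g t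
            = integral {t..y} g - (y - t) *\<^sub>R g t"
          using \<open>integral {a..t} g + integral {t..y} g = integral {a..y} g\<close>
          by (simp add: algebra_simps)
        ultimately show ?thesis using 2 by simp
      next
        case 3
        have "integral {a..y} g + integral {y..t} g = integral {a..t} g"
          using g yab t 3 by (intro Henstock_Kurzweil_Integration.integral_combine)
            (auto intro: integrable_on_subinterval)
        moreover have "norm (integral {-t..-t+(t-y)} (\<lambda>x. G (- x)) /\<^sub>R (t-y) - G t) < e"
          using 3 y by (intro d2) (auto simp: d_def)
        moreover have "integral {-t..-y} (\<lambda>x. G (- x)) = integral {y..t} G" by simp
        ultimately have "norm (integral {y..t} g - (t - y) *\<^sub>R g t) \<le> e * (t - y)"
          using q[where I = "integral {y..t} g" and h = "t - y"] 3 yab t eqG[of y t] Gt by simp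
        moreover have "integral {a..y} g - integral {a..t} g - (y - t) *\<^sub>R g t
            = - (integral {y..t} g - (t - y) *\<^sub>R g t)"
          using \<open>integral {a..y} g + integral {y..t} g = integral {a..t} g\<close>
          by (simp add: algebra_simps)
        ultimately show ?thesis using 3 by (simp only: norm_minus_cancel) simp
      qed
    qed
    ultimately show "\<exists>d>0. \<forall>y. norm (y - t) < d \<longrightarrow>
        norm (integral {a..y} g - integral {a..t} g - (y - t) *\<^sub>R g t) \<le> e * norm (y - t)"
      by blast
  qed
  ultimately show ?thesis by (rule that)
qed

section \<open>Measurability on the path space\<close>

text \<open>Compactness of \<open>{0..T}\<close> makes the boundedness built into
  \<open>cfunspace\<close> automatic.\<close>

lemma mspace_C0_iff:
  "f \<in> mspace (C0 T) \<longleftrightarrow> continuous_on {0..T} f \<and> f \<in> extensional {0..T}"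
proof -
  have "compactin (top_of_set {0..T}) (topspace (top_of_set {0..T}))"
    by (simp add: compactin_subtopology)
  note eq = compactin_mspace_cfunspace[OF this, of euclidean_metric]
  show ?thesis unfolding C0_def eq by auto
qed

lemma mdist_C0_le:
  assumes "0 \<le> T" "f \<in> mspace (C0 T)" "g \<in> mspace (C0 T)"
  shows "mdist (C0 T) f g \<le> a \<longleftrightarrow> (\<forall>t\<in>{0..T}. dist (f t) (g t) \<le> a)"
  using cfunspace_mdist_le[of f "top_of_set {0..T}" euclidean_metric g a] assms by (simp add: C0_def)

lemma open_C0_subset:
  "{U :: (real \<Rightarrow> 'a::euclidean_space) set. openin (mtopology_of (C0 T)) U} \<subseteq> Pow (mspace (C0 T))"
proof
  fix U :: "(real \<Rightarrow> 'a) set"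
  assume "U \<in> {U. openin (mtopology_of (C0 T)) U}"
  then show "U \<in> Pow (mspace (C0 T))" using openin_subset[of "mtopology_of (C0 T)" U] by simp
qed

lemma space_path_borel: "space (path_borel T) = mspace (C0 T)"
  by (simp add: path_borel_def space_measure_of[OF open_C0_subset])

lemma openin_C0_iff:
  "openin (mtopology_of (C0 T)) U \<longleftrightarrow>
     U \<subseteq> mspace (C0 T) \<and> (\<forall>f\<in>U. \<exists>r>0. \<forall>g\<in>mspace (C0 T). mdist (C0 T) f g < r \<longrightarrow> g \<in> U)"
proof -
  interpret Metric_space "mspace (C0 T)" "mdist (C0 T)" by (rule Metric_space_mspace_mdist)
  have "mball f r \<subseteq> U \<longleftrightarrow> (\<forall>g\<in>mspace (C0 T). mdist (C0 T) f g < r \<longrightarrow> g \<in> U)"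
    if "f \<in> mspace (C0 T)" for f r
    using that by (simp only: subset_iff in_mball Ball_def) blast
  then have "(\<exists>r>0. mball f r \<subseteq> U) \<longleftrightarrow> (\<exists>r>0. \<forall>g\<in>mspace (C0 T). mdist (C0 T) f g < r \<longrightarrow> g \<in> U)"
    if "f \<in> mspace (C0 T)" for f using that by simp
  then show ?thesis unfolding mtopology_of_def openin_mtopology Ball_def subset_iff by blast
qed

lemma sets_path_borel_openin:
  "openin (mtopology_of (C0 T)) U \<Longrightarrow> U \<in> sets (path_borel T)"
  unfolding path_borel_def
  by (subst sets_measure_of[OF open_C0_subset]) auto

lemma measurable_eval_path_borel:
  assumes t: "t \<in> {0..T}"
  shows "(\<lambda>f. f t :: 'b::euclidean_space) \<in> borel_measurable (path_borel T)"
proof (rule borel_measurableI)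
  fix V :: "'b set" assume "open V"
  have "openin (mtopology_of (C0 T)) {f \<in> mspace (C0 T). f t \<in> V}"
    unfolding openin_C0_iff
  proof (intro conjI ballI)
    fix f assume f: "f \<in> {f \<in> mspace (C0 T). f t \<in> V}"
    then obtain e where e: "e > 0" "\<And>y. dist y (f t) < e \<Longrightarrow> y \<in> V"
      using \<open>open V\<close> by (auto simp: open_dist)
    have "g t \<in> V" if g: "g \<in> mspace (C0 T)" "mdist (C0 T) f g < e" for g
    proof -
      have "dist (f t) (g t) \<le> mdist (C0 T) f g"
        using mdist_C0_le[of T f g "mdist (C0 T) f g"] f g t by auto
      with g(2) show ?thesis by (intro e) (simp add: dist_commute)
    qed
    with e(1) show "\<exists>r>0. \<forall>g\<in>mspace (C0 T). mdist (C0 T) f g < r \<longrightarrow> g \<in> {f \<in> mspace (C0 T). f t \<in> V}"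
      by blast
  qed auto
  from sets_path_borel_openin[OF this]
  show "(\<lambda>f. f t) -` V \<inter> space (path_borel T) \<in> sets (path_borel T)"
    by (simp add: space_path_borel vimage_def Int_def conj_commute)
qed

lemma measurable_path_borel_eval:
  assumes "X \<in> measurable M (path_borel T)" "t \<in> {0..T}"
  shows "(\<lambda>\<omega>. X \<omega> t :: 'b::euclidean_space) \<in> borel_measurable M"
  using measurable_compose[OF assms(1) measurable_eval_path_borel[OF assms(2)]] .

lemma continuous_on_le_dense:
  fixes f :: "real \<Rightarrow> real"
  assumes "continuous_on {a..b} f" "S \<subseteq> {a..b}" "{a..b} \<subseteq> closure S"
    and "\<And>s. s \<in> S \<Longrightarrow> f s \<le> c" "t \<in> {a..b}"
  shows "f t \<le> c"
proof -
  have "closure S = {a..b}"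
    using assms(2,3) closure_minimal[of S "{a..b}"] by auto
  then show ?thesis using continuous_le_on_closure[of S f t c] assms by auto
qed

text \<open>
  The path space is covered by countably many sets \<open>B i\<close> of paths that stay close to a given
  step function, and these have arbitrarily small diameter. Hence open sets are countable unions
  of sets that are determined by countably many evaluations.
\<close>

lemma measurable_path_borelI:
  fixes X :: "'w \<Rightarrow> real \<Rightarrow> 'b::euclidean_space"
  assumes T: "0 \<le> T" and X: "\<And>\<omega>. \<omega> \<in> space M \<Longrightarrow> X \<omega> \<in> mspace (C0 T)"
    and meas: "\<And>t. t \<in> {0..T} \<Longrightarrow> (\<lambda>\<omega>. X \<omega> t) \<in> borel_measurable M"
  shows "X \<in> measurable M (path_borel T)"
  unfolding path_borel_def
proof (rule measurable_measure_of)
  show "{U. openin (mtopology_of (C0 T :: (real \<Rightarrow> 'b) metric)) U} \<subseteq> Pow (mspace (C0 T))"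
    by (rule open_C0_subset)
  show "X \<in> space M \<rightarrow> mspace (C0 T)" using X by auto
  fix U :: "(real \<Rightarrow> 'b) set" assume "U \<in> {U. openin (mtopology_of (C0 T)) U}"
  then have U: "U \<subseteq> mspace (C0 T)"
    "\<And>f. f \<in> U \<Longrightarrow> \<exists>r>0. \<forall>g\<in>mspace (C0 T). mdist (C0 T) f g < r \<longrightarrow> g \<in> U"
    by (auto simp: openin_C0_iff)
  obtain Q :: "'b set" where Q: "countable Q" "\<And>X. open X \<Longrightarrow> X \<noteq> {} \<Longrightarrow> \<exists>d\<in>Q. d \<in> X"
    using countable_dense_setE by blast
  obtain S where S: "countable S" "S \<subseteq> {0..T}" "{0..T} \<subseteq> closure S"
    using separable[of "{0..T}"] by blast
  \<comment> \<open>\<open>k\<close> is the precision, \<open>n\<close> the mesh and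
    \<open>v\<close> the list of values of the step function. Closeness is tested only at times in
    the countable dense set \<open>S\<close>; this keeps the preimage of \<open>B i\<close>
    measurable and by continuity still bounds the distance of two members on all of
    \<open>{0..T}\<close>.\<close>
  define B where "B = (\<lambda>(k::nat, n::nat, v :: 'b list). {f \<in> mspace (C0 T).
      \<forall>s\<in>S. dist (f s) (v ! nat \<lfloor>s * real n\<rfloor>) \<le> 1 / (real k + 1)})"
  define I where "I = (UNIV :: nat set) \<times> (UNIV :: nat set) \<times> lists Q"
  have I: "countable I" unfolding I_def using Q by auto
  have diam: "dist (f t) (g t) \<le> 2 / (real k + 1)"
    if "f \<in> B (k, n, v)" "g \<in> B (k, n, v)" "t \<in> {0..T}" for f g k n v t
  proof (rule continuous_on_le_dense[OF _ S(2) S(3), where f = "\<lambda>t. dist (f t) (g t)"])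
    show "continuous_on {0..T} (\<lambda>t. dist (f t) (g t))"
      using that by (auto intro!: continuous_intros simp: B_def mspace_C0_iff)
    show "dist (f s) (g s) \<le> 2 / (real k + 1)" if s: "s \<in> S" for s
    proof -
      have "dist (f s) (v ! nat \<lfloor>s * real n\<rfloor>) \<le> 1 / (real k + 1)"
        "dist (g s) (v ! nat \<lfloor>s * real n\<rfloor>) \<le> 1 / (real k + 1)"
        using \<open>f \<in> B (k, n, v)\<close> \<open>g \<in> B (k, n, v)\<close> s by (auto simp: B_def)
      then show ?thesis
        using dist_triangle2[of "f s" "g s" "v ! nat \<lfloor>s * real n\<rfloor>"] by simp
    qed
  qed (use that in auto)
  have ex: "\<exists>n v. v \<in> lists Q \<and> f \<in> B (k, n, v)" if f: "f \<in> mspace (C0 T)" for f k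
  proof -
    \<comment> \<open>Half the precision: one \<open>e\<close> for moving from \<open>s\<close> to
      the grid point below it, one for replacing the value there by a point of
      \<open>Q\<close>.\<close>
    define e where "e = 1 / (2 * (real k + 1))"
    have e: "e > 0" by (simp add: e_def)
    have "uniformly_continuous_on {0..T} f"
      using f by (intro compact_uniformly_continuous) (auto simp: mspace_C0_iff)
    then obtain d where d: "d > 0" "\<And>s t. s \<in> {0..T} \<Longrightarrow> t \<in> {0..T} \<Longrightarrow> dist s t < d \<Longrightarrow> dist (f s) (f t) < e"
      using e unfolding uniformly_continuous_on_def by metis
    obtain n :: nat where n: "n > 0" "1 / real n < d"
      using real_arch_inverse[of d] d(1) by (auto simp: inverse_eq_divide)
    have "\<exists>q\<in>Q. dist (f (real j / real n)) q < e" for j :: nat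
      using Q(2)[of "ball (f (real j / real n)) e"] e by auto
    then obtain q where q: "\<And>j::nat. q j \<in> Q" "\<And>j::nat. dist (f (real j / real n)) (q j) < e"
      by metis
    \<comment> \<open>\<open>Suc\<close> makes room for the index reached at the right endpoint
      \<open>T\<close>.\<close>
    define v where "v = map q [0..<Suc (nat \<lfloor>T * real n\<rfloor>)]"
    have "dist (f s) (v ! nat \<lfloor>s * real n\<rfloor>) \<le> 1 / (real k + 1)" if s: "s \<in> S" for s
    proof -
      have sT: "0 \<le> s" "s \<le> T" using s S(2) by auto
      define j where "j = nat \<lfloor>s * real n\<rfloor>"
      have "j \<le> nat \<lfloor>T * real n\<rfloor>" unfolding j_def using sT by (intro nat_mono floor_mono mult_right_mono) auto
      then have vj: "v ! j = q j" unfolding v_def by (subst nth_map) (auto simp del: upt_Suc)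
      have rj: "real j = of_int \<lfloor>s * real n\<rfloor>" unfolding j_def using sT by simp
      then have "real j \<le> s * real n" "s * real n < real j + 1" by linarith+
      then have j1: "real j / real n \<le> s" "s < (real j + 1) / real n"
        using n(1) by (simp_all add: pos_divide_le_eq pos_less_divide_eq)
      then have j2: "s - real j / real n < 1 / real n" by (simp add: add_divide_distrib)
      have "dist (f s) (f (real j / real n)) < e"
        using j1(1) j2 sT n(2) by (intro d(2)) (auto simp: dist_real_def)
      with q(2)[of j] have "dist (f s) (q j) < e + e"
        using dist_triangle_less_add[of "f s" "f (real j / real n)" e "q j" e] by (simp add: dist_commute)
      moreover have "e + e = 1 / (real k + 1)" by (simp add: e_def field_simps)
      ultimately show ?thesis unfolding j_def[symmetric] vj by simp
    qed
    moreover have "v \<in> lists Q" using q(1) by (auto simp: v_def)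
    ultimately show ?thesis using f by (auto simp: B_def)
  qed
  have U_eq: "U = (\<Union>i\<in>{i\<in>I. B i \<subseteq> U}. B i)"
  proof (intro equalityI subsetI)
    fix f assume f: "f \<in> U"
    then obtain r where r: "r > 0" "\<And>g. g \<in> mspace (C0 T) \<Longrightarrow> mdist (C0 T) f g < r \<Longrightarrow> g \<in> U"
      using U(2) by blast
    obtain k :: nat where k: "k > 0" "1 / real k < r / 2"
      using real_arch_inverse[of "r/2"] r(1) by (auto simp: inverse_eq_divide)
    obtain n v where nv: "v \<in> lists Q" "f \<in> B (k, n, v)" using ex[of f k] f U(1) by auto
    have "B (k, n, v) \<subseteq> U"
    proof
      fix g assume g: "g \<in> B (k, n, v)"
      have gf: "g \<in> mspace (C0 T)" "f \<in> mspace (C0 T)" using g f U(1) by (auto simp: B_def)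
      have "mdist (C0 T) f g \<le> 2 / (real k + 1)"
        using diam[OF nv(2) g] mdist_C0_le[OF T gf(2,1)] by auto
      also have "\<dots> \<le> 2 / real k" using k(1) by (intro divide_left_mono) auto
      also have "\<dots> < r" using k(2) by simp
      finally show "g \<in> U" using r(2) gf by auto
    qed
    then show "f \<in> (\<Union>i\<in>{i\<in>I. B i \<subseteq> U}. B i)" using nv by (auto simp: I_def)
  qed auto
  have "X -` U \<inter> space M = (\<Union>i\<in>{i\<in>I. B i \<subseteq> U}. {\<omega>\<in>space M. X \<omega> \<in> B i})"
    by (subst U_eq) auto
  also have "\<dots> \<in> sets M"
  proof (rule sets.countable_UN'')
    show "countable {i\<in>I. B i \<subseteq> U}" using I by (rule countable_subset[rotated]) auto
    fix i assume "i \<in> {i\<in>I. B i \<subseteq> U}"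
    obtain k n v where i: "i = (k, n, v)" by (cases i)
    have "{\<omega>\<in>space M. X \<omega> \<in> B i} =
        {\<omega>\<in>space M. \<forall>s\<in>S. dist (X \<omega> s) (v ! nat \<lfloor>s * real n\<rfloor>) \<le> 1 / (real k + 1)}"
      using X by (auto simp: B_def i)
    also have "\<dots> \<in> sets M"
    proof (rule sets.sets_Collect_countable_All'[OF _ S(1)])
      fix s assume "s \<in> S"
      then have [measurable]: "(\<lambda>\<omega>. X \<omega> s) \<in> borel_measurable M" using meas S(2) by auto
      show "{\<omega>\<in>space M. dist (X \<omega> s) (v ! nat \<lfloor>s * real n\<rfloor>) \<le> 1 / (real k + 1)} \<in> sets M"
        by measurable
    qed
    finally show "{\<omega>\<in>space M. X \<omega> \<in> B i} \<in> sets M" .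
  qed
  finally show "X -` U \<inter> space M \<in> sets M" .
qed

section \<open>The supremum norm and the time marginals\<close>

lemma path_norm_le_iff:
  assumes T: "0 \<le> T" and f: "continuous_on {0..T} f"
  shows "path_norm T f \<le> c \<longleftrightarrow> (\<forall>t\<in>{0..T}. norm (f t) \<le> c)"
proof -
  have "bdd_above ((\<lambda>t. norm (f t)) ` {0..T})"
    using f by (intro bounded_imp_bdd_above compact_imp_bounded compact_continuous_image continuous_intros) auto
  then show ?thesis unfolding path_norm_def using T by (subst cSUP_le_iff) auto
qed

lemma norm_le_path_norm:
  assumes "continuous_on {0..T} f" "t \<in> {0..T}"
  shows "norm (f t) \<le> path_norm T f"
  using path_norm_le_iff[of T f "path_norm T f"] assms by auto

lemma path_norm_nonneg:
  assumes "0 \<le> T" "continuous_on {0..T} f"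
  shows "0 \<le> path_norm T f"
proof -
  have "norm (f 0) \<le> path_norm T f" using assms by (intro norm_le_path_norm) auto
  then show ?thesis using norm_ge_zero[of "f 0"] by linarith
qed

text \<open>By continuity the bound need only be checked at countably many times.\<close>

lemma measurable_path_norm:
  assumes T: "0 \<le> T"
  shows "(path_norm T :: (real \<Rightarrow> 'b::euclidean_space) \<Rightarrow> real) \<in> borel_measurable (path_borel T)"
proof (rule borel_measurableI_le)
  fix c :: real
  obtain S where S: "countable S" "S \<subseteq> {0..T}" "{0..T} \<subseteq> closure S"
    using separable[of "{0..T}"] by blast
  have "(\<forall>t\<in>{0..T}. norm (f t) \<le> c) \<longleftrightarrow> (\<forall>t\<in>S. norm (f t) \<le> c)"
    if "f \<in> mspace (C0 T)" for f :: "real \<Rightarrow> 'b"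
  proof -
    have "continuous_on {0..T} (\<lambda>t. norm (f t))"
      using that by (auto simp: mspace_C0_iff intro: continuous_on_norm)
    from continuous_on_le_dense[OF this S(2,3)] show ?thesis using S(2) by blast
  qed
  then have "{f \<in> space (path_borel T). path_norm T (f :: real \<Rightarrow> 'b) \<le> c}
      = {f \<in> space (path_borel T). \<forall>t\<in>S. norm (f t) \<le> c}"
    using path_norm_le_iff[OF T] by (auto simp: space_path_borel mspace_C0_iff)
  also have "\<dots> \<in> sets (path_borel T)"
  proof (rule sets.sets_Collect_countable_All'[OF _ S(1)])
    fix s assume "s \<in> S"
    then have [measurable]: "(\<lambda>f. f s :: 'b) \<in> borel_measurable (path_borel T)"
      using S(2) by (intro measurable_eval_path_borel) auto
    show "{f \<in> space (path_borel T). norm (f s :: 'b) \<le> c} \<in> sets (path_borel T)" by measurable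
  qed
  finally show "{f \<in> space (path_borel T). path_norm T (f :: real \<Rightarrow> 'b) \<le> c} \<in> sets (path_borel T)" .
qed

lemma marginal_path_law:
  assumes "X \<in> measurable M (path_borel T)" "t \<in> {0..T}"
  shows "marginal (path_law M T X) t = distr M borel (\<lambda>\<omega>. X \<omega> t)"
  unfolding marginal_def path_law_def
  by (subst distr_distr) (use assms measurable_eval_path_borel in \<open>auto simp: comp_def\<close>)

section \<open>Moments of the running maximum of Brownian motion\<close>

text \<open>An even grid point of level \<open>n + 1\<close> already belongs to level
  \<open>n\<close>, and an odd one is a single increment away from its even left neighbour. Each
  level therefore adds its increment bound only once.\<close>

lemma dyadic_chaining_grid:
  fixes f :: "real \<Rightarrow> 'b::real_normed_vector"
  assumes f0: "f 0 = 0" and b: "0 \<le> b"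
    and inc: "\<And>n k. k < 2 ^ n \<Longrightarrow>
      norm (f (real (Suc k) * T / 2 ^ n) - f (real k * T / 2 ^ n)) \<le> b * c ^ n"
    and c: "0 \<le> c"
  shows "j \<le> 2 ^ n \<Longrightarrow> norm (f (real j * T / 2 ^ n)) \<le> b * (\<Sum>i\<le>n. c ^ i)"
proof (induction n arbitrary: j)
  case 0
  then consider "j = 0" | "j = 1" by fastforce
  then show ?case
  proof cases
    case 1 then show ?thesis using f0 b by simp
  next
    case 2 then show ?thesis using inc[of 0 0] f0 by simp
  qed
next
  case (Suc n)
  define k where "k = j div 2"
  have k: "k \<le> 2 ^ n" using Suc.prems by (simp add: k_def)
  have half: "real (2 * k) * T / 2 ^ Suc n = real k * T / 2 ^ n" by simp
  have IH: "norm (f (real (2 * k) * T / 2 ^ Suc n)) \<le> b * (\<Sum>i\<le>n. c ^ i)"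
    using Suc.IH[OF k] half by simp
  show ?case
  proof (cases "even j")
    case True
    then have "j = 2 * k" by (simp add: k_def)
    then have "norm (f (real j * T / 2 ^ Suc n)) \<le> b * (\<Sum>i\<le>n. c ^ i)" using IH by simp
    also have "\<dots> \<le> b * (\<Sum>i\<le>Suc n. c ^ i)"
      using b c by (intro mult_left_mono) auto
    finally show ?thesis .
  next
    case False
    then have j: "j = Suc (2 * k)" by (simp add: k_def)
    then have "2 * k < 2 ^ Suc n" using Suc.prems by simp
    from inc[OF this]
    have "norm (f (real j * T / 2 ^ Suc n) - f (real (2 * k) * T / 2 ^ Suc n)) \<le> b * c ^ Suc n"
      using j by simp
    then have "norm (f (real j * T / 2 ^ Suc n)) \<le> b * c ^ Suc n + b * (\<Sum>i\<le>n. c ^ i)"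
      using IH norm_triangle_sub[of "f (real j * T / 2 ^ Suc n)" "f (real (2 * k) * T / 2 ^ Suc n)"]
      by linarith
    then show ?thesis by (simp add: algebra_simps)
  qed
qed

text \<open>The factor 6 is the sum of the geometric series with ratio 5/6. The dyadic points just
  below \<open>t\<close> converge to \<open>t\<close>, so continuity carries the bound from the grid
  to every time. The ratio exceeds 1 / sqrt 2, the scaling of Brownian increments under halving of
  the step, which is what lets the moment series below converge.\<close>

lemma dyadic_chaining:
  fixes f :: "real \<Rightarrow> 'b::real_normed_vector"
  assumes T: "T > 0" and f: "continuous_on {0..T} f" "f 0 = 0" and b: "0 \<le> b"
    and inc: "\<And>n k. k < 2 ^ n \<Longrightarrow>
      norm (f (real (Suc k) * T / 2 ^ n) - f (real k * T / 2 ^ n)) \<le> b * (5 / 6) ^ n"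
    and t: "t \<in> {0..T}"
  shows "norm (f t) \<le> 6 * b"
proof -
  define s where "s n = real (nat \<lfloor>t / T * 2 ^ n\<rfloor>) * T / 2 ^ n" for n
  have tT: "0 \<le> t / T" "t / T \<le> 1" using t T by auto
  have j: "nat \<lfloor>t / T * 2 ^ n\<rfloor> \<le> 2 ^ n" for n
  proof -
    have "t / T * 2 ^ n \<le> 1 * 2 ^ n" by (rule mult_right_mono[OF tT(2)]) simp
    then have "\<lfloor>t / T * 2 ^ n\<rfloor> \<le> 2 ^ n" by (simp add: floor_le_iff)
    then show ?thesis by (simp add: nat_le_iff)
  qed
  have b1: "norm (f (s n)) \<le> 6 * b" for n
  proof -
    have "norm (f (s n)) \<le> b * (\<Sum>i\<le>n. (5 / 6) ^ i)"
      unfolding s_def by (rule dyadic_chaining_grid[OF f(2) b inc]) (use j in auto)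
    also have "b * (\<Sum>i\<le>n. (5 / 6 :: real) ^ i) \<le> b * 6"
      by (intro mult_left_mono b) (subst sum_gp0, simp add: field_simps)
    finally have "norm (f (s n)) \<le> b * 6" .
    then show ?thesis by (simp add: mult.commute)
  qed
  have dist: "\<bar>s n - t\<bar> \<le> T * (1 / 2) ^ n" for n
  proof -
    have "0 \<le> t / T * 2 ^ n" using tT(1) by (rule mult_nonneg_nonneg) simp
    then have "real (nat \<lfloor>t / T * 2 ^ n\<rfloor>) = of_int \<lfloor>t / T * 2 ^ n\<rfloor>"
      by (intro of_nat_nat) (simp only: zero_le_floor)
    then have "\<bar>real (nat \<lfloor>t / T * 2 ^ n\<rfloor>) - t / T * 2 ^ n\<bar> \<le> 1" by linarith
    then have "\<bar>real (nat \<lfloor>t / T * 2 ^ n\<rfloor>) - t / T * 2 ^ n\<bar> * (T / 2 ^ n) \<le> 1 * (T / 2 ^ n)"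
      using T by (intro mult_right_mono) auto
    moreover have "\<bar>real (nat \<lfloor>t / T * 2 ^ n\<rfloor>) - t / T * 2 ^ n\<bar> * (T / 2 ^ n) = \<bar>s n - t\<bar>"
    proof -
      have "\<bar>x\<bar> * y = \<bar>x * y\<bar>" if "y \<ge> 0" for x y :: real using that by (simp add: abs_mult)
      moreover have "(real (nat \<lfloor>t / T * 2 ^ n\<rfloor>) - t / T * 2 ^ n) * (T / 2 ^ n) = s n - t"
        using T by (simp add: s_def left_diff_distrib diff_divide_distrib)
      moreover have "T / 2 ^ n \<ge> 0" using T by simp
      ultimately show ?thesis by (simp only:)
    qed
    ultimately show ?thesis by (simp add: power_one_over)
  qed
  have "(\<lambda>n. s n - t) \<longlonglongrightarrow> 0"
  proof (rule Lim_null_comparison)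
    show "\<forall>\<^sub>F n in sequentially. norm (s n - t) \<le> T * (1 / 2) ^ n" using dist by auto
    show "(\<lambda>n. T * (1 / 2) ^ n) \<longlonglongrightarrow> 0"
      by (intro tendsto_mult_right_zero LIMSEQ_power_zero) auto
  qed
  then have lim: "s \<longlonglongrightarrow> t" by (simp add: LIM_zero_iff)
  have sT: "s n \<in> {0..T}" for n
  proof -
    have "real (nat \<lfloor>t / T * 2 ^ n\<rfloor>) \<le> 2 ^ n" using j[of n] by (metis of_nat_le_iff of_nat_numeral of_nat_power)
    then show ?thesis using T by (auto simp: s_def field_simps)
  qed
  have "(\<lambda>n. f (s n)) \<longlonglongrightarrow> f t"
    using f(1) lim sT t by (auto simp: continuous_on_sequentially comp_def)
  then have "(\<lambda>n. norm (f (s n))) \<longlonglongrightarrow> norm (f t)" by (rule tendsto_norm)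
  then show ?thesis using b1 by (intro Lim_bounded[where M = 0]) auto
qed

text \<open>Each coordinate is at most the largest one in modulus, whose power is itself a term of
  the sum.\<close>

lemma norm_power_le_sum_inner:
  fixes x :: "'b::euclidean_space"
  shows "norm x ^ n \<le> real DIM('b) ^ n * (\<Sum>b\<in>Basis. \<bar>x \<bullet> b\<bar> ^ n)"
proof -
  define m where "m = Max ((\<lambda>b. \<bar>x \<bullet> b\<bar>) ` Basis)"
  have "m \<in> (\<lambda>b. \<bar>x \<bullet> b\<bar>) ` Basis" unfolding m_def by (intro Max_in) auto
  then obtain b where b: "b \<in> Basis" "m = \<bar>x \<bullet> b\<bar>" by auto
  have "norm x \<le> (\<Sum>b\<in>Basis. \<bar>x \<bullet> b\<bar>)" by (rule norm_le_l1)
  also have "\<dots> \<le> (\<Sum>b\<in>(Basis::'b set). m)" by (intro sum_mono) (auto simp: m_def)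
  finally have "norm x ^ n \<le> (real DIM('b) * m) ^ n" by (intro power_mono) auto
  also have "\<dots> = real DIM('b) ^ n * \<bar>x \<bullet> b\<bar> ^ n" by (simp add: power_mult_distrib b)
  also have "\<dots> \<le> real DIM('b) ^ n * (\<Sum>b\<in>Basis. \<bar>x \<bullet> b\<bar> ^ n)"
    using b by (intro mult_left_mono member_le_sum) auto
  finally show ?thesis .
qed

text \<open>The factor is the double factorial of 2k - 1. At \<open>k = 0\<close> the formula says
  that the density has mass 1, which serves the remaining coordinates in the vector case.\<close>

lemma nn_integral_normal_density_even_moment:
  assumes "h > 0"
  shows "(\<integral>\<^sup>+ y. ennreal (normal_density 0 (sqrt h) y * y ^ (2 * k)) \<partial>lborel)
       = ennreal (fact (2 * k) / (2 ^ k * fact k) * h ^ k)"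
proof -
  have "has_bochner_integral lborel (\<lambda>y. normal_density 0 (sqrt h) y * (y - 0) ^ (2 * k))
     (fact (2 * k) / ((2 / (sqrt h)\<^sup>2) ^ k * fact k))"
    by (rule normal_moment_even) (use assms in auto)
  moreover have "fact (2 * k) / ((2 / (sqrt h)\<^sup>2) ^ k * fact k) = fact (2 * k) / (2 ^ k * fact k) * h ^ k"
    using assms by (simp add: power_divide)
  ultimately have *: "has_bochner_integral lborel (\<lambda>y. normal_density 0 (sqrt h) y * y ^ (2 * k))
     (fact (2 * k) / (2 ^ k * fact k) * h ^ k)" by simp
  show ?thesis
    by (subst nn_integral_eq_integral)
      (use * in \<open>auto simp: has_bochner_integral_iff intro!: mult_nonneg_nonneg\<close>)
qed

text \<open>The density is a product over coordinates, so the moment of one coordinate splits into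
  one-dimensional integrals. The power 2k of the dimension comes from comparing the norm with the
  coordinates, one more factor from summing over them.\<close>

lemma gaussian_vector_even_moment:
  fixes Z :: "'w \<Rightarrow> 'b::euclidean_space"
  assumes Z: "distributed M lborel Z (\<lambda>x. ennreal (\<Prod>b\<in>Basis. normal_density 0 (sqrt h) (x \<bullet> b)))"
    and h: "h > 0"
  shows "(\<integral>\<^sup>+ \<omega>. ennreal (norm (Z \<omega>) ^ (2 * k)) \<partial>M)
    \<le> ennreal (real DIM('b) ^ (2 * k + 1) * (fact (2 * k) / (2 ^ k * fact k)) * h ^ k)"
proof -
  define D where "D = (\<lambda>x::'b. \<Prod>b\<in>Basis. normal_density 0 (sqrt h) (x \<bullet> b))"
  define m where "m = fact (2 * k) / (2 ^ k * fact k) * h ^ k"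
  have m: "m \<ge> 0" using h by (simp add: m_def)
  have D0: "D x \<ge> 0" for x unfolding D_def by (intro prod_nonneg) auto
  have [measurable]: "D \<in> borel_measurable borel" unfolding D_def by measurable
  have comp: "(\<integral>\<^sup>+ x. ennreal (D x * \<bar>x \<bullet> b\<bar> ^ (2 * k)) \<partial>lborel) = ennreal m" if b: "b \<in> Basis" for b :: 'b
  proof -
    \<comment> \<open>The power of the coordinate \<open>b\<close> is attached to the factor with
      that index; all other factors remain plain densities of mass 1.\<close>
    define f where "f = (\<lambda>b' y. normal_density 0 (sqrt h) y * (if b' = b then y ^ (2 * k) else 1))"
    have f0: "f b' y \<ge> 0" for b' y by (simp add: f_def)
    have [measurable]: "f b' \<in> borel_measurable borel" for b' unfolding f_def by measurable
    have "ennreal (D x * \<bar>x \<bullet> b\<bar> ^ (2 * k)) = (\<Prod>b'\<in>Basis. ennreal (f b' (x \<bullet> b')))" for x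
    proof -
      have "(\<Prod>b'\<in>Basis. f b' (x \<bullet> b')) = D x * (\<Prod>b'\<in>Basis. if b' = b then (x \<bullet> b') ^ (2 * k) else 1)"
        by (simp add: f_def D_def prod.distrib)
      also have "\<dots> = D x * \<bar>x \<bullet> b\<bar> ^ (2 * k)"
        using b by (subst prod.delta) (auto simp: power_mult)
      finally show ?thesis by (subst prod_ennreal) (auto simp: f0)
    qed
    then have "(\<integral>\<^sup>+ x. ennreal (D x * \<bar>x \<bullet> b\<bar> ^ (2 * k)) \<partial>lborel)
        = (\<integral>\<^sup>+ x. (\<Prod>b'\<in>Basis. ennreal (f b' (x \<bullet> b'))) \<partial>(lborel :: 'b measure))" by simp
    also have "\<dots> = (\<Prod>b'\<in>(Basis :: 'b set). \<integral>\<^sup>+ y. ennreal (f b' y) \<partial>lborel)"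
      by (subst nn_integral_lborel_prod) auto
    also have "\<dots> = (\<Prod>b'\<in>(Basis :: 'b set). if b' = b then ennreal m else 1)"
    proof (rule prod.cong[OF refl])
      fix b' :: 'b
      show "(\<integral>\<^sup>+ y. ennreal (f b' y) \<partial>lborel) = (if b' = b then ennreal m else 1)"
        using nn_integral_normal_density_even_moment[OF h, of k]
          nn_integral_normal_density_even_moment[OF h, of 0]
        by (simp add: f_def m_def)
    qed
    also have "\<dots> = ennreal m" using b by (subst prod.delta) auto
    finally show ?thesis .
  qed
  have "(\<integral>\<^sup>+ \<omega>. ennreal (norm (Z \<omega>) ^ (2 * k)) \<partial>M) = (\<integral>\<^sup>+ x. ennreal (D x) * ennreal (norm x ^ (2 * k)) \<partial>lborel)"
    using distributed_nn_integral[OF Z, of "\<lambda>x. ennreal (norm x ^ (2 * k))"] by (simp add: D_def)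
  also have "\<dots> \<le> (\<integral>\<^sup>+ x. (\<Sum>b\<in>Basis. ennreal (real DIM('b) ^ (2 * k)) * ennreal (D x * \<bar>x \<bullet> b\<bar> ^ (2 * k))) \<partial>(lborel :: 'b measure))"
  proof (rule nn_integral_mono)
    fix x :: 'b
    have "D x * norm x ^ (2 * k) \<le> D x * (real DIM('b) ^ (2 * k) * (\<Sum>b\<in>Basis. \<bar>x \<bullet> b\<bar> ^ (2 * k)))"
      using D0 by (intro mult_left_mono norm_power_le_sum_inner)
    also have "\<dots> = (\<Sum>b\<in>Basis. real DIM('b) ^ (2 * k) * (D x * \<bar>x \<bullet> b\<bar> ^ (2 * k)))"
      by (simp add: sum_distrib_left mult_ac)
    finally have "ennreal (D x * norm x ^ (2 * k)) \<le> ennreal (\<Sum>b\<in>Basis. real DIM('b) ^ (2 * k) * (D x * \<bar>x \<bullet> b\<bar> ^ (2 * k)))"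
      by (rule ennreal_leI)
    then show "ennreal (D x) * ennreal (norm x ^ (2 * k)) \<le>
        (\<Sum>b\<in>Basis. ennreal (real DIM('b) ^ (2 * k)) * ennreal (D x * \<bar>x \<bullet> b\<bar> ^ (2 * k)))"
      using D0 by (simp add: ennreal_mult[symmetric] sum_ennreal[symmetric] del: sum_ennreal)
  qed
  also have "\<dots> = (\<Sum>b\<in>(Basis :: 'b set). ennreal (real DIM('b) ^ (2 * k)) * ennreal m)"
    by (subst nn_integral_sum) (auto simp: nn_integral_cmult comp)
  also have "\<dots> = ennreal (real DIM('b) * (real DIM('b) ^ (2 * k) * m))"
    using m by (simp add: ennreal_mult[symmetric] ennreal_of_nat_eq_real_of_nat)
  also have "real DIM('b) * (real DIM('b) ^ (2 * k) * m)
      = real DIM('b) ^ (2 * k + 1) * (fact (2 * k) / (2 ^ k * fact k)) * h ^ k"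
    by (simp add: m_def)
  finally show ?thesis .
qed

text \<open>\<open>R\<close> is a constant times the sum of all dyadic increments to the power 2k,
  with weight \<open>((6/5) ^ n) ^ (2 * k)\<close> at level \<open>n\<close>. If the sum is
  \<open>r\<close>, every increment of level \<open>n\<close> is at most the 2k-th root of
  \<open>r\<close> times \<open>(5/6) ^ n\<close>, as chaining requires; where the sum is infinite
  the bound is trivial. A countable sum of measurable terms is measurable, so no supremum over
  uncountably many times enters.\<close>

lemma brownian_motion_sup_moment:
  fixes W :: "real \<Rightarrow> 'w \<Rightarrow> 'b::euclidean_space"
  assumes bm: "brownian_motion M F T W" and T: "T > 0" and k: "k \<ge> 3"
  defines "G \<equiv> real DIM('b) ^ (2 * k + 1) * (fact (2 * k) / (2 ^ k * fact k))"
  obtains R where "R \<in> borel_measurable M"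
    "(\<integral>\<^sup>+ \<omega>. R \<omega> \<partial>M) \<le> ennreal (6 ^ (2 * k) * (G * T ^ k / (1 - 2 * (18 / 25) ^ k)))"
    "AE \<omega> in M. \<forall>t\<in>{0..T}. ennreal (norm (W t \<omega>) ^ (2 * k)) \<le> R \<omega>"
proof -
  define \<Delta> where "\<Delta> n j \<omega> = W (real (Suc j) * T / 2 ^ n) \<omega> - W (real j * T / 2 ^ n) \<omega>" for n j \<omega>
  let ?D = "\<lambda>n j \<omega>. norm (\<Delta> n j \<omega>) ^ (2 * k) * ((6/5) ^ n) ^ (2 * k)"
  \<comment> \<open>The expected contribution of level \<open>n\<close> is proportional to
    \<open>q ^ n\<close>: there are \<open>2 ^ n\<close> increments, each contributing
    \<open>((1/2) ^ k) ^ n\<close> from the variance and \<open>((36/25) ^ k) ^ n\<close> from the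
    weight. Three is the least \<open>k\<close> for which \<open>q < 1\<close>.\<close>
  define q where "q = 2 * (18 / 25 :: real) ^ k"
  define A where "A n \<omega> = (\<Sum>j<2^n. ennreal (?D n j \<omega>))" for n \<omega>
  define R where "R \<omega> = 6 ^ (2 * k) * (\<Sum>n. A n \<omega>)" for \<omega>
  have G: "G \<ge> 0" by (simp add: G_def)
  have q: "0 \<le> q" "q < 1"
  proof -
    have "(18 / 25 :: real) ^ k \<le> (18 / 25) ^ 3" using k by (intro power_decreasing) auto
    also have "\<dots> < 1 / 2" by (simp add: power3_eq_cube)
    finally show "q < 1" by (simp add: q_def)
  qed (simp add: q_def)
  have dist: "distributed M lborel (\<Delta> n j) (\<lambda>x. ennreal (\<Prod>b\<in>Basis. normal_density 0 (sqrt (T / 2 ^ n)) (x \<bullet> b)))"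
    if j: "j < 2 ^ n" for n j
  proof -
    define s t where "s = real j * T / 2 ^ n" and "t = real (Suc j) * T / 2 ^ n"
    have "real (Suc j) \<le> 2 ^ n" using j by (metis Suc_leI of_nat_le_iff of_nat_numeral of_nat_power)
    then have "real (Suc j) * T / 2 ^ n \<le> 2 ^ n * T / 2 ^ n"
      using T by (intro divide_right_mono mult_right_mono) auto
    then have "0 \<le> s" "s < t" "t \<le> T" using T by (auto simp: s_def t_def field_simps)
    then have "distributed M lborel (\<lambda>\<omega>. W t \<omega> - W s \<omega>)
        (\<lambda>x. ennreal (\<Prod>b\<in>Basis. normal_density 0 (sqrt (t - s)) (x \<bullet> b)))"
      using bm unfolding brownian_motion_def by blast
    moreover have "t - s = T / 2 ^ n" by (simp add: s_def t_def field_simps)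
    ultimately show ?thesis by (simp add: \<Delta>_def[abs_def] s_def t_def)
  qed
  have meas[measurable]: "\<Delta> n j \<in> borel_measurable M" if "j < 2 ^ n" for n j
    using distributed_measurable[OF dist[OF that]] by simp
  have Am[measurable]: "A n \<in> borel_measurable M" for n
    unfolding A_def by (intro borel_measurable_sum) auto
  have EA: "(\<integral>\<^sup>+ \<omega>. A n \<omega> \<partial>M) \<le> ennreal (G * T ^ k * q ^ n)" for n
  proof -
    have "(\<integral>\<^sup>+ \<omega>. A n \<omega> \<partial>M) = (\<Sum>j<2^n. \<integral>\<^sup>+ \<omega>. ennreal (?D n j \<omega>) \<partial>M)"
      unfolding A_def by (rule nn_integral_sum) auto
    also have "\<dots> \<le> (\<Sum>j<(2::nat)^n. ennreal (G * (T / 2 ^ n) ^ k * ((6/5) ^ n) ^ (2 * k)))"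
    proof (rule sum_mono)
      fix j :: nat assume "j \<in> {..<2 ^ n}"
      then have j: "j < 2 ^ n" by simp
      have "(\<integral>\<^sup>+ \<omega>. ennreal (?D n j \<omega>) \<partial>M)
         = (\<integral>\<^sup>+ \<omega>. ennreal (norm (\<Delta> n j \<omega>) ^ (2 * k)) \<partial>M) * ennreal (((6/5) ^ n) ^ (2 * k))"
        using j by (subst nn_integral_multc[symmetric]) (auto simp: ennreal_mult)
      also have "\<dots> \<le> ennreal (G * (T / 2 ^ n) ^ k) * ennreal (((6/5) ^ n) ^ (2 * k))"
        using gaussian_vector_even_moment[OF dist[OF j], of k] T
        by (intro mult_right_mono) (auto simp: G_def)
      also have "\<dots> = ennreal (G * (T / 2 ^ n) ^ k * ((6/5) ^ n) ^ (2 * k))"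
        using G T by (subst ennreal_mult[symmetric]) auto
      finally show "(\<integral>\<^sup>+ \<omega>. ennreal (?D n j \<omega>) \<partial>M)
          \<le> ennreal (G * (T / 2 ^ n) ^ k * ((6/5) ^ n) ^ (2 * k))" .
    qed
    also have "\<dots> = ennreal (2 ^ n * (G * (T / 2 ^ n) ^ k * ((6/5) ^ n) ^ (2 * k)))"
      using G T by (simp add: ennreal_of_nat_eq_real_of_nat ennreal_mult[symmetric])
    also have "2 ^ n * (G * (T / 2 ^ n) ^ k * ((6/5) ^ n) ^ (2 * k)) = G * T ^ k * q ^ n"
    proof -
      have comm: "(x ^ n) ^ l = (x ^ l) ^ n" for x :: real and l
        by (metis power_mult mult.commute)
      have "((6/5 :: real) ^ n) ^ (2 * k) = ((36/25) ^ k) ^ n"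
      proof -
        have "(6/5 :: real) ^ (2 * k) = (36/25) ^ k" by (subst power_mult) (simp add: power2_eq_square)
        then show ?thesis using comm[of "6/5" "2 * k"] by simp
      qed
      moreover have "(T / 2 ^ n) ^ k = T ^ k * ((1/2) ^ k) ^ n"
        unfolding power_divide comm[of 2] by simp
      ultimately have "(T / 2 ^ n) ^ k * ((6/5) ^ n) ^ (2 * k) = T ^ k * ((1/2) ^ k * (36/25) ^ k) ^ n"
        by (simp only: power_mult_distrib mult.assoc)
      also have "(1/2 :: real) ^ k * (36/25) ^ k = (18/25) ^ k"
        unfolding power_mult_distrib[symmetric] by simp
      finally have "(T / 2 ^ n) ^ k * ((6/5) ^ n) ^ (2 * k) = T ^ k * ((18/25) ^ k) ^ n" .
      then show ?thesis by (simp add: q_def power_mult_distrib)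
    qed
    finally show ?thesis .
  qed
  have ER: "(\<integral>\<^sup>+ \<omega>. R \<omega> \<partial>M) \<le> ennreal (6 ^ (2 * k) * (G * T ^ k / (1 - q)))"
  proof -
    have sums: "(\<lambda>n. G * T ^ k * q ^ n) sums (G * T ^ k / (1 - q))"
      using sums_mult[OF geometric_sums[of q], of "G * T ^ k"] q by simp
    have "(\<integral>\<^sup>+ \<omega>. R \<omega> \<partial>M) = 6 ^ (2 * k) * (\<Sum>n. \<integral>\<^sup>+ \<omega>. A n \<omega> \<partial>M)"
      unfolding R_def by (subst nn_integral_cmult) (auto simp: nn_integral_suminf)
    also have "\<dots> \<le> 6 ^ (2 * k) * (\<Sum>n. ennreal (G * T ^ k * q ^ n))"
      by (intro mult_left_mono suminf_le EA) auto
    also have "\<dots> = 6 ^ (2 * k) * ennreal (G * T ^ k / (1 - q))"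
      using sums G T q by (subst suminf_ennreal2) (auto simp: sums_iff)
    also have "(6::ennreal) ^ (2 * k) = ennreal (6 ^ (2 * k))" by (simp add: ennreal_power[symmetric])
    also have "ennreal (6 ^ (2 * k)) * ennreal (G * T ^ k / (1 - q)) = ennreal (6 ^ (2 * k) * (G * T ^ k / (1 - q)))"
      using G T q by (subst ennreal_mult) auto
    finally show ?thesis .
  qed
  have ae: "AE \<omega> in M. W 0 \<omega> = 0" "AE \<omega> in M. continuous_on {0..T} (\<lambda>t. W t \<omega>)"
    using bm by (auto simp: brownian_motion_def)
  have bound: "AE \<omega> in M. \<forall>t\<in>{0..T}. ennreal (norm (W t \<omega>) ^ (2 * k)) \<le> R \<omega>"
    using ae
  proof eventually_elim
    case (elim \<omega>)
    show ?case
    proof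
      fix t assume t: "t \<in> {0..T}"
      show "ennreal (norm (W t \<omega>) ^ (2 * k)) \<le> R \<omega>"
      proof (cases "(\<Sum>n. A n \<omega>) = \<infinity>")
        case True then show ?thesis by (simp add: R_def ennreal_mult_top)
      next
        case False
        then obtain r where r: "(\<Sum>n. A n \<omega>) = ennreal r" "r \<ge> 0" by (cases "\<Sum>n. A n \<omega>") auto
        define b where "b = root (2 * k) r"
        have b: "b \<ge> 0" "b ^ (2 * k) = r" using r k by (auto simp: b_def real_root_pow_pos2)
        have "norm (W t \<omega>) \<le> 6 * b"
        proof (rule dyadic_chaining[OF T elim(2,1) b(1) _ t])
          fix n j :: nat assume j: "j < 2 ^ n"
          have "ennreal (?D n j \<omega>) \<le> A n \<omega>"
            unfolding A_def using j by (intro member_le_sum) auto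
          also have "\<dots> \<le> ennreal r"
          proof -
            have "(\<Sum>i\<in>{n}. A i \<omega>) \<le> (\<Sum>n. A n \<omega>)" by (rule sum_le_suminf) auto
            then show ?thesis using r by simp
          qed
          finally have "(norm (\<Delta> n j \<omega>) * (6/5) ^ n) ^ (2 * k) \<le> b ^ (2 * k)"
            using r b by (simp add: power_mult_distrib)
          then have "norm (\<Delta> n j \<omega>) * (6/5) ^ n \<le> b"
            using b(1) k by (subst (asm) power_mono_iff) auto
          then show "norm (W (real (Suc j) * T / 2 ^ n) \<omega> - W (real j * T / 2 ^ n) \<omega>) \<le> b * (5 / 6) ^ n"
            by (simp add: \<Delta>_def field_simps)
        qed
        then have "norm (W t \<omega>) ^ (2 * k) \<le> (6 * b) ^ (2 * k)" by (intro power_mono) auto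
        also have "\<dots> = 6 ^ (2 * k) * r" by (simp add: power_mult_distrib b)
        finally have "ennreal (norm (W t \<omega>) ^ (2 * k)) \<le> ennreal (6 ^ (2 * k) * r)" by (rule ennreal_leI)
        also have "\<dots> = R \<omega>" using r by (simp add: R_def ennreal_mult ennreal_power[symmetric])
        finally show ?thesis .
      qed
    qed
  qed
  have "R \<in> borel_measurable M" unfolding R_def by measurable
  then show ?thesis using that ER bound unfolding q_def by blast
qed

text \<open>The paths of \<open>W\<close> are continuous only outside a set that need not be
  measurable. It is enclosed in a measurable null set \<open>N\<close> and the path is set to 0
  there, so that \<open>w\<close> is continuous for every outcome and still measurable at each
  time.\<close>

lemma brownian_path_version:
  fixes W :: "real \<Rightarrow> 'w \<Rightarrow> 'b::euclidean_space"
  assumes fp: "filtered_prob_space M F" and bm: "brownian_motion M F T W"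
  obtains w where "\<And>\<omega>. w \<omega> \<in> mspace (C0 T)" "\<And>t. t \<in> {0..T} \<Longrightarrow> (\<lambda>\<omega>. w \<omega> t) \<in> borel_measurable M"
    "AE \<omega> in M. \<forall>t\<in>{0..T}. w \<omega> t = W t \<omega>"
proof -
  have "AE \<omega> in M. continuous_on {0..T} (\<lambda>t. W t \<omega>)" using bm by (simp add: brownian_motion_def)
  then obtain N where N: "{\<omega> \<in> space M. \<not> continuous_on {0..T} (\<lambda>t. W t \<omega>)} \<subseteq> N" "N \<in> null_sets M"
    by (auto simp: eventually_ae_filter)
  define w where "w \<omega> = restrict (\<lambda>t. if \<omega> \<in> space M - N then W t \<omega> else 0) {0..T}" for \<omega>
  have "w \<omega> \<in> mspace (C0 T)" for \<omega>
  proof -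
    have "continuous_on {0..T} (\<lambda>t. if \<omega> \<in> space M - N then W t \<omega> else 0)"
      using N(1) by (cases "\<omega> \<in> space M - N") auto
    then have "continuous_on {0..T} (w \<omega>)" by (rule continuous_on_eq) (simp add: w_def)
    then show ?thesis by (simp add: mspace_C0_iff w_def)
  qed
  moreover have "(\<lambda>\<omega>. w \<omega> t) \<in> borel_measurable M" if t: "t \<in> {0..T}" for t
  proof -
    have "W t \<in> borel_measurable (F t)" using bm t by (simp add: brownian_motion_def)
    then have [measurable]: "W t \<in> borel_measurable M"
      using fp measurable_from_subalg[of M "F t"] by (auto simp: filtered_prob_space_def)
    have [measurable]: "N \<in> sets M" using N(2) by auto
    have "(\<lambda>\<omega>. if \<omega> \<in> space M - N then W t \<omega> else 0) \<in> borel_measurable M" by measurable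
    then show ?thesis using t by (simp add: w_def)
  qed
  moreover have "AE \<omega> in M. \<forall>t\<in>{0..T}. w \<omega> t = W t \<omega>"
    using AE_not_in[OF N(2)] AE_space by eventually_elim (simp add: w_def)
  ultimately show ?thesis by (rule that)
qed

lemma powr_le_one_plus_power:
  fixes x p :: real
  assumes "0 \<le> x" "0 < p" "p \<le> real n"
  shows "x powr p \<le> 1 + x ^ n"
proof (cases "x \<le> 1")
  case True
  then have "x powr p \<le> 1 powr p" using assms by (intro powr_mono2) auto
  then show ?thesis using assms by (simp add: add_increasing2)
next
  case False
  then have "x powr p \<le> x powr real n" using assms by (intro powr_mono) auto
  then show ?thesis using False by (simp add: powr_realpow)
qed

text \<open>All three terms are at most their maximum \<open>m\<close>, and \<open>m powr p\<close>
  is one of the terms on the right.\<close>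

lemma sum3_powr_le:
  fixes a b c p :: real
  assumes "0 \<le> a" "0 \<le> b" "0 \<le> c" "0 < p"
  shows "(a + b + c) powr p \<le> 3 powr p * (a powr p + b powr p + c powr p)"
proof -
  define m where "m = max a (max b c)"
  have "(a + b + c) powr p \<le> (3 * m) powr p" using assms by (intro powr_mono2) (auto simp: m_def)
  also have "\<dots> = 3 powr p * m powr p" by (rule powr_mult)
  also have "m powr p \<le> a powr p + b powr p + c powr p"
    unfolding m_def max_def by (auto intro: add_increasing add_increasing2)
  finally show ?thesis by simp
qed

lemma brownian_path_norm_moment:
  fixes W :: "real \<Rightarrow> 'w \<Rightarrow> 'b::euclidean_space"
  assumes bm: "brownian_motion M F T W" and T: "T > 0" and k: "k \<ge> 3"
    and w: "\<And>\<omega>. w \<omega> \<in> mspace (C0 T)" "AE \<omega> in M. \<forall>t\<in>{0..T}. w \<omega> t = W t \<omega>"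
  shows "(\<integral>\<^sup>+ \<omega>. ennreal (path_norm T (w \<omega>) ^ (2 * k)) \<partial>M)
    \<le> ennreal (6 ^ (2 * k) * (real DIM('b) ^ (2 * k + 1) * (fact (2 * k) / (2 ^ k * fact k)) * T ^ k
         / (1 - 2 * (18 / 25) ^ k)))"
proof -
  obtain R where R: "R \<in> borel_measurable M"
    "(\<integral>\<^sup>+ \<omega>. R \<omega> \<partial>M) \<le> ennreal (6 ^ (2 * k) * (real DIM('b) ^ (2 * k + 1) * (fact (2 * k) / (2 ^ k * fact k)) * T ^ k
         / (1 - 2 * (18 / 25) ^ k)))"
    "AE \<omega> in M. \<forall>t\<in>{0..T}. ennreal (norm (W t \<omega>) ^ (2 * k)) \<le> R \<omega>"
    using brownian_motion_sup_moment[OF bm T k] .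
  have "(\<integral>\<^sup>+ \<omega>. ennreal (path_norm T (w \<omega>) ^ (2 * k)) \<partial>M) \<le> (\<integral>\<^sup>+ \<omega>. R \<omega> \<partial>M)"
  proof (rule nn_integral_mono_AE)
    show "AE \<omega> in M. ennreal (path_norm T (w \<omega>) ^ (2 * k)) \<le> R \<omega>"
      using R(3) w(2)
    proof eventually_elim
      case (elim \<omega>)
      show ?case
      proof (cases "R \<omega> = \<infinity>")
        case False
        then obtain r where r: "R \<omega> = ennreal r" "r \<ge> 0" by (cases "R \<omega>") auto
        define b where "b = root (2 * k) r"
        have b: "b \<ge> 0" "b ^ (2 * k) = r" using r k by (auto simp: b_def real_root_pow_pos2)
        have cont: "continuous_on {0..T} (w \<omega>)" using w(1) by (simp add: mspace_C0_iff)
        have "norm (w \<omega> t) \<le> b" if t: "t \<in> {0..T}" for t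
        proof -
          have "ennreal (norm (w \<omega> t) ^ (2 * k)) \<le> ennreal r" using elim t r by auto
          then have "norm (w \<omega> t) ^ (2 * k) \<le> b ^ (2 * k)" using r b by simp
          then show ?thesis using b(1) k by (subst (asm) power_mono_iff) auto
        qed
        then have "path_norm T (w \<omega>) \<le> b" using path_norm_le_iff[OF _ cont] T by simp
        then have "path_norm T (w \<omega>) ^ (2 * k) \<le> b ^ (2 * k)"
          using path_norm_nonneg[OF _ cont] T by (intro power_mono) auto
        then show ?thesis using r b by (simp add: ennreal_leI)
      qed simp
    qed
  qed
  with R(2) show ?thesis by (rule order_trans[rotated])
qed

section \<open>Weighted norms and random variables\<close>

text \<open>Picard iteration with geometric convergence. As the weighted norm of a difference may be
  infinite, distances are never formed: closeness is a pointwise relation with a constant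
  \<open>r\<close>, only \<open>x0\<close> and its image are required to be finitely close, and
  completeness is replaced by closedness of \<open>A\<close> under weighted uniform
  convergence.\<close>

lemma weighted_fixed_point:
  fixes \<Phi> :: "('i \<Rightarrow> 't \<Rightarrow> 'b::banach) \<Rightarrow> 'i \<Rightarrow> 't \<Rightarrow> 'b" and w :: "'i \<Rightarrow> 't \<Rightarrow> real"
  assumes w: "\<And>i t. 0 \<le> w i t" and x0: "x0 \<in> A" and self: "\<And>x. x \<in> A \<Longrightarrow> \<Phi> x \<in> A"
    and contr: "\<And>x y r. x \<in> A \<Longrightarrow> y \<in> A \<Longrightarrow> 0 \<le> r \<Longrightarrow> (\<And>i t. norm (x i t - y i t) \<le> r * w i t) \<Longrightarrow>
        (\<And>i t. norm (\<Phi> x i t - \<Phi> y i t) \<le> r / 2 * w i t)"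
    and start: "0 \<le> r0" "\<And>i t. norm (\<Phi> x0 i t - x0 i t) \<le> r0 * w i t"
    and closed: "\<And>X x r. (\<And>n::nat. X n \<in> A) \<Longrightarrow> r \<longlonglongrightarrow> 0 \<Longrightarrow>
        (\<And>n i t. norm (X n i t - x i t) \<le> r n * w i t) \<Longrightarrow> x \<in> A"
  shows "\<exists>x\<in>A. \<Phi> x = x"
proof -
  define X where "X n = (\<Phi> ^^ n) x0" for n
  have XA: "X n \<in> A" for n by (induction n) (auto simp: X_def x0 self)
  have step: "norm (X (Suc n) i t - X n i t) \<le> r0 * (1/2) ^ n * w i t" for n i t
  proof (induction n arbitrary: i t)
    case 0 then show ?case using start by (simp add: X_def)
  next
    case (Suc n)
    have "norm (\<Phi> (X (Suc n)) i t - \<Phi> (X n) i t) \<le> r0 * (1/2) ^ n / 2 * w i t"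
      using contr[OF XA XA, of "r0 * (1/2) ^ n" "Suc n" n i t] Suc start by auto
    then show ?case by (simp add: X_def)
  qed
  have far: "norm (X (n + k) i t - X n i t) \<le> 2 * r0 * (1/2) ^ n * w i t" for n k i t
  proof -
    \<comment> \<open>The partial geometric sum is kept exact; an induction on \<open>k\<close> with
      the plain factor 2 would not close.\<close>
    have "norm (X (n + k) i t - X n i t) \<le> r0 * (1/2) ^ n * (2 - 2 * (1/2) ^ k) * w i t"
    proof (induction k)
      case (Suc k)
      have "norm (X (n + Suc k) i t - X n i t)
          \<le> norm (X (Suc (n + k)) i t - X (n + k) i t) + norm (X (n + k) i t - X n i t)"
        using norm_triangle_ineq[of "X (Suc (n + k)) i t - X (n + k) i t" "X (n + k) i t - X n i t"] by simp
      also have "\<dots> \<le> r0 * (1/2) ^ (n + k) * w i t + r0 * (1/2) ^ n * (2 - 2 * (1/2) ^ k) * w i t"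
        using step[of "n + k" i t] Suc by simp
      also have "\<dots> = r0 * (1/2) ^ n * (2 - 2 * (1/2) ^ Suc k) * w i t"
        by (simp add: algebra_simps power_add)
      finally show ?case .
    qed simp
    also have "\<dots> \<le> r0 * (1/2) ^ n * 2 * w i t"
      using start(1) w by (intro mult_right_mono mult_left_mono) auto
    finally show ?thesis by (simp add: mult_ac)
  qed
  have r: "(\<lambda>n. 2 * r0 * (1/2) ^ n * c) \<longlonglongrightarrow> 0" for c
  proof -
    have "(\<lambda>n. 2 * r0 * (1/2) ^ n * c) \<longlonglongrightarrow> 2 * r0 * 0 * c"
      by (intro tendsto_mult tendsto_const LIMSEQ_power_zero) auto
    then show ?thesis by simp
  qed
  have "Cauchy (\<lambda>n. X n i t)" for i t
  proof (rule CauchyI')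
    fix e :: real assume "e > 0"
    then have "\<forall>\<^sub>F n in sequentially. 2 * r0 * (1/2) ^ n * w i t < e"
      using r by (intro order_tendstoD) auto
    then obtain N where N: "\<And>n. n \<ge> N \<Longrightarrow> 2 * r0 * (1/2) ^ n * w i t < e"
      by (auto simp: eventually_sequentially)
    have "dist (X m i t) (X n i t) < e" if "m \<ge> N" "n > m" for m n
      using far[where n = m and k = "n - m" and i = i and t = t] N[OF that(1)] that
      by (simp add: dist_norm norm_minus_commute)
    then show "\<exists>N. \<forall>m\<ge>N. \<forall>n>m. dist (X m i t) (X n i t) < e" by blast
  qed
  then have "\<forall>i t. \<exists>l. (\<lambda>n. X n i t) \<longlonglongrightarrow> l" by (simp add: Cauchy_convergent_iff convergent_def)
  then obtain x where x: "\<And>i t. (\<lambda>n. X n i t) \<longlonglongrightarrow> x i t" by metis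
  have lim: "norm (X n i t - x i t) \<le> 2 * r0 * (1/2) ^ n * w i t" for n i t
  proof -
    have "(\<lambda>k. norm (X (k + n) i t - X n i t)) \<longlonglongrightarrow> norm (x i t - X n i t)"
      by (intro tendsto_norm tendsto_diff tendsto_const LIMSEQ_ignore_initial_segment x)
    then have "norm (x i t - X n i t) \<le> 2 * r0 * (1/2) ^ n * w i t"
      by (rule Lim_bounded[where M = 0]) (metis far add.commute)
    then show ?thesis by (simp add: norm_minus_commute)
  qed
  have "x \<in> A" using closed[of X "\<lambda>n. 2 * r0 * (1/2) ^ n * 1" x, OF XA r[of 1]] lim by simp
  moreover have "\<Phi> x = x"
  proof (intro ext)
    fix i t
    have "norm (\<Phi> x i t - x i t) \<le> 2 * r0 * (1/2) ^ n * w i t" for n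
    proof -
      have "norm (\<Phi> (X n) i t - \<Phi> x i t) \<le> 2 * r0 * (1/2) ^ n / 2 * w i t"
        using contr[OF XA \<open>x \<in> A\<close>, of "2 * r0 * (1/2) ^ n" n i t] lim start by auto
      moreover have "norm (\<Phi> (X n) i t - x i t) \<le> 2 * r0 * (1/2) ^ Suc n * w i t"
        using lim[of "Suc n" i t] by (simp add: X_def)
      ultimately show ?thesis
        using norm_triangle_ineq4[of "\<Phi> (X n) i t - x i t" "\<Phi> (X n) i t - \<Phi> x i t"] by simp
    qed
    then have "norm (\<Phi> x i t - x i t) \<le> 0"
      by (intro LIMSEQ_le_const[OF r[of "w i t"]]) blast
    then show "\<Phi> x i t = x i t" by simp
  qed
  ultimately show ?thesis by blast
qed

text \<open>Takes the role of Gronwall's inequality: the admissible constants follow the recursion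
  \<open>r -> a + r / 2\<close>, whose iterates \<open>R n\<close> tend to the fixed point
  \<open>2 * a\<close> from any finite start. With \<open>a = 0\<close> this yields uniqueness, with
  positive \<open>a\<close> an a priori bound.\<close>

lemma halving_bound:
  fixes f w :: "'i \<Rightarrow> real"
  assumes start: "0 \<le> r0" "\<And>i. i \<in> I \<Longrightarrow> f i \<le> r0 * w i" and a: "0 \<le> a"
    and step: "\<And>r. 0 \<le> r \<Longrightarrow> (\<And>i. i \<in> I \<Longrightarrow> f i \<le> r * w i) \<Longrightarrow> (\<And>i. i \<in> I \<Longrightarrow> f i \<le> (a + r / 2) * w i)"
    and i: "i \<in> I"
  shows "f i \<le> 2 * a * w i"
proof -
  define R where "R n = 2 * a + (r0 - 2 * a) * (1/2) ^ n" for n :: nat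
  have RS: "R (Suc n) = a + R n / 2" for n by (simp add: R_def field_simps)
  have "0 \<le> R n \<and> (\<forall>i\<in>I. f i \<le> R n * w i)" for n
  proof (induction n)
    case 0 then show ?case using start by (simp add: R_def)
  next
    case (Suc n) then show ?case using step[of "R n"] a unfolding RS by auto
  qed
  then have "f i \<le> R n * w i" for n using i by blast
  moreover have "(\<lambda>n. R n * w i) \<longlonglongrightarrow> (2 * a + (r0 - 2 * a) * 0) * w i"
    unfolding R_def by (intro tendsto_intros LIMSEQ_power_zero) auto
  ultimately show ?thesis by (intro LIMSEQ_le_const[where X = "\<lambda>n. R n * w i"]) auto
qed

text \<open>Integrating \<open>exp (l * s)\<close> gains the factor \<open>1 / l\<close>, and
  \<open>2 * \<Lambda> \<le> l\<close> turns the Lipschitz constant into 1/2. The function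
  \<open>h\<close> collects the part of the integrand that is not measured in the weight and is
  simply integrated over all of \<open>{0..T}\<close>.\<close>

lemma exp_weighted_integral_bound:
  fixes g :: "real \<Rightarrow> 'b::euclidean_space"
  assumes g: "(g has_integral I) {0..t}" and t: "t \<in> {0..T}"
    and h: "h integrable_on {0..T}" "\<And>s. s \<in> {0..T} \<Longrightarrow> 0 \<le> h s" "integral {0..T} h \<le> A"
    and lam: "0 \<le> \<Lambda>" "2 * \<Lambda> \<le> l" "0 < l" "0 \<le> c"
    and le: "\<And>s. s \<in> {0..t} \<Longrightarrow> norm (g s) \<le> h s + \<Lambda> * c * exp (l * s)"
  shows "norm I \<le> A + c / 2 * exp (l * t)"
proof -
  have e0: "((\<lambda>s. exp (l * s)) has_integral (exp (l * t) / l - exp (l * 0) / l)) {0..t}"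
    using lam t by (intro fundamental_theorem_of_calculus)
      (auto intro!: derivative_eq_intros simp: has_real_derivative_iff_has_vector_derivative[symmetric])
  then have e: "((\<lambda>s. \<Lambda> * c * exp (l * s)) has_integral (\<Lambda> * c * (exp (l * t) / l - 1 / l))) {0..t}"
    using has_integral_mult_right[OF e0, of "\<Lambda> * c"] by simp
  have ht: "h integrable_on {0..t}" using h(1) t by (auto intro: integrable_on_subinterval)
  have "norm (integral {0..t} g) \<le> integral {0..t} (\<lambda>s. h s + \<Lambda> * c * exp (l * s))"
    by (rule integral_norm_bound_integral)
      (use g e ht le in \<open>auto intro!: integrable_add simp: has_integral_integrable\<close>)
  also have "\<dots> = integral {0..t} h + \<Lambda> * c * (exp (l * t) / l - 1 / l)"
    using e ht by (subst Henstock_Kurzweil_Integration.integral_add) (auto simp: has_integral_iff)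
  also have "integral {0..t} h \<le> integral {0..T} h"
    using t h ht by (intro integral_subset_le) auto
  also have "\<Lambda> * c * (exp (l * t) / l - 1 / l) \<le> c / 2 * exp (l * t)"
  proof -
    have "\<Lambda> * c * (exp (l * t) / l - 1 / l) \<le> \<Lambda> * c * (exp (l * t) / l)"
      using lam by (intro mult_left_mono) auto
    also have "\<dots> = (\<Lambda> / l) * (c * exp (l * t))" by simp
    also have "\<dots> \<le> (1/2) * (c * exp (l * t))"
      using lam by (intro mult_right_mono) (auto simp: field_simps)
    finally show ?thesis by simp
  qed
  finally show ?thesis using h(3) g by (simp add: integral_unique)
qed

text \<open>Rounds \<open>s\<close> down to mesh \<open>1 / (n + 1)\<close>. A function of the
  rounded time is glued from countably many pieces, hence measurable, and continuity in time then
  passes measurability to the limit.\<close>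

abbreviation grid :: "nat \<Rightarrow> real \<Rightarrow> real" where
  "grid n s \<equiv> of_int \<lfloor>real (Suc n) * s\<rfloor> / real (Suc n)"

lemma floor_grid_tendsto: "(\<lambda>n. grid n s) \<longlonglongrightarrow> (s :: real)"
proof -
  have "(\<lambda>n. grid n s - s) \<longlonglongrightarrow> 0"
  proof (rule Lim_null_comparison)
    have "\<bar>grid n s - s\<bar> \<le> 1 / real (Suc n)" for n
    proof -
      have "\<bar>of_int \<lfloor>real (Suc n) * s\<rfloor> - real (Suc n) * s\<bar> \<le> 1" by linarith
      then have "\<bar>of_int \<lfloor>real (Suc n) * s\<rfloor> - real (Suc n) * s\<bar> / real (Suc n) \<le> 1 / real (Suc n)"
        by (intro divide_right_mono) auto
      moreover have "grid n s - s
          = (of_int \<lfloor>real (Suc n) * s\<rfloor> - real (Suc n) * s) / real (Suc n)"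
        by (simp add: diff_divide_distrib del: of_nat_Suc)
      ultimately show ?thesis by (simp add: abs_divide del: of_nat_Suc)
    qed
    then show "\<forall>\<^sub>F n in sequentially. norm (grid n s - s) \<le> 1 / real (Suc n)"
      by (auto simp del: of_nat_Suc)
    show "(\<lambda>n. 1 / real (Suc n)) \<longlonglongrightarrow> 0" using LIMSEQ_inverse_real_of_nat by (simp add: inverse_eq_divide)
  qed
  then show ?thesis by (simp add: LIM_zero_iff del: of_nat_Suc)
qed

lemma borel_measurable_continuous_process:
  fixes X :: "'w \<Rightarrow> real \<Rightarrow> 'b::euclidean_space"
  assumes meas: "\<And>t. (\<lambda>\<omega>. X \<omega> t) \<in> borel_measurable M" and cont: "\<And>\<omega>. continuous_on UNIV (X \<omega>)"
  shows "(\<lambda>(\<omega>, s). X \<omega> s) \<in> borel_measurable (M \<Otimes>\<^sub>M borel)"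
proof (rule borel_measurable_LIMSEQ_metric)
  fix n
  have "(\<lambda>z. X (fst z) (grid n (snd z))) \<in> borel_measurable (M \<Otimes>\<^sub>M borel)"
  proof (rule measurable_compose_countable[where f = "\<lambda>i z. X (fst z) (of_int i / real (Suc n))"])
    show "(\<lambda>z. X (fst z) (of_int i / real (Suc n))) \<in> borel_measurable (M \<Otimes>\<^sub>M borel)" for i
      by (rule measurable_compose[OF measurable_fst meas])
  qed measurable
  then show "(\<lambda>(\<omega>, s). X \<omega> (grid n s)) \<in> borel_measurable (M \<Otimes>\<^sub>M borel)"
    by (simp add: case_prod_beta')
next
  fix z :: "'w \<times> real"
  have "isCont (X (fst z)) (snd z)" using cont by (simp add: continuous_on_eq_continuous_at)
  from isCont_tendsto_compose[OF this floor_grid_tendsto]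
  show "(\<lambda>n. case z of (\<omega>, s) \<Rightarrow> X \<omega> (grid n s))
      \<longlonglongrightarrow> (case z of (\<omega>, s) \<Rightarrow> X \<omega> s)"
    by (simp add: case_prod_beta')
qed

section \<open>Laws of random variables and the 1-Wasserstein distance\<close>

lemma distr_in_wasserstein_space:
  fixes \<xi> :: "'w \<Rightarrow> 'b::euclidean_space"
  assumes "prob_space M" "integrable M \<xi>"
  shows "distr M borel \<xi> \<in> wasserstein_space 1"
proof -
  interpret prob_space M by fact
  have [measurable]: "\<xi> \<in> borel_measurable M" using assms by auto
  have "(\<integral>\<^sup>+ x. ennreal (norm x) \<partial>distr M borel \<xi>) < \<infinity>"
    using assms(2) by (subst nn_integral_distr) (auto simp: integrable_iff_bounded)
  then show ?thesis
    by (auto simp: wasserstein_space_def moment_def Let_def powr_one_gt_zero_iff prob_space_distr)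
qed

lemma wasserstein_space_integrable:
  assumes "\<mu> \<in> wasserstein_space 1"
  shows "integrable \<mu> (\<lambda>x. x)"
proof -
  have *: "sets \<mu> = sets borel" "moment 1 norm \<mu> < \<infinity>" using assms by (auto simp: wasserstein_space_def)
  then have "(\<integral>\<^sup>+ x. ennreal (norm x) \<partial>\<mu>) < \<infinity>"
    by (auto simp: moment_def Let_def top.not_eq_extremum split: if_splits)
  moreover have "(\<lambda>x. x) \<in> borel_measurable \<mu>" by (rule measurable_ident_sets[OF *(1)])
  ultimately show ?thesis by (simp add: integrable_iff_bounded)
qed

text \<open>The joint law of \<open>\<xi>\<close> and \<open>\<eta>\<close> is one competitor in the
  infimum over couplings.\<close>

lemma wasserstein_dist_distr_le:
  fixes \<xi> \<eta> :: "'w \<Rightarrow> 'b::euclidean_space"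
  assumes \<xi>: "integrable M \<xi>" and \<eta>: "integrable M \<eta>"
  shows "wasserstein_dist 1 (distr M borel \<xi>) (distr M borel \<eta>) \<le> (LINT \<omega>|M. norm (\<xi> \<omega> - \<eta> \<omega>))"
proof -
  have [measurable]: "\<xi> \<in> borel_measurable M" "\<eta> \<in> borel_measurable M" using \<xi> \<eta> by auto
  define \<pi> where "\<pi> = distr M (borel \<Otimes>\<^sub>M borel) (\<lambda>\<omega>. (\<xi> \<omega>, \<eta> \<omega>))"
  have \<pi>: "\<pi> \<in> couplings (distr M borel \<xi>) (distr M borel \<eta>)"
    unfolding couplings_def \<pi>_def by (simp add: distr_distr comp_def)
  have "(\<integral>\<^sup>+ z. ennreal (dist (fst z) (snd z) powr 1) \<partial>\<pi>) = (\<integral>\<^sup>+ \<omega>. ennreal (norm (\<xi> \<omega> - \<eta> \<omega>)) \<partial>M)"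
    unfolding \<pi>_def by (subst nn_integral_distr) (auto simp: dist_norm)
  also have "\<dots> = ennreal (LINT \<omega>|M. norm (\<xi> \<omega> - \<eta> \<omega>))"
    using \<xi> \<eta> by (intro nn_integral_eq_integral) auto
  finally have *: "(\<integral>\<^sup>+ z. ennreal (dist (fst z) (snd z) powr 1) \<partial>\<pi>) = ennreal (LINT \<omega>|M. norm (\<xi> \<omega> - \<eta> \<omega>))" .
  have "(INF \<pi>\<in>couplings (distr M borel \<xi>) (distr M borel \<eta>).
      \<integral>\<^sup>+ z. ennreal (dist (fst z) (snd z) powr 1) \<partial>\<pi>) \<le> ennreal (LINT \<omega>|M. norm (\<xi> \<omega> - \<eta> \<omega>))"
    unfolding *[symmetric] by (rule INF_lower[OF \<pi>])
  then have "enn2real (INF \<pi>\<in>couplings (distr M borel \<xi>) (distr M borel \<eta>).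
      \<integral>\<^sup>+ z. ennreal (dist (fst z) (snd z) powr 1) \<partial>\<pi>) \<le> (LINT \<omega>|M. norm (\<xi> \<omega> - \<eta> \<omega>))"
    by (intro enn2real_leI) auto
  then show ?thesis by (simp add: wasserstein_dist_def)
qed

lemma borel_imp_lebesgue_on_measurable:
  "f \<in> measurable borel N \<Longrightarrow> f \<in> measurable (lebesgue_on S) N"
  by (intro measurable_restrict_space1 measurable_completion) (simp add: measurable_lborel1)

section \<open>The integral equation\<close>

text \<open>
  Here \<open>\<xi> \<omega> t\<close> stands for \<open>X0 \<omega> + sqrt (2 * \<sigma>) *\<^sub>R W t \<omega>\<close>, with continuous paths for every \<open>\<omega>\<close>.
\<close>

locale particle_system = prob_space M
  for M :: "'w measure" +
  fixes T L :: real and H1 H2 K1 K2 :: "'b::euclidean_space \<Rightarrow> 'b"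
    and u :: "'m::finite \<Rightarrow> real \<Rightarrow> 'b measure \<Rightarrow> 'b" and Y0 :: "'m \<Rightarrow> 'b"
    and \<xi> :: "'w \<Rightarrow> real \<Rightarrow> 'b" and K :: "'w \<Rightarrow> real" and \<kappa> :: real
  assumes T: "0 < T"
    and lip: "L-lipschitz_on UNIV H1" "L-lipschitz_on UNIV H2" "L-lipschitz_on UNIV K1" "L-lipschitz_on UNIV K2"
    and u: "\<And>i. admissible_control T L (u i)"
    and \<xi>_cont: "\<And>\<omega>. continuous_on {0..T} (\<xi> \<omega>)"
    and \<xi>_meas: "\<And>t. t \<in> {0..T} \<Longrightarrow> (\<lambda>\<omega>. \<xi> \<omega> t) \<in> borel_measurable M"
    and \<xi>_le: "\<And>\<omega> t. t \<in> {0..T} \<Longrightarrow> norm (\<xi> \<omega> t) \<le> K \<omega>"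
    and K: "integrable M K" "\<And>\<omega>. 1 \<le> K \<omega>" "expectation K \<le> \<kappa>"
begin

text \<open>The law argument is carried by a random variable \<open>\<zeta>\<close> with that law,
  and the convolution becomes an expectation over \<open>M\<close>. Drifts can then be compared
  through the L^1 distance of variables on the same space.\<close>

definition bX :: "('w \<Rightarrow> 'b) \<Rightarrow> ('m \<Rightarrow> 'b) \<Rightarrow> 'b \<Rightarrow> 'b" where
  "bX \<zeta> y x = (LINT \<omega>|M. H1 (x - \<zeta> \<omega>)) + (1 / real CARD('m)) *\<^sub>R (\<Sum>j\<in>UNIV. K1 (y j - x))"

definition bY :: "real \<Rightarrow> ('w \<Rightarrow> 'b) \<Rightarrow> ('m \<Rightarrow> 'b) \<Rightarrow> 'm \<Rightarrow> 'b" where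
  "bY s \<zeta> y i = (LINT \<omega>|M. K2 (y i - \<zeta> \<omega>))
     + (1 / real CARD('m)) *\<^sub>R (\<Sum>j\<in>UNIV. H2 (y j - y i)) + u i s (distr M borel \<zeta>)"

text \<open>
  \<open>\<Lambda>\<close> is the Lipschitz constant of the drifts in the weighted norm, and the rate \<open>l\<close> is chosen
  such that integrating \<open>\<Lambda> * exp (l * s)\<close> gains a factor \<open>1 / 2\<close>.
\<close>

definition \<Lambda> :: real where "\<Lambda> = L * (3 + 2 * \<kappa>)"

definition l :: real where "l = 2 * \<Lambda> + 1"

abbreviation L1_dist :: "('w \<Rightarrow> 'b) \<Rightarrow> ('w \<Rightarrow> 'b) \<Rightarrow> real" where
  "L1_dist \<zeta> \<eta> \<equiv> LINT \<omega>|M. norm (\<zeta> \<omega> - \<eta> \<omega>)"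

section \<open>Lipschitz and growth estimates for the drifts\<close>

lemma L_nonneg: "0 \<le> L"
  using lip(1) by (rule lipschitz_on_nonneg)

lemma \<kappa>_ge_1: "1 \<le> \<kappa>"
proof -
  have "expectation (\<lambda>_. 1) \<le> expectation K" using K by (intro integral_mono) auto
  then show ?thesis using K(3) by (simp add: prob_space)
qed

lemma \<Lambda>_l: "0 \<le> \<Lambda>" "2 * \<Lambda> \<le> l" "0 < l"
  using L_nonneg \<kappa>_ge_1 by (auto simp: \<Lambda>_def l_def add_nonneg_pos)

lemma lipschitz_norm_diff:
  "L-lipschitz_on UNIV H \<Longrightarrow> norm (H x - H y) \<le> L * norm (x - y)" for H :: "'b \<Rightarrow> 'b"
  using lipschitz_onD[of L UNIV H x y] by (simp add: dist_norm)

lemma lipschitz_borel: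
  "L-lipschitz_on UNIV H \<Longrightarrow> H \<in> borel_measurable borel" for H :: "'b \<Rightarrow> 'b"
  by (intro borel_measurable_continuous_onI lipschitz_on_continuous_on)

lemma integrable_lipschitz_comp:
  fixes H :: "'b \<Rightarrow> 'b"
  assumes H: "L-lipschitz_on UNIV H" and \<zeta>: "integrable M \<zeta>"
  shows "integrable M (\<lambda>\<omega>. H (x - \<zeta> \<omega>))"
proof (rule Bochner_Integration.integrable_bound)
  have [measurable]: "H \<in> borel_measurable borel" "\<zeta> \<in> borel_measurable M"
    using lipschitz_borel[OF H] \<zeta> by auto
  show "(\<lambda>\<omega>. H (x - \<zeta> \<omega>)) \<in> borel_measurable M" by measurable
  show "integrable M (\<lambda>\<omega>. norm (H x) + L * norm (\<zeta> \<omega>))" using \<zeta> by auto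
  show "AE \<omega> in M. norm (H (x - \<zeta> \<omega>)) \<le> norm (norm (H x) + L * norm (\<zeta> \<omega>))"
  proof (rule AE_I2)
    fix \<omega>
    have "norm (H (x - \<zeta> \<omega>)) \<le> norm (H x) + norm (H (x - \<zeta> \<omega>) - H x)" by (rule norm_triangle_sub)
    also have "norm (H (x - \<zeta> \<omega>) - H x) \<le> L * norm (\<zeta> \<omega>)"
      using lipschitz_norm_diff[OF H, of "x - \<zeta> \<omega>" x] by simp
    finally show "norm (H (x - \<zeta> \<omega>)) \<le> norm (norm (H x) + L * norm (\<zeta> \<omega>))" by simp
  qed
qed

lemma expectation_lipschitz_diff:
  fixes H :: "'b \<Rightarrow> 'b"
  assumes H: "L-lipschitz_on UNIV H" and \<zeta>: "integrable M \<zeta>" and \<eta>: "integrable M \<eta>"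
  shows "norm ((LINT \<omega>|M. H (x - \<zeta> \<omega>)) - (LINT \<omega>|M. H (x' - \<eta> \<omega>)))
    \<le> L * (norm (x - x') + L1_dist \<zeta> \<eta>)"
proof -
  have "norm ((LINT \<omega>|M. H (x - \<zeta> \<omega>)) - (LINT \<omega>|M. H (x' - \<eta> \<omega>)))
      = norm (LINT \<omega>|M. H (x - \<zeta> \<omega>) - H (x' - \<eta> \<omega>))"
    by (subst Bochner_Integration.integral_diff) (auto intro: integrable_lipschitz_comp H \<zeta> \<eta>)
  also have "\<dots> \<le> (LINT \<omega>|M. norm (H (x - \<zeta> \<omega>) - H (x' - \<eta> \<omega>)))" by (rule integral_norm_bound)
  also have "\<dots> \<le> (LINT \<omega>|M. L * (norm (x - x') + norm (\<zeta> \<omega> - \<eta> \<omega>)))"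
  proof (rule integral_mono)
    show "integrable M (\<lambda>\<omega>. norm (H (x - \<zeta> \<omega>) - H (x' - \<eta> \<omega>)))"
      by (intro integrable_norm Bochner_Integration.integrable_diff integrable_lipschitz_comp H \<zeta> \<eta>)
    show "integrable M (\<lambda>\<omega>. L * (norm (x - x') + norm (\<zeta> \<omega> - \<eta> \<omega>)))" using \<zeta> \<eta> by auto
    fix \<omega>
    have "norm (H (x - \<zeta> \<omega>) - H (x' - \<eta> \<omega>)) \<le> L * norm ((x - x') - (\<zeta> \<omega> - \<eta> \<omega>))"
      using lipschitz_norm_diff[OF H, of "x - \<zeta> \<omega>" "x' - \<eta> \<omega>"] by (simp add: algebra_simps)
    also have "\<dots> \<le> L * (norm (x - x') + norm (\<zeta> \<omega> - \<eta> \<omega>))"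
      by (intro mult_left_mono norm_triangle_ineq4 L_nonneg)
    finally show "norm (H (x - \<zeta> \<omega>) - H (x' - \<eta> \<omega>)) \<le> L * (norm (x - x') + norm (\<zeta> \<omega> - \<eta> \<omega>))" .
  qed
  also have "\<dots> = L * (norm (x - x') + L1_dist \<zeta> \<eta>)"
    using \<zeta> \<eta> by (simp add: prob_space)
  finally show ?thesis .
qed

lemma average_lipschitz_diff:
  fixes H :: "'b \<Rightarrow> 'b" and y y' :: "'m \<Rightarrow> 'b"
  assumes H: "L-lipschitz_on UNIV H" and a: "\<And>j. norm (y j - y' j) \<le> a"
  shows "norm ((1 / real CARD('m)) *\<^sub>R (\<Sum>j\<in>UNIV. H (y j - x)) - (1 / real CARD('m)) *\<^sub>R (\<Sum>j\<in>UNIV. H (y' j - x')))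
    \<le> L * (a + norm (x - x'))"
proof -
  have "norm (\<Sum>j\<in>UNIV. H (y j - x) - H (y' j - x')) \<le> (\<Sum>j\<in>(UNIV::'m set). L * (a + norm (x - x')))"
  proof (rule sum_norm_le)
    fix j
    have "norm (H (y j - x) - H (y' j - x')) \<le> L * norm ((y j - y' j) - (x - x'))"
      using lipschitz_norm_diff[OF H, of "y j - x" "y' j - x'"] by (simp add: algebra_simps)
    also have "\<dots> \<le> L * (a + norm (x - x'))"
      using a[of j] norm_triangle_ineq4[of "y j - y' j" "x - x'"] by (intro mult_left_mono L_nonneg) auto
    finally show "norm (H (y j - x) - H (y' j - x')) \<le> L * (a + norm (x - x'))" .
  qed
  then have "norm ((1 / real CARD('m)) *\<^sub>R (\<Sum>j\<in>UNIV. H (y j - x) - H (y' j - x')))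
      \<le> (1 / real CARD('m)) * (real CARD('m) * (L * (a + norm (x - x'))))"
    by (simp add: pos_divide_le_eq mult_ac)
  then show ?thesis by (simp add: sum_subtractf scaleR_right_diff_distrib)
qed

lemma u_diff:
  assumes "s \<in> {0..T}" "integrable M \<zeta>" "integrable M \<eta>"
  shows "norm (u i s (distr M borel \<zeta>) - u i s (distr M borel \<eta>)) \<le> L * L1_dist \<zeta> \<eta>"
proof -
  have W: "distr M borel \<zeta> \<in> wasserstein_space 1" "distr M borel \<eta> \<in> wasserstein_space 1"
    using assms by (auto intro: distr_in_wasserstein_space prob_space_axioms)
  have "dist (u i s (distr M borel \<zeta>)) (u i s (distr M borel \<eta>))
      \<le> L * wasserstein_dist 1 (distr M borel \<zeta>) (distr M borel \<eta>)"
    using u[of i] W assms(1) unfolding admissible_control_def by blast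
  also have "\<dots> \<le> L * L1_dist \<zeta> \<eta>"
    by (intro mult_left_mono L_nonneg wasserstein_dist_distr_le assms)
  finally show ?thesis by (simp add: dist_norm)
qed

lemma bX_diff:
  assumes "integrable M \<zeta>" "integrable M \<eta>" "\<And>j. norm (y j - y' j) \<le> a"
  shows "norm (bX \<zeta> y x - bX \<eta> y' x') \<le> L * (2 * norm (x - x') + L1_dist \<zeta> \<eta> + a)"
proof -
  have "norm (bX \<zeta> y x - bX \<eta> y' x') \<le> L * (norm (x - x') + L1_dist \<zeta> \<eta>) + L * (a + norm (x - x'))"
    unfolding bX_def add_diff_add
    by (intro norm_triangle_mono expectation_lipschitz_diff average_lipschitz_diff lip assms)
  then show ?thesis by (simp add: algebra_simps)
qed

lemma bY_diff:
  assumes "s \<in> {0..T}" "integrable M \<zeta>" "integrable M \<eta>" "\<And>j. norm (y j - y' j) \<le> a"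
  shows "norm (bY s \<zeta> y i - bY s \<eta> y' i) \<le> L * (3 * a + 2 * L1_dist \<zeta> \<eta>)"
proof -
  have "norm (bY s \<zeta> y i - bY s \<eta> y' i) \<le> L * (norm (y i - y' i) + L1_dist \<zeta> \<eta>)
      + L * (a + norm (y i - y' i)) + L * L1_dist \<zeta> \<eta>"
    unfolding bY_def add_diff_add
    by (intro norm_triangle_mono expectation_lipschitz_diff average_lipschitz_diff lip assms u_diff)
  also have "\<dots> = L * (2 * norm (y i - y' i) + a + 2 * L1_dist \<zeta> \<eta>)"
    by (simp add: algebra_simps)
  also have "\<dots> \<le> L * (3 * a + 2 * L1_dist \<zeta> \<eta>)"
    using assms(4)[of i] by (intro mult_left_mono L_nonneg) auto
  finally show ?thesis .
qed

text \<open>Here integrability of the weight enters: taking the expectation replaces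
  \<open>K \<omega>\<close> by its mean, which is at most \<open>\<kappa>\<close>.\<close>

lemma expectation_weighted_le:
  fixes \<zeta> \<eta> :: "'w \<Rightarrow> 'b"
  assumes "AE \<omega> in M. norm (\<zeta> \<omega> - \<eta> \<omega>) \<le> r * K \<omega> * \<rho>" "integrable M \<zeta>" "integrable M \<eta>" "0 \<le> r" "0 \<le> \<rho>"
  shows "L1_dist \<zeta> \<eta> \<le> r * \<kappa> * \<rho>"
proof -
  have "L1_dist \<zeta> \<eta> \<le> (LINT \<omega>|M. r * K \<omega> * \<rho>)"
    by (intro integral_mono_AE integrable_norm Bochner_Integration.integrable_diff) (use assms K in auto)
  also have "\<dots> = r * expectation K * \<rho>" by simp
  also have "\<dots> \<le> r * \<kappa> * \<rho>" using assms K by (intro mult_right_mono mult_left_mono) auto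
  finally show ?thesis .
qed

text \<open>\<open>k\<close> stands for the value of \<open>K\<close> at the outcome whose path
  passes through \<open>x\<close>. The law and the \<open>y\<close> terms carry no such factor and
  are absorbed using \<open>1 \<le> k\<close>. The constant obtained is
  \<open>L * (3 + \<kappa>)\<close>, enlarged to \<open>\<Lambda>\<close> so that one rate serves
  all components.\<close>

lemma bX_weighted_diff:
  assumes \<zeta>: "integrable M \<zeta>" "integrable M \<eta>" and r: "0 \<le> r" "0 \<le> \<rho>"
    and close: "AE \<omega> in M. norm (\<zeta> \<omega> - \<eta> \<omega>) \<le> r * K \<omega> * \<rho>"
    "\<And>j. norm (y j - y' j) \<le> r * \<rho>" "norm (x - x') \<le> r * k * \<rho>" and k: "1 \<le> k"
  shows "norm (bX \<zeta> y x - bX \<eta> y' x') \<le> \<Lambda> * (r * k) * \<rho>"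
proof -
  have "norm (bX \<zeta> y x - bX \<eta> y' x') \<le> L * (2 * norm (x - x') + L1_dist \<zeta> \<eta> + r * \<rho>)"
    by (rule bX_diff[OF \<zeta> close(2)])
  also have "\<dots> \<le> L * (2 * (r * k * \<rho>) + r * \<kappa> * \<rho> + r * \<rho>)"
    by (rule mult_left_mono[OF _ L_nonneg]) (use expectation_weighted_le[OF close(1) \<zeta> r] close(3) in linarith)
  also have "\<dots> \<le> L * (2 * (r * k * \<rho>) + \<kappa> * (r * \<rho> * k) + r * \<rho> * k)"
  proof -
    have 1: "r * \<rho> \<le> r * \<rho> * k" using mult_left_mono[OF k, of "r * \<rho>"] r by simp
    have "\<kappa> * (r * \<rho>) \<le> \<kappa> * (r * \<rho> * k)" by (rule mult_left_mono[OF 1]) (use \<kappa>_ge_1 in simp)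
    then have "r * \<kappa> * \<rho> \<le> \<kappa> * (r * \<rho> * k)" by (simp add: mult_ac)
    with 1 show ?thesis by (intro mult_left_mono[OF _ L_nonneg]) linarith
  qed
  also have "\<dots> = L * (3 + \<kappa>) * (r * k) * \<rho>" by (simp add: algebra_simps)
  also have "\<dots> \<le> \<Lambda> * (r * k) * \<rho>"
    unfolding \<Lambda>_def using r k \<kappa>_ge_1 L_nonneg by (intro mult_right_mono mult_left_mono) auto
  finally show ?thesis .
qed

text \<open>The constant is exactly \<open>\<Lambda>\<close>: the difference of \<open>y i\<close>
  enters through the convolution and through the average, and the average adds that of the other
  \<open>y j\<close>, hence 3; the law enters through \<open>K2\<close> and through the control,
  hence \<open>2 * \<kappa>\<close>.\<close>

lemma bY_weighted_diff:
  assumes s: "s \<in> {0..T}" and \<zeta>: "integrable M \<zeta>" "integrable M \<eta>" and r: "0 \<le> r" "0 \<le> \<rho>"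
    and close: "AE \<omega> in M. norm (\<zeta> \<omega> - \<eta> \<omega>) \<le> r * K \<omega> * \<rho>" "\<And>j. norm (y j - y' j) \<le> r * \<rho>"
  shows "norm (bY s \<zeta> y i - bY s \<eta> y' i) \<le> \<Lambda> * r * \<rho>"
proof -
  have "norm (bY s \<zeta> y i - bY s \<eta> y' i) \<le> L * (3 * (r * \<rho>) + 2 * L1_dist \<zeta> \<eta>)"
    by (rule bY_diff[OF s \<zeta> close(2)])
  also have "\<dots> \<le> L * (3 * (r * \<rho>) + 2 * (r * \<kappa> * \<rho>))"
    by (rule mult_left_mono[OF _ L_nonneg]) (use expectation_weighted_le[OF close(1) \<zeta> r] in linarith)
  also have "\<dots> = \<Lambda> * r * \<rho>" by (simp add: \<Lambda>_def algebra_simps)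
  finally show ?thesis .
qed

lemma bX_zero: "bX (\<lambda>_. 0) (\<lambda>_. 0) 0 = H1 0 + K1 0"
  by (simp add: bX_def prob_space sum_constant_scaleR)

lemma bY_zero: "bY s (\<lambda>_. 0) (\<lambda>_. 0) i = K2 0 + H2 0 + u i s (return borel 0)"
  by (simp add: bY_def prob_space sum_constant_scaleR distr_const)

text \<open>Comparison with the zero state, whose drift is the constant
  \<open>H1 0 + K1 0\<close>.\<close>

lemma bX_weighted_growth:
  assumes "integrable M \<zeta>" "0 \<le> r" "0 \<le> \<rho>" "AE \<omega> in M. norm (\<zeta> \<omega>) \<le> r * K \<omega> * \<rho>"
    "\<And>j. norm (y j) \<le> r * \<rho>" "norm x \<le> r * k * \<rho>" "1 \<le> k"
  shows "norm (bX \<zeta> y x) \<le> norm (H1 0 + K1 0) + \<Lambda> * (r * k) * \<rho>"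
proof -
  have "norm (bX \<zeta> y x - bX (\<lambda>_. 0) (\<lambda>_. 0) 0) \<le> \<Lambda> * (r * k) * \<rho>"
    by (rule bX_weighted_diff) (use assms in auto)
  then show ?thesis unfolding bX_zero using norm_triangle_sub[of "bX \<zeta> y x" "H1 0 + K1 0"] by linarith
qed

abbreviation u0 :: "'m \<Rightarrow> real \<Rightarrow> real" where
  "u0 i s \<equiv> norm (u i s (return borel 0))"

text \<open>The control at the Dirac mass is only integrable in time, so it stays as a function of
  \<open>s\<close> instead of entering a constant.\<close>

lemma bY_weighted_growth:
  assumes "s \<in> {0..T}" "integrable M \<zeta>" "0 \<le> r" "0 \<le> \<rho>" "AE \<omega> in M. norm (\<zeta> \<omega>) \<le> r * K \<omega> * \<rho>"
    "\<And>j. norm (y j) \<le> r * \<rho>"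
  shows "norm (bY s \<zeta> y i) \<le> norm (K2 0 + H2 0) + u0 i s + \<Lambda> * r * \<rho>"
proof -
  have "norm (bY s \<zeta> y i - bY s (\<lambda>_. 0) (\<lambda>_. 0) i) \<le> \<Lambda> * r * \<rho>"
    by (rule bY_weighted_diff) (use assms in auto)
  moreover have "norm (bY s \<zeta> y i)
      \<le> norm (K2 0 + H2 0 + u i s (return borel 0)) + norm (bY s \<zeta> y i - (K2 0 + H2 0 + u i s (return borel 0)))"
    by (rule norm_triangle_sub)
  moreover have "norm (K2 0 + H2 0 + u i s (return borel 0)) \<le> norm (K2 0 + H2 0) + u0 i s"
    by (rule norm_triangle_ineq)
  ultimately show ?thesis unfolding bY_zero by linarith
qed

section \<open>Solutions of the integral equation: uniqueness and the a priori bound\<close>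

abbreviation driftX :: "('w \<Rightarrow> real \<Rightarrow> 'b) \<Rightarrow> ('m \<Rightarrow> real \<Rightarrow> 'b) \<Rightarrow> 'w \<Rightarrow> real \<Rightarrow> 'b" where
  "driftX X Y \<omega> s \<equiv> bX (\<lambda>\<omega>'. X \<omega>' s) (\<lambda>j. Y j s) (X \<omega> s)"

abbreviation driftY :: "('w \<Rightarrow> real \<Rightarrow> 'b) \<Rightarrow> ('m \<Rightarrow> real \<Rightarrow> 'b) \<Rightarrow> 'm \<Rightarrow> real \<Rightarrow> 'b" where
  "driftY X Y i s \<equiv> bY s (\<lambda>\<omega>. X \<omega> s) (\<lambda>j. Y j s) i"

text \<open>\<open>G\<close> is a set of outcomes on which the integral equation holds for all
  times: everything for the solution constructed here, a set of full probability for a given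
  pathwise solution. \<open>has_integral\<close> includes the integrability of the drift.\<close>

definition solves :: "'w set \<Rightarrow> ('w \<Rightarrow> real \<Rightarrow> 'b) \<Rightarrow> ('m \<Rightarrow> real \<Rightarrow> 'b) \<Rightarrow> bool" where
  "solves G X Y \<longleftrightarrow> (AE \<omega> in M. \<omega> \<in> G) \<and>
     (\<forall>t\<in>{0..T}. (\<lambda>\<omega>. X \<omega> t) \<in> borel_measurable M) \<and>
     (\<forall>\<omega>\<in>G. \<forall>t\<in>{0..T}.
        (driftX X Y \<omega> has_integral (X \<omega> t - \<xi> \<omega> t)) {0..t}) \<and>
     (\<forall>i. \<forall>t\<in>{0..T}.
        (driftY X Y i has_integral (Y i t - Y0 i)) {0..t})"

definition dominated :: "real \<Rightarrow> 'w set \<Rightarrow> ('w \<Rightarrow> real \<Rightarrow> 'b) \<Rightarrow> ('m \<Rightarrow> real \<Rightarrow> 'b) \<Rightarrow> bool" where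
  "dominated r G X Y \<longleftrightarrow> (\<forall>\<omega>\<in>G. \<forall>t\<in>{0..T}. norm (X \<omega> t) \<le> r * K \<omega>) \<and> (\<forall>i. \<forall>t\<in>{0..T}. norm (Y i t) \<le> r)"

lemma integrable_dominated:
  assumes "solves G X Y" "dominated r G X Y" "t \<in> {0..T}"
  shows "integrable M (\<lambda>\<omega>. X \<omega> t)"
proof (rule Bochner_Integration.integrable_bound)
  show "integrable M (\<lambda>\<omega>. r * K \<omega>)" using K by auto
  show "(\<lambda>\<omega>. X \<omega> t) \<in> borel_measurable M" using assms by (auto simp: solves_def)
  have "AE \<omega> in M. \<omega> \<in> G" using assms by (auto simp: solves_def)
  then show "AE \<omega> in M. norm (X \<omega> t) \<le> norm (r * K \<omega>)"
  proof eventually_elim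
    case (elim \<omega>)
    then have "norm (X \<omega> t) \<le> r * K \<omega>" using assms by (auto simp: dominated_def)
    then show ?case by simp
  qed
qed

lemma dominated_nonneg: "dominated r G X Y \<Longrightarrow> 0 \<le> r"
proof -
  assume "dominated r G X Y"
  then have "norm (Y undefined 0) \<le> r" using T by (auto simp: dominated_def)
  then show ?thesis using norm_ge_zero[of "Y undefined 0"] by linarith
qed

lemma u_zero_integrable: "(u0 i) integrable_on {0..T}"
proof -
  have "return borel (0::'b) \<in> wasserstein_space 1"
    using distr_in_wasserstein_space[OF prob_space_axioms, of "\<lambda>_. 0::'b"] by (simp add: distr_const)
  then have "set_integrable lebesgue {0..T} (\<lambda>s. u i s (return borel 0))"
    using u[of i] by (auto simp: admissible_control_def caratheodory_fun_def)
  from absolutely_integrable_norm[OF this]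
  have "(u0 i) absolutely_integrable_on {0..T}" by (simp add: o_def)
  then show ?thesis by (rule set_lebesgue_integral_eq_integral(1))
qed

text \<open>Random and deterministic components become one family indexed by \<open>'w + 'm\<close>,
  so that a single constant measures both in the halving argument.\<close>

fun val :: "('w \<Rightarrow> real \<Rightarrow> 'b) \<Rightarrow> ('m \<Rightarrow> real \<Rightarrow> 'b) \<Rightarrow> 'w + 'm \<Rightarrow> real \<Rightarrow> 'b" where
  "val X Y (Inl \<omega>) t = X \<omega> t"
| "val X Y (Inr i) t = Y i t"

fun wt :: "'w + 'm \<Rightarrow> real" where
  "wt (Inl \<omega>) = K \<omega>"
| "wt (Inr i) = 1"

lemma wt_ge_1: "1 \<le> wt \<theta>"
  using K by (cases \<theta>) auto

text \<open>The forcing \<open>\<xi>\<close> and the initial values \<open>Y0\<close> cancel in the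
  difference, so by the drift estimates a constant \<open>q\<close> for the weighted difference
  improves to \<open>q / 2\<close>. Domination provides the finite start \<open>r + r'\<close>, and
  \<open>halving_bound\<close> with \<open>a = 0\<close> leaves no difference.\<close>

lemma uniqueness:
  assumes S: "solves G X Y" "solves G' X' Y'" and D: "dominated r G X Y" "dominated r' G' X' Y'"
    and t: "t \<in> {0..T}"
  shows "\<omega> \<in> G \<inter> G' \<Longrightarrow> X \<omega> t = X' \<omega> t" "Y i t = Y' i t"
proof -
  define I :: "(('w + 'm) \<times> real) set" where "I = (Inl ` (G \<inter> G') \<union> range Inr) \<times> {0..T}"
  define f where "f = (\<lambda>(\<theta>, t). norm (val X Y \<theta> t - val X' Y' \<theta> t))"
  define w where "w = (\<lambda>(\<theta>, t). wt \<theta> * exp (l * t))"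
  have ae: "AE \<omega> in M. \<omega> \<in> G \<inter> G'" using S by (auto simp: solves_def)
  have r: "0 \<le> r" "0 \<le> r'" using D dominated_nonneg by auto
  have e1: "1 \<le> exp (l * s)" if "s \<in> {0..T}" for s using that \<Lambda>_l by simp
  have bound: "f p \<le> 2 * 0 * w p" if "p \<in> I" for p
  proof (rule halving_bound[OF _ _ _ _ that])
    show "0 \<le> r + r'" using r by simp
    fix p assume "p \<in> I"
    then obtain \<theta> s where p: "p = (\<theta>, s)" and \<theta>: "\<theta> \<in> Inl ` (G \<inter> G') \<union> range Inr" and s: "s \<in> {0..T}"
      by (auto simp: I_def)
    have "f p \<le> norm (val X Y \<theta> s) + norm (val X' Y' \<theta> s)"
      unfolding f_def p by (simp add: norm_triangle_ineq4)
    also have "\<dots> \<le> r * wt \<theta> + r' * wt \<theta>"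
      using \<theta> s D by (cases \<theta>) (auto simp: dominated_def intro!: add_mono)
    also have "\<dots> = (r + r') * (wt \<theta> * 1)" by (simp add: algebra_simps)
    also have "\<dots> \<le> (r + r') * (wt \<theta> * exp (l * s))"
      using e1[OF s] wt_ge_1[of \<theta>] r by (intro mult_left_mono) auto
    finally show "f p \<le> (r + r') * w p" by (simp add: p w_def)
  next
    fix q p assume q: "0 \<le> q" and IH: "\<And>p. p \<in> I \<Longrightarrow> f p \<le> q * w p" and "p \<in> I"
    then obtain \<theta> t where p: "p = (\<theta>, t)" and \<theta>: "\<theta> \<in> Inl ` (G \<inter> G') \<union> range Inr" and t: "t \<in> {0..T}"
      by (auto simp: I_def)
    have IHX: "norm (X \<omega> s - X' \<omega> s) \<le> q * K \<omega> * exp (l * s)" if "\<omega> \<in> G \<inter> G'" "s \<in> {0..T}" for \<omega> s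
      using IH[of "(Inl \<omega>, s)"] that by (auto simp: I_def f_def w_def mult_ac)
    have IHY: "norm (Y i s - Y' i s) \<le> q * exp (l * s)" if "s \<in> {0..T}" for i s
      using IH[of "(Inr i, s)"] that by (auto simp: I_def f_def w_def mult_ac)
    have aeX: "AE \<omega> in M. norm (X \<omega> s - X' \<omega> s) \<le> q * K \<omega> * exp (l * s)" if "s \<in> {0..T}" for s
      using ae by eventually_elim (use IHX that in auto)
    have int: "integrable M (\<lambda>\<omega>. X \<omega> s)" "integrable M (\<lambda>\<omega>. X' \<omega> s)" if "s \<in> {0..T}" for s
      using integrable_dominated that S D by auto
    show "f p \<le> (0 + q / 2) * w p"
    proof (cases \<theta>)
      case (Inl \<omega>)
      then have \<omega>: "\<omega> \<in> G" "\<omega> \<in> G'" using \<theta> by auto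
      have hi: "((\<lambda>s. driftX X Y \<omega> s - driftX X' Y' \<omega> s)
          has_integral ((X \<omega> t - \<xi> \<omega> t) - (X' \<omega> t - \<xi> \<omega> t))) {0..t}"
        using S \<omega> t by (intro has_integral_diff) (auto simp: solves_def)
      have "norm ((X \<omega> t - \<xi> \<omega> t) - (X' \<omega> t - \<xi> \<omega> t)) \<le> 0 + (q * K \<omega>) / 2 * exp (l * t)"
      proof (rule exp_weighted_integral_bound[OF hi t, where h = "\<lambda>_. 0" and \<Lambda> = \<Lambda> and l = l and c = "q * K \<omega>"])
        show "0 \<le> q * K \<omega>" using q K(2)[of \<omega>] by simp
        fix s assume "s \<in> {0..t}"
        then have s: "s \<in> {0..T}" using t by auto
        have "norm (driftX X Y \<omega> s - driftX X' Y' \<omega> s)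
            \<le> \<Lambda> * (q * K \<omega>) * exp (l * s)"
          by (rule bX_weighted_diff) (use s int aeX IHX IHY \<omega> q K in auto)
        then show "norm (driftX X Y \<omega> s - driftX X' Y' \<omega> s)
            \<le> 0 + \<Lambda> * (q * K \<omega>) * exp (l * s)" by simp
      qed (use \<Lambda>_l in auto)
      then show ?thesis by (simp add: p Inl f_def w_def mult_ac)
    next
      case (Inr i)
      have hi: "((\<lambda>s. driftY X Y i s - driftY X' Y' i s)
          has_integral ((Y i t - Y0 i) - (Y' i t - Y0 i))) {0..t}"
        using S t by (intro has_integral_diff) (auto simp: solves_def)
      have "norm ((Y i t - Y0 i) - (Y' i t - Y0 i)) \<le> 0 + q / 2 * exp (l * t)"
      proof (rule exp_weighted_integral_bound[OF hi t, where h = "\<lambda>_. 0" and \<Lambda> = \<Lambda> and l = l and c = q])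
        fix s assume "s \<in> {0..t}"
        then have s: "s \<in> {0..T}" using t by auto
        have "norm (driftY X Y i s - driftY X' Y' i s)
            \<le> \<Lambda> * q * exp (l * s)"
          by (rule bY_weighted_diff) (use s int aeX IHY q K in auto)
        then show "norm (driftY X Y i s - driftY X' Y' i s)
            \<le> 0 + \<Lambda> * q * exp (l * s)" by simp
      qed (use \<Lambda>_l q in auto)
      then show ?thesis by (simp add: p Inr f_def w_def mult_ac)
    qed
  qed simp
  show "X \<omega> t = X' \<omega> t" if "\<omega> \<in> G \<inter> G'"
    using bound[of "(Inl \<omega>, t)"] that t by (auto simp: I_def f_def)
  show "Y i t = Y' i t"
    using bound[of "(Inr i, t)"] t by (auto simp: I_def f_def)
qed

text \<open>Everything inhomogeneous in the equation: the forcing (the term 1, relative to the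
  weight \<open>K\<close>), bounds for the time integrals of the drifts of the zero state, and the
  initial values. The sums over \<open>i\<close> dominate each single index.\<close>

definition A0 :: real where
  "A0 = 1 + T * norm (H1 0 + K1 0) + T * norm (K2 0 + H2 0) + (\<Sum>i\<in>UNIV. norm (Y0 i))
     + (\<Sum>i\<in>UNIV. integral {0..T} (u0 i))"

lemma A0_bounds:
  "1 + T * norm (H1 0 + K1 0) \<le> A0"
  "norm (Y0 i) + (T * norm (K2 0 + H2 0) + integral {0..T} (u0 i)) \<le> A0"
  "0 \<le> A0"
proof -
  have nn: "0 \<le> integral {0..T} (u0 i)" for i
    by (intro integral_nonneg u_zero_integrable) auto
  have s: "0 \<le> (\<Sum>i\<in>UNIV. norm (Y0 i))" "0 \<le> (\<Sum>i\<in>UNIV. integral {0..T} (u0 i))"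
    "norm (Y0 i) \<le> (\<Sum>i\<in>UNIV. norm (Y0 i))"
    "integral {0..T} (u0 i) \<le> (\<Sum>i\<in>UNIV. integral {0..T} (u0 i))"
    by (auto intro!: sum_nonneg member_le_sum nn)
  have "0 \<le> T * norm (H1 0 + K1 0)" "0 \<le> T * norm (K2 0 + H2 0)" using T by auto
  with s show "1 + T * norm (H1 0 + K1 0) \<le> A0"
    "norm (Y0 i) + (T * norm (K2 0 + H2 0) + integral {0..T} (u0 i)) \<le> A0"
    "0 \<le> A0"
    unfolding A0_def by linarith+
qed

text \<open>One step of the recursion \<open>q -> A0 + q / 2\<close>. The integrand \<open>g\<close>
  is arbitrary so that the same step serves solutions and the images of states under
  \<open>\<Phi>\<close>.\<close>

lemma random_path_bound_step:
  assumes hi: "(g has_integral J) {0..t}" and t: "t \<in> {0..T}" and q: "0 \<le> q"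
    and le: "\<And>s. s \<in> {0..t} \<Longrightarrow> norm (g s) \<le> norm (H1 0 + K1 0) + \<Lambda> * (q * K \<omega>) * exp (l * s)"
  shows "norm (\<xi> \<omega> t + J) \<le> (A0 + q / 2) * (K \<omega> * exp (l * t))"
proof -
  have K1: "1 \<le> K \<omega>" and e1: "1 \<le> exp (l * t)" using K t \<Lambda>_l by auto
  have "norm J \<le> T * norm (H1 0 + K1 0) + (q * K \<omega>) / 2 * exp (l * t)"
    by (rule exp_weighted_integral_bound[OF hi t _ _ _ _ _ _ _ le]) (use \<Lambda>_l q K1 T in auto)
  then have "norm (\<xi> \<omega> t + J) \<le> K \<omega> + T * norm (H1 0 + K1 0) + (q * K \<omega>) / 2 * exp (l * t)"
    using \<xi>_le[OF t, of \<omega>] norm_triangle_ineq[of "\<xi> \<omega> t" J] by linarith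
  also have "K \<omega> + T * norm (H1 0 + K1 0) \<le> A0 * (K \<omega> * exp (l * t))"
  proof -
    have "T * norm (H1 0 + K1 0) * 1 \<le> T * norm (H1 0 + K1 0) * K \<omega>"
      using K1 T by (intro mult_left_mono) auto
    then have "K \<omega> + T * norm (H1 0 + K1 0) \<le> (1 + T * norm (H1 0 + K1 0)) * K \<omega>"
      by (simp add: algebra_simps)
    also have "\<dots> \<le> A0 * K \<omega>" using A0_bounds(1) K1 by (intro mult_right_mono) auto
    also have "\<dots> = A0 * (K \<omega> * 1)" by simp
    also have "\<dots> \<le> A0 * (K \<omega> * exp (l * t))"
      using A0_bounds(3) K1 e1 by (intro mult_left_mono) auto
    finally show ?thesis .
  qed
  finally show ?thesis by (simp add: algebra_simps)
qed

lemma deterministic_path_bound_step: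
  assumes hi: "(g has_integral J) {0..t}" and t: "t \<in> {0..T}" and q: "0 \<le> q"
    and le: "\<And>s. s \<in> {0..t} \<Longrightarrow>
      norm (g s) \<le> norm (K2 0 + H2 0) + u0 i s + \<Lambda> * q * exp (l * s)"
  shows "norm (Y0 i + J) \<le> (A0 + q / 2) * exp (l * t)"
proof -
  have e1: "1 \<le> exp (l * t)" using t \<Lambda>_l by auto
  have A0e: "A0 \<le> A0 * exp (l * t)" using mult_left_mono[OF e1 A0_bounds(3)] by simp
  have "norm J \<le> (T * norm (K2 0 + H2 0) + integral {0..T} (u0 i)) + q / 2 * exp (l * t)"
  proof (rule exp_weighted_integral_bound[OF hi t _ _ _ _ _ _ _ le])
    show "(\<lambda>s. norm (K2 0 + H2 0) + u0 i s) integrable_on {0..T}"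
      by (intro integrable_add u_zero_integrable) auto
    show "integral {0..T} (\<lambda>s. norm (K2 0 + H2 0) + u0 i s)
        \<le> T * norm (K2 0 + H2 0) + integral {0..T} (u0 i)"
      by (subst Henstock_Kurzweil_Integration.integral_add) (use u_zero_integrable T in auto)
  qed (use \<Lambda>_l q in auto)
  then have "norm (Y0 i + J) \<le> A0 + q / 2 * exp (l * t)"
    using A0_bounds(2)[of i] norm_triangle_ineq[of "Y0 i" J] by linarith
  with A0e show ?thesis by (simp add: algebra_simps)
qed

text \<open>The given constant \<open>r\<close> only starts the recursion
  \<open>q -> A0 + q / 2\<close>; the limit \<open>2 * A0\<close> depends on the data alone, and
  \<open>exp (l * t) \<le> exp (l * T)\<close> removes the time weight.\<close>

lemma a_priori_bound:
  assumes S: "solves G X Y" and D: "dominated r G X Y"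
  shows "dominated (2 * A0 * exp (l * T)) G X Y"
proof -
  define I :: "(('w + 'm) \<times> real) set" where "I = (Inl ` G \<union> range Inr) \<times> {0..T}"
  define f where "f = (\<lambda>(\<theta>, t). norm (val X Y \<theta> t))"
  define w where "w = (\<lambda>(\<theta>, t). wt \<theta> * exp (l * t))"
  have ae: "AE \<omega> in M. \<omega> \<in> G" using S by (auto simp: solves_def)
  have r: "0 \<le> r" using D dominated_nonneg by auto
  have e1: "1 \<le> exp (l * s)" if "s \<in> {0..T}" for s using that \<Lambda>_l by simp
  have bound: "f p \<le> 2 * A0 * w p" if "p \<in> I" for p
  proof (rule halving_bound[OF r _ A0_bounds(3) _ that])
    fix p assume "p \<in> I"
    then obtain \<theta> s where p: "p = (\<theta>, s)" and \<theta>: "\<theta> \<in> Inl ` G \<union> range Inr" and s: "s \<in> {0..T}"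
      by (auto simp: I_def)
    have "f p \<le> r * (wt \<theta> * 1)"
      using \<theta> s D by (cases \<theta>) (auto simp: dominated_def f_def p)
    also have "\<dots> \<le> r * (wt \<theta> * exp (l * s))"
      using e1[OF s] wt_ge_1[of \<theta>] r by (intro mult_left_mono) auto
    finally show "f p \<le> r * w p" by (simp add: p w_def)
  next
    fix q p assume q: "0 \<le> q" and IH: "\<And>p. p \<in> I \<Longrightarrow> f p \<le> q * w p" and "p \<in> I"
    then obtain \<theta> t where p: "p = (\<theta>, t)" and \<theta>: "\<theta> \<in> Inl ` G \<union> range Inr" and t: "t \<in> {0..T}"
      by (auto simp: I_def)
    have IHX: "norm (X \<omega> s) \<le> q * K \<omega> * exp (l * s)" if "\<omega> \<in> G" "s \<in> {0..T}" for \<omega> s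
      using IH[of "(Inl \<omega>, s)"] that by (auto simp: I_def f_def w_def mult_ac)
    have IHY: "norm (Y i s) \<le> q * exp (l * s)" if "s \<in> {0..T}" for i s
      using IH[of "(Inr i, s)"] that by (auto simp: I_def f_def w_def mult_ac)
    have aeX: "AE \<omega> in M. norm (X \<omega> s) \<le> q * K \<omega> * exp (l * s)" if "s \<in> {0..T}" for s
      using ae by eventually_elim (use IHX that in auto)
    note int = integrable_dominated[OF S D]
    show "f p \<le> (A0 + q / 2) * w p"
    proof (cases \<theta>)
      case (Inl \<omega>)
      then have \<omega>: "\<omega> \<in> G" using \<theta> by auto
      have "norm (\<xi> \<omega> t + (X \<omega> t - \<xi> \<omega> t)) \<le> (A0 + q / 2) * (K \<omega> * exp (l * t))"
      proof (rule random_path_bound_step[OF _ t q])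
        show "(driftX X Y \<omega> has_integral (X \<omega> t - \<xi> \<omega> t)) {0..t}"
          using S \<omega> t by (auto simp: solves_def)
        fix s assume "s \<in> {0..t}"
        then have s: "s \<in> {0..T}" using t by auto
        show "norm (driftX X Y \<omega> s) \<le> norm (H1 0 + K1 0) + \<Lambda> * (q * K \<omega>) * exp (l * s)"
          by (rule bX_weighted_growth) (use s int aeX IHX IHY \<omega> q K in auto)
      qed
      then show ?thesis by (simp add: p Inl f_def w_def)
    next
      case (Inr i)
      have "norm (Y0 i + (Y i t - Y0 i)) \<le> (A0 + q / 2) * exp (l * t)"
      proof (rule deterministic_path_bound_step[OF _ t q])
        show "(driftY X Y i has_integral (Y i t - Y0 i)) {0..t}"
          using S t by (auto simp: solves_def)
        fix s assume "s \<in> {0..t}"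
        then have s: "s \<in> {0..T}" using t by auto
        show "norm (driftY X Y i s)
            \<le> norm (K2 0 + H2 0) + u0 i s + \<Lambda> * q * exp (l * s)"
          by (rule bY_weighted_growth) (use s int aeX IHY q in auto)
      qed
      then show ?thesis by (simp add: p Inr f_def w_def)
    qed
  qed
  have w_le: "2 * A0 * w (\<theta>, t) \<le> 2 * A0 * exp (l * T) * wt \<theta>" if "t \<in> {0..T}" for \<theta> t
  proof -
    have "exp (l * t) \<le> exp (l * T)" using that \<Lambda>_l by simp
    then have "2 * A0 * (wt \<theta> * exp (l * t)) \<le> 2 * A0 * (wt \<theta> * exp (l * T))"
      using A0_bounds(3) wt_ge_1[of \<theta>] by (intro mult_left_mono) auto
    then show ?thesis by (simp add: w_def mult_ac)
  qed
  show ?thesis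
    unfolding dominated_def
  proof (intro conjI ballI allI)
    fix \<omega> t assume "\<omega> \<in> G" "t \<in> {0..T}"
    then show "norm (X \<omega> t) \<le> 2 * A0 * exp (l * T) * K \<omega>"
      using order_trans[OF bound w_le, of "Inl \<omega>" t] by (auto simp: I_def f_def)
  next
    fix i t assume "t \<in> {0..T}"
    then show "norm (Y i t) \<le> 2 * A0 * exp (l * T)"
      using order_trans[OF bound w_le, of "Inr i" t] by (auto simp: I_def f_def)
  qed
qed

section \<open>Existence: clamped paths and the fixed point map\<close>

definition pr :: "real \<Rightarrow> real" where "pr t = max 0 (min T t)"

lemma pr_in: "pr t \<in> {0..T}" and pr_id: "t \<in> {0..T} \<Longrightarrow> pr t = t" and pr_pr: "pr (pr t) = pr t"
  using T by (auto simp: pr_def)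

lemma pr_range: "range pr \<subseteq> {0..T}"
  using pr_in by blast

lemma continuous_on_pr: "continuous_on A pr"
  unfolding pr_def by (intro continuous_intros)

text \<open>
  The state \<open>x\<close> collects the random path \<open>x (Inl \<omega>)\<close> and the deterministic paths \<open>x (Inr i)\<close>,
  extended to constants outside \<open>[0,T]\<close>.
\<close>

definition states :: "('w + 'm \<Rightarrow> real \<Rightarrow> 'b) set" where
  "states = {x. (\<forall>\<theta>. continuous_on UNIV (x \<theta>)) \<and> (\<forall>\<theta> t. x \<theta> t = x \<theta> (pr t)) \<and>
     (\<forall>t. (\<lambda>\<omega>. x (Inl \<omega>) t) \<in> borel_measurable M) \<and> (\<exists>r\<ge>0. \<forall>\<theta> t. norm (x \<theta> t) \<le> r * wt \<theta>)}"

abbreviation BX :: "('w + 'm \<Rightarrow> real \<Rightarrow> 'b) \<Rightarrow> 'w \<Rightarrow> real \<Rightarrow> 'b" where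
  "BX x \<omega> s \<equiv> bX (\<lambda>\<omega>'. x (Inl \<omega>') s) (\<lambda>j. x (Inr j) s) (x (Inl \<omega>) s)"

abbreviation BY :: "('w + 'm \<Rightarrow> real \<Rightarrow> 'b) \<Rightarrow> 'm \<Rightarrow> real \<Rightarrow> 'b" where
  "BY x i s \<equiv> bY s (\<lambda>\<omega>'. x (Inl \<omega>') s) (\<lambda>j. x (Inr j) s) i"

fun \<Phi> :: "('w + 'm \<Rightarrow> real \<Rightarrow> 'b) \<Rightarrow> 'w + 'm \<Rightarrow> real \<Rightarrow> 'b" where
  "\<Phi> x (Inl \<omega>) t = \<xi> \<omega> (pr t) + integral {0..pr t} (BX x \<omega>)"
| "\<Phi> x (Inr i) t = Y0 i + integral {0..pr t} (BY x i)"

text \<open>The time is clamped here as well, so that on the whole real line the weight lies between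
  \<open>wt \<theta>\<close> and \<open>exp (l * T) * wt \<theta>\<close>.\<close>

definition ewt :: "'w + 'm \<Rightarrow> real \<Rightarrow> real" where
  "ewt \<theta> t = wt \<theta> * exp (l * pr t)"

lemma ewt_ge: "wt \<theta> \<le> ewt \<theta> t" and ewt_le: "ewt \<theta> t \<le> exp (l * T) * wt \<theta>" and ewt_nonneg: "0 \<le> ewt \<theta> t"
proof -
  have w: "1 \<le> wt \<theta>" by (rule wt_ge_1)
  have p: "0 \<le> pr t" "pr t \<le> T" using pr_in[of t] by auto
  have "1 \<le> exp (l * pr t)" using p \<Lambda>_l by simp
  from mult_left_mono[OF this, of "wt \<theta>"] w show "wt \<theta> \<le> ewt \<theta> t" by (simp add: ewt_def)
  then show "0 \<le> ewt \<theta> t" using w by linarith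
  have "exp (l * pr t) \<le> exp (l * T)" using p \<Lambda>_l by simp
  from mult_left_mono[OF this, of "wt \<theta>"] w show "ewt \<theta> t \<le> exp (l * T) * wt \<theta>"
    by (simp add: ewt_def mult.commute)
qed

lemma states_integrable:
  assumes "x \<in> states"
  shows "integrable M (\<lambda>\<omega>. x (Inl \<omega>) t)"
proof -
  obtain r where r: "r \<ge> 0" "\<And>\<theta> t. norm (x \<theta> t) \<le> r * wt \<theta>" using assms by (auto simp: states_def)
  show ?thesis
  proof (rule Bochner_Integration.integrable_bound)
    show "integrable M (\<lambda>\<omega>. r * K \<omega>)" using K by auto
    show "(\<lambda>\<omega>. x (Inl \<omega>) t) \<in> borel_measurable M" using assms by (auto simp: states_def)
    have "norm (x (Inl \<omega>) t) \<le> norm (r * K \<omega>)" for \<omega> using r(2)[of "Inl \<omega>" t] by simp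
    then show "AE \<omega> in M. norm (x (Inl \<omega>) t) \<le> norm (r * K \<omega>)" by simp
  qed
qed

lemma states_joint_measurable:
  assumes "x \<in> states"
  shows "(\<lambda>z. x (Inl (fst z)) (snd z)) \<in> borel_measurable (M \<Otimes>\<^sub>M borel)"
  using borel_measurable_continuous_process[of "\<lambda>\<omega>. x (Inl \<omega>)" M] assms
  by (simp add: states_def case_prod_beta')

lemma states_Inr_measurable:
  assumes "x \<in> states"
  shows "(\<lambda>s. x (Inr j) s) \<in> borel_measurable borel"
  using assms by (intro borel_measurable_continuous_onI) (simp add: states_def)

text \<open>Measurability of a parameter integral, from joint measurability on the product space.
  Keeping \<open>g\<close> and \<open>s\<close> general covers both the parameter (\<omega>, s) and
  the time alone.\<close>

lemma expectation_state_measurable: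
  fixes H :: "'b \<Rightarrow> 'b" and g :: "'c \<Rightarrow> 'b"
  assumes x: "x \<in> states" and H: "L-lipschitz_on UNIV H"
    and g: "g \<in> borel_measurable N" and s: "s \<in> borel_measurable N"
  shows "(\<lambda>z. LINT \<omega>|M. H (g z - x (Inl \<omega>) (s z))) \<in> borel_measurable N"
proof (rule borel_measurable_lebesgue_integral)
  have [measurable]: "H \<in> borel_measurable borel" "g \<in> borel_measurable N" "s \<in> borel_measurable N"
    using lipschitz_borel[OF H] g s by auto
  have "(\<lambda>p. (snd p, s (fst p))) \<in> measurable (N \<Otimes>\<^sub>M M) (M \<Otimes>\<^sub>M borel)" by measurable
  from measurable_compose[OF this states_joint_measurable[OF x]]
  have [measurable]: "(\<lambda>p. x (Inl (snd p)) (s (fst p))) \<in> borel_measurable (N \<Otimes>\<^sub>M M)" by simp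
  have "(\<lambda>p. H (g (fst p) - x (Inl (snd p)) (s (fst p)))) \<in> borel_measurable (N \<Otimes>\<^sub>M M)" by measurable
  then show "(\<lambda>(z, \<omega>). H (g z - x (Inl \<omega>) (s z))) \<in> borel_measurable (N \<Otimes>\<^sub>M M)"
    by (simp add: case_prod_beta')
qed

lemma BX_joint_measurable:
  assumes x: "x \<in> states"
  shows "(\<lambda>z. BX x (fst z) (snd z)) \<in> borel_measurable (M \<Otimes>\<^sub>M borel)"
proof -
  have [measurable]: "(\<lambda>z. x (Inl (fst z)) (snd z)) \<in> borel_measurable (M \<Otimes>\<^sub>M borel)"
    "\<And>j. (\<lambda>s. x (Inr j) s) \<in> borel_measurable borel" "K1 \<in> borel_measurable borel"
    using states_joint_measurable[OF x] states_Inr_measurable[OF x] lipschitz_borel[OF lip(3)] by auto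
  have [measurable]: "(\<lambda>z. LINT \<omega>|M. H1 (x (Inl (fst z)) (snd z) - x (Inl \<omega>) (snd z)))
      \<in> borel_measurable (M \<Otimes>\<^sub>M borel)"
    by (rule expectation_state_measurable[OF x lip(1)]) auto
  show ?thesis unfolding bX_def by measurable
qed

lemma BX_measurable:
  assumes x: "x \<in> states"
  shows "BX x \<omega> \<in> borel_measurable borel"
proof -
  have [measurable]: "\<And>\<theta>. (\<lambda>s. x \<theta> s) \<in> borel_measurable borel"
    using x by (intro borel_measurable_continuous_onI) (simp add: states_def)
  have [measurable]: "K1 \<in> borel_measurable borel" using lipschitz_borel[OF lip(3)] .
  have [measurable]: "(\<lambda>s. LINT \<omega>'|M. H1 (x (Inl \<omega>) s - x (Inl \<omega>') s)) \<in> borel_measurable borel"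
    by (rule expectation_state_measurable[OF x lip(1)]) auto
  show ?thesis unfolding bX_def by measurable
qed

lemma BX_bounded:
  assumes x: "x \<in> states"
  obtains c where "0 \<le> c" "\<And>\<omega> s. norm (BX x \<omega> s) \<le> norm (H1 0 + K1 0) + \<Lambda> * (c * K \<omega>)"
proof -
  obtain r where r: "r \<ge> 0" "\<And>\<theta> t. norm (x \<theta> t) \<le> r * wt \<theta>" using x by (auto simp: states_def)
  have "norm (BX x \<omega> s) \<le> norm (H1 0 + K1 0) + \<Lambda> * (r * K \<omega>) * 1" for \<omega> s
    by (rule bX_weighted_growth)
      (use states_integrable[OF x] r(1) r(2)[of "Inl _"] r(2)[of "Inr _"] K(2) in auto)
  then show ?thesis using that[of r] r(1) by simp
qed

lemma BX_absolutely_integrable: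
  assumes x: "x \<in> states"
  shows "BX x \<omega> absolutely_integrable_on {0..t}"
proof -
  obtain c where c: "\<And>\<omega> s. norm (BX x \<omega> s) \<le> norm (H1 0 + K1 0) + \<Lambda> * (c * K \<omega>)"
    using BX_bounded[OF x] by metis
  show ?thesis
  proof (rule measurable_bounded_by_integrable_imp_absolutely_integrable)
    show "BX x \<omega> \<in> borel_measurable (lebesgue_on {0..t})"
      by (rule borel_imp_lebesgue_on_measurable[OF BX_measurable[OF x]])
    show "(\<lambda>_. norm (H1 0 + K1 0) + \<Lambda> * (c * K \<omega>)) integrable_on {0..t}" by auto
  qed (use c in auto)
qed

text \<open>A control is measurable in time only for a fixed measure. Freezing the law at rounded
  times leaves countably many measures; as the mesh shrinks, path continuity and domination by
  \<open>K\<close> give L^1 convergence of the variables, and the Lipschitz bound of the control in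
  W_1 gives convergence of its values.\<close>

lemma u_state_measurable:
  assumes x: "x \<in> states"
  shows "(\<lambda>s. u i s (distr M borel (\<lambda>\<omega>. x (Inl \<omega>) s))) \<in> borel_measurable (lebesgue_on {0..T})"
proof (rule borel_measurable_LIMSEQ_metric)
  fix n
  define g where "g j s = u i s (distr M borel (\<lambda>\<omega>. x (Inl \<omega>) (of_int j / real (Suc n))))" for j :: int and s
  have gm: "g j \<in> borel_measurable (lebesgue_on {0..T})" for j
  proof -
    have "distr M borel (\<lambda>\<omega>. x (Inl \<omega>) (of_int j / real (Suc n))) \<in> wasserstein_space 1"
      by (intro distr_in_wasserstein_space prob_space_axioms states_integrable x)
    then show ?thesis using u[of i] unfolding g_def admissible_control_def caratheodory_fun_def by blast
  qed
  have fm: "(\<lambda>s. \<lfloor>real (Suc n) * s\<rfloor>) \<in> measurable (lebesgue_on {0..T}) (count_space UNIV)"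
    by (rule borel_imp_lebesgue_on_measurable) measurable
  have "(\<lambda>s. g \<lfloor>real (Suc n) * s\<rfloor> s) \<in> borel_measurable (lebesgue_on {0..T})"
    by (rule measurable_compose_countable[OF gm fm])
  then show "(\<lambda>s. u i s (distr M borel (\<lambda>\<omega>. x (Inl \<omega>) (grid n s))))
      \<in> borel_measurable (lebesgue_on {0..T})" by (simp add: g_def)
next
  fix s assume "s \<in> space (lebesgue_on {0..T})"
  then have s: "s \<in> {0..T}" by simp
  obtain r where r: "r \<ge> 0" "\<And>\<theta> t. norm (x \<theta> t) \<le> r * wt \<theta>" using x by (auto simp: states_def)
  define q where "q n = grid n s" for n
  have [measurable]: "\<And>t. (\<lambda>\<omega>. x (Inl \<omega>) t) \<in> borel_measurable M" using x by (auto simp: states_def)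
  have "(\<lambda>n. LINT \<omega>|M. norm (x (Inl \<omega>) (q n) - x (Inl \<omega>) s)) \<longlonglongrightarrow> (LINT \<omega>|M. 0)"
  proof (rule integral_dominated_convergence[where w = "\<lambda>\<omega>. 2 * r * K \<omega>"])
    show "integrable M (\<lambda>\<omega>. 2 * r * K \<omega>)" using K by auto
    show "AE \<omega> in M. (\<lambda>n. norm (x (Inl \<omega>) (q n) - x (Inl \<omega>) s)) \<longlonglongrightarrow> 0"
    proof (rule AE_I2)
      fix \<omega>
      have "isCont (x (Inl \<omega>)) s" using x by (simp add: states_def continuous_on_eq_continuous_at)
      from isCont_tendsto_compose[OF this floor_grid_tendsto]
      have "(\<lambda>n. x (Inl \<omega>) (q n)) \<longlonglongrightarrow> x (Inl \<omega>) s" by (simp add: q_def)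
      then show "(\<lambda>n. norm (x (Inl \<omega>) (q n) - x (Inl \<omega>) s)) \<longlonglongrightarrow> 0"
        by (intro tendsto_norm_zero) (simp add: LIM_zero_iff)
    qed
    show "AE \<omega> in M. norm (norm (x (Inl \<omega>) (q n) - x (Inl \<omega>) s)) \<le> 2 * r * K \<omega>" for n
    proof (rule AE_I2)
      fix \<omega>
      have "norm (x (Inl \<omega>) (q n) - x (Inl \<omega>) s) \<le> r * K \<omega> + r * K \<omega>"
        using r(2)[of "Inl \<omega>" "q n"] r(2)[of "Inl \<omega>" s]
          norm_triangle_ineq4[of "x (Inl \<omega>) (q n)" "x (Inl \<omega>) s"] by simp
      then show "norm (norm (x (Inl \<omega>) (q n) - x (Inl \<omega>) s)) \<le> 2 * r * K \<omega>" by simp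
    qed
  qed measurable
  then have lim: "(\<lambda>n. L * (LINT \<omega>|M. norm (x (Inl \<omega>) (q n) - x (Inl \<omega>) s))) \<longlonglongrightarrow> 0"
    by (simp add: tendsto_mult_right_zero)
  have "(\<lambda>n. u i s (distr M borel (\<lambda>\<omega>. x (Inl \<omega>) (q n))) - u i s (distr M borel (\<lambda>\<omega>. x (Inl \<omega>) s))) \<longlonglongrightarrow> 0"
    by (rule Lim_null_comparison[OF _ lim]) (auto intro!: always_eventually u_diff s states_integrable x)
  then show "(\<lambda>n. u i s (distr M borel (\<lambda>\<omega>. x (Inl \<omega>) (grid n s))))
      \<longlonglongrightarrow> u i s (distr M borel (\<lambda>\<omega>. x (Inl \<omega>) s))"
    by (simp add: LIM_zero_iff q_def)
qed

lemma BY_absolutely_integrable: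
  assumes x: "x \<in> states"
  shows "BY x i absolutely_integrable_on {0..T}"
proof -
  obtain r where r: "r \<ge> 0" "\<And>\<theta> t. norm (x \<theta> t) \<le> r * wt \<theta>" using x by (auto simp: states_def)
  have b: "norm (BY x i s) \<le> norm (K2 0 + H2 0) + u0 i s + \<Lambda> * r * 1" if "s \<in> {0..T}" for s
    by (rule bY_weighted_growth)
      (use that states_integrable[OF x] r(1) r(2)[of "Inl _"] r(2)[of "Inr _"] in auto)
  have m1: "(\<lambda>s. (LINT \<omega>|M. K2 (x (Inr i) s - x (Inl \<omega>) s))
     + (1 / real CARD('m)) *\<^sub>R (\<Sum>j\<in>UNIV. H2 (x (Inr j) s - x (Inr i) s))) \<in> borel_measurable borel"
  proof -
    have [measurable]: "\<And>\<theta>. (\<lambda>s. x \<theta> s) \<in> borel_measurable borel"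
      using x by (intro borel_measurable_continuous_onI) (simp add: states_def)
    have [measurable]: "H2 \<in> borel_measurable borel" using lipschitz_borel[OF lip(2)] .
    have [measurable]: "(\<lambda>s. LINT \<omega>'|M. K2 (x (Inr i) s - x (Inl \<omega>') s)) \<in> borel_measurable borel"
      by (rule expectation_state_measurable[OF x lip(4)]) auto
    show ?thesis by measurable
  qed
  show ?thesis
  proof (rule measurable_bounded_by_integrable_imp_absolutely_integrable)
    show "BY x i \<in> borel_measurable (lebesgue_on {0..T})"
      unfolding bY_def
      by (intro borel_measurable_add borel_imp_lebesgue_on_measurable[OF m1] u_state_measurable x)
    show "(\<lambda>s. norm (K2 0 + H2 0) + u0 i s + \<Lambda> * r * 1) integrable_on {0..T}"
      by (intro integrable_add u_zero_integrable) auto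
  qed (use b in auto)
qed

lemma BX_has_integral:
  "x \<in> states \<Longrightarrow> (BX x \<omega> has_integral integral {0..t} (BX x \<omega>)) {0..t}"
  using set_lebesgue_integral_eq_integral(1)[OF BX_absolutely_integrable] by (rule integrable_integral)

lemma BY_has_integral:
  assumes "x \<in> states" "t \<in> {0..T}"
  shows "(BY x i has_integral integral {0..t} (BY x i)) {0..t}"
  using set_lebesgue_integral_eq_integral(1)[OF BY_absolutely_integrable[OF assms(1), of i]] assms(2)
  by (intro integrable_integral) (auto intro: integrable_on_subinterval)

text \<open>The gauge integral is rewritten as an integral over \<open>lborel\<close>, where
  measurability in the parameter follows from joint measurability of the integrand.\<close>

lemma integral_BX_measurable:
  assumes x: "x \<in> states"
  shows "(\<lambda>\<omega>. integral {0..t} (BX x \<omega>)) \<in> borel_measurable M"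
proof -
  have eq: "integral {0..t} (BX x \<omega>) = (LINT s|lborel. indicator {0..t} s *\<^sub>R BX x \<omega> s)" for \<omega>
  proof -
    have [measurable]: "BX x \<omega> \<in> borel_measurable borel" by (rule BX_measurable[OF x])
    have "integral {0..t} (BX x \<omega>) = (LINT s|lebesgue. indicator {0..t} s *\<^sub>R BX x \<omega> s)"
      using set_lebesgue_integral_eq_integral(2)[OF BX_absolutely_integrable[OF x], of t \<omega>]
      by (simp add: set_lebesgue_integral_def)
    also have "\<dots> = (LINT s|lborel. indicator {0..t} s *\<^sub>R BX x \<omega> s)"
      by (rule integral_completion) measurable
    finally show ?thesis .
  qed
  have [measurable]: "(\<lambda>z. BX x (fst z) (snd z)) \<in> borel_measurable (M \<Otimes>\<^sub>M borel)"
    by (rule BX_joint_measurable[OF x])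
  have "(\<lambda>z. indicator {0..t} (snd z) *\<^sub>R BX x (fst z) (snd z)) \<in> borel_measurable (M \<Otimes>\<^sub>M borel)"
    by measurable
  then have "(\<lambda>(\<omega>, s). indicator {0..t} s *\<^sub>R BX x \<omega> s) \<in> borel_measurable (M \<Otimes>\<^sub>M lborel)"
    by (simp add: case_prod_beta' cong: measurable_cong_sets)
  then show ?thesis unfolding eq by (rule lborel.borel_measurable_lebesgue_integral)
qed

lemma \<Phi>_difference:
  assumes x: "x \<in> states" and y: "y \<in> states" and r: "0 \<le> r"
    and close: "\<And>\<theta> t. norm (x \<theta> t - y \<theta> t) \<le> r * ewt \<theta> t"
  shows "norm (\<Phi> x \<theta> t - \<Phi> y \<theta> t) \<le> r / 2 * ewt \<theta> t"
proof -
  note p = pr_in[of t]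
  have cX: "norm (x (Inl \<omega>) s - y (Inl \<omega>) s) \<le> r * K \<omega> * exp (l * s)" if "s \<in> {0..pr t}" for \<omega> s
    using close[of "Inl \<omega>" s] pr_id[of s] that p by (simp add: ewt_def)
  have cY: "norm (x (Inr i) s - y (Inr i) s) \<le> r * exp (l * s)" if "s \<in> {0..pr t}" for i s
    using close[of "Inr i" s] pr_id[of s] that p by (simp add: ewt_def)
  show ?thesis
  proof (cases \<theta>)
    case (Inl \<omega>)
    have "norm (integral {0..pr t} (BX x \<omega>) - integral {0..pr t} (BX y \<omega>)) \<le> 0 + (r * K \<omega>) / 2 * exp (l * pr t)"
    proof (rule exp_weighted_integral_bound[OF has_integral_diff[OF BX_has_integral[OF x] BX_has_integral[OF y]] p,
          where h = "\<lambda>_. 0" and \<Lambda> = \<Lambda> and l = l and c = "r * K \<omega>"])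
      fix s assume s: "s \<in> {0..pr t}"
      have "norm (BX x \<omega> s - BX y \<omega> s) \<le> \<Lambda> * (r * K \<omega>) * exp (l * s)"
        by (rule bX_weighted_diff) (use s states_integrable x y r cX cY K in auto)
      then show "norm (BX x \<omega> s - BX y \<omega> s) \<le> 0 + \<Lambda> * (r * K \<omega>) * exp (l * s)" by simp
    qed (use \<Lambda>_l r K(2)[of \<omega>] in auto)
    then show ?thesis by (simp add: Inl ewt_def mult_ac)
  next
    case (Inr i)
    have "norm (integral {0..pr t} (BY x i) - integral {0..pr t} (BY y i)) \<le> 0 + r / 2 * exp (l * pr t)"
    proof (rule exp_weighted_integral_bound[OF has_integral_diff[OF BY_has_integral[OF x p] BY_has_integral[OF y p]] p,
          where h = "\<lambda>_. 0" and \<Lambda> = \<Lambda> and l = l and c = r])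
      fix s assume s: "s \<in> {0..pr t}"
      have "norm (BY x i s - BY y i s) \<le> \<Lambda> * r * exp (l * s)"
        by (rule bY_weighted_diff) (use s p states_integrable x y r cX cY in auto)
      then show "norm (BY x i s - BY y i s) \<le> 0 + \<Lambda> * r * exp (l * s)" by simp
    qed (use \<Lambda>_l r in auto)
    then show ?thesis by (simp add: Inr ewt_def mult_ac)
  qed
qed

lemma \<Phi>_growth:
  assumes x: "x \<in> states" and r: "0 \<le> r" and b: "\<And>\<theta> t. norm (x \<theta> t) \<le> r * ewt \<theta> t"
  shows "norm (\<Phi> x \<theta> t) \<le> (A0 + r / 2) * ewt \<theta> t"
proof -
  note p = pr_in[of t]
  have cX: "norm (x (Inl \<omega>) s) \<le> r * K \<omega> * exp (l * s)" if "s \<in> {0..pr t}" for \<omega> s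
    using b[of "Inl \<omega>" s] pr_id[of s] that p by (simp add: ewt_def)
  have cY: "norm (x (Inr i) s) \<le> r * exp (l * s)" if "s \<in> {0..pr t}" for i s
    using b[of "Inr i" s] pr_id[of s] that p by (simp add: ewt_def)
  show ?thesis
  proof (cases \<theta>)
    case (Inl \<omega>)
    have "norm (\<xi> \<omega> (pr t) + integral {0..pr t} (BX x \<omega>)) \<le> (A0 + r / 2) * (K \<omega> * exp (l * pr t))"
    proof (rule random_path_bound_step[OF BX_has_integral[OF x] p r])
      fix s assume s: "s \<in> {0..pr t}"
      show "norm (BX x \<omega> s) \<le> norm (H1 0 + K1 0) + \<Lambda> * (r * K \<omega>) * exp (l * s)"
        by (rule bX_weighted_growth) (use s states_integrable x r cX cY K in auto)
    qed
    then show ?thesis by (simp add: Inl ewt_def)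
  next
    case (Inr i)
    have "norm (Y0 i + integral {0..pr t} (BY x i)) \<le> (A0 + r / 2) * exp (l * pr t)"
    proof (rule deterministic_path_bound_step[OF BY_has_integral[OF x p] p r])
      fix s assume s: "s \<in> {0..pr t}"
      show "norm (BY x i s) \<le> norm (K2 0 + H2 0) + u0 i s + \<Lambda> * r * exp (l * s)"
        by (rule bY_weighted_growth) (use s p states_integrable x r cX cY in auto)
    qed
    then show ?thesis by (simp add: Inr ewt_def)
  qed
qed

lemma \<Phi>_states:
  assumes x: "x \<in> states"
  shows "\<Phi> x \<in> states"
  unfolding states_def
proof (intro CollectI conjI allI)
  fix \<theta> show "continuous_on UNIV (\<Phi> x \<theta>)"
  proof (cases \<theta>)
    case (Inl \<omega>)
    have "continuous_on {0..T} (\<lambda>t. \<xi> \<omega> t + integral {0..t} (BX x \<omega>))"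
      by (intro continuous_on_add \<xi>_cont indefinite_integral_continuous_1
          set_lebesgue_integral_eq_integral(1)[OF BX_absolutely_integrable[OF x]])
    from continuous_on_compose2[OF this continuous_on_pr[of UNIV]] show ?thesis
      using pr_range by (simp add: Inl)
  next
    case (Inr i)
    have "continuous_on {0..T} (\<lambda>t. Y0 i + integral {0..t} (BY x i))"
      by (intro continuous_on_add continuous_on_const indefinite_integral_continuous_1
          set_lebesgue_integral_eq_integral(1)[OF BY_absolutely_integrable[OF x]])
    from continuous_on_compose2[OF this continuous_on_pr[of UNIV]] show ?thesis
      using pr_range by (simp add: Inr)
  qed
next
  fix \<theta> t show "\<Phi> x \<theta> t = \<Phi> x \<theta> (pr t)" by (cases \<theta>) (simp_all add: pr_pr)
next
  fix t show "(\<lambda>\<omega>. \<Phi> x (Inl \<omega>) t) \<in> borel_measurable M"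
    by (simp, intro borel_measurable_add \<xi>_meas integral_BX_measurable x pr_in)
next
  obtain r where r: "r \<ge> 0" "\<And>\<theta> t. norm (x \<theta> t) \<le> r * wt \<theta>" using x by (auto simp: states_def)
  have "norm (x \<theta> t) \<le> r * ewt \<theta> t" for \<theta> t
    using r(2)[of \<theta> t] mult_left_mono[OF ewt_ge r(1), of \<theta> t] by linarith
  from \<Phi>_growth[OF x r(1) this]
  have "norm (\<Phi> x \<theta> t) \<le> (A0 + r / 2) * ewt \<theta> t" for \<theta> t .
  moreover have "(A0 + r / 2) * ewt \<theta> t \<le> (A0 + r / 2) * exp (l * T) * wt \<theta>" for \<theta> t
    using mult_left_mono[OF ewt_le, of "A0 + r / 2" \<theta> t] r(1) A0_bounds(3) by (simp add: mult_ac)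
  ultimately have "norm (\<Phi> x \<theta> t) \<le> ((A0 + r / 2) * exp (l * T)) * wt \<theta>" for \<theta> t
    by (meson order_trans)
  moreover have "0 \<le> (A0 + r / 2) * exp (l * T)" using r(1) A0_bounds(3) by simp
  ultimately show "\<exists>r\<ge>0. \<forall>\<theta> t. norm (\<Phi> x \<theta> t) \<le> r * wt \<theta>" by blast
qed

text \<open>The time weight is bounded, so convergence is uniform in time for each index, which
  preserves continuity; measurability and clamping pass to pointwise limits, and the growth bound is
  inherited from \<open>X 0\<close>.\<close>

lemma states_closed:
  assumes X: "\<And>n::nat. X n \<in> states" and r: "r \<longlonglongrightarrow> 0"
    and close: "\<And>n \<theta> t. norm (X n \<theta> t - x \<theta> t) \<le> r n * ewt \<theta> t"
  shows "x \<in> states"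
proof -
  have close': "norm (X n \<theta> t - x \<theta> t) \<le> \<bar>r n\<bar> * exp (l * T) * wt \<theta>" for n \<theta> t
  proof -
    have "norm (X n \<theta> t - x \<theta> t) \<le> \<bar>r n\<bar> * ewt \<theta> t"
      using close[of n \<theta> t] mult_right_mono[OF abs_ge_self ewt_nonneg, of "r n" \<theta> t] by linarith
    also have "\<dots> \<le> \<bar>r n\<bar> * (exp (l * T) * wt \<theta>)" by (intro mult_left_mono ewt_le) auto
    finally show ?thesis by (simp add: mult.assoc)
  qed
  have r0: "(\<lambda>n. \<bar>r n\<bar> * exp (l * T) * wt \<theta>) \<longlonglongrightarrow> 0" for \<theta>
    by (intro tendsto_mult_left_zero tendsto_rabs_zero r)
  have lim: "(\<lambda>n. X n \<theta> t) \<longlonglongrightarrow> x \<theta> t" for \<theta> t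
    by (rule LIM_zero_cancel, rule Lim_null_comparison[OF _ r0[of \<theta>]]) (use close' in auto)
  show ?thesis
    unfolding states_def
  proof (intro CollectI conjI allI)
    fix \<theta>
    have "uniform_limit UNIV (\<lambda>n. X n \<theta>) (x \<theta>) sequentially"
    proof (rule uniform_limitI)
      fix e :: real assume "e > 0"
      then have "\<forall>\<^sub>F n in sequentially. \<bar>r n\<bar> * exp (l * T) * wt \<theta> < e" using r0 by (intro order_tendstoD) auto
      then show "\<forall>\<^sub>F n in sequentially. \<forall>t\<in>UNIV. dist (X n \<theta> t) (x \<theta> t) < e"
        by eventually_elim (use close' in \<open>auto simp: dist_norm intro: le_less_trans\<close>)
    qed
    then show "continuous_on UNIV (x \<theta>)"
      by (rule uniform_limit_theorem[rotated]) (use X in \<open>auto simp: states_def intro!: always_eventually\<close>)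
  next
    fix \<theta> t
    have "X n \<theta> t = X n \<theta> (pr t)" for n using X[of n] by (auto simp: states_def)
    then show "x \<theta> t = x \<theta> (pr t)" using lim[of \<theta> t] lim[of \<theta> "pr t"] by (auto intro: LIMSEQ_unique)
  next
    fix t show "(\<lambda>\<omega>. x (Inl \<omega>) t) \<in> borel_measurable M"
      by (rule borel_measurable_LIMSEQ_metric[OF _ lim]) (use X in \<open>auto simp: states_def\<close>)
  next
    obtain q where q: "q \<ge> 0" "\<And>\<theta> t. norm (X 0 \<theta> t) \<le> q * wt \<theta>" using X[of 0] by (auto simp: states_def)
    have "norm (x \<theta> t) \<le> (q + \<bar>r 0\<bar> * exp (l * T)) * wt \<theta>" for \<theta> t
      using q(2)[of \<theta> t] close'[of 0 \<theta> t] norm_triangle_ineq4[of "X 0 \<theta> t" "X 0 \<theta> t - x \<theta> t"]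
      by (simp add: algebra_simps)
    moreover have "0 \<le> q + \<bar>r 0\<bar> * exp (l * T)" using q(1) by simp
    ultimately show "\<exists>r\<ge>0. \<forall>\<theta> t. norm (x \<theta> t) \<le> r * wt \<theta>" by blast
  qed
qed

lemma existence:
  obtains X Y where "solves UNIV X Y"
    "\<And>\<omega>. continuous_on {0..T} (X \<omega>)" "\<And>i. continuous_on {0..T} (Y i)"
    "\<And>t. t \<in> {0..T} \<Longrightarrow> integrable M (\<lambda>\<omega>. X \<omega> t)"
    "\<And>\<omega> t. driftX X Y \<omega> absolutely_integrable_on {0..t}"
    "\<And>i. driftY X Y i absolutely_integrable_on {0..T}"
proof -
  have zero: "(\<lambda>_ _. 0) \<in> states" by (auto simp: states_def intro!: exI[of _ 0])
  have "\<exists>x\<in>states. \<Phi> x = x"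
  proof (rule weighted_fixed_point[where w = ewt and ?x0.0 = "\<lambda>_ _. 0" and ?r0.0 = A0])
    \<comment> \<open>The growth estimate with \<open>r = 0\<close>: the image of the zero state
      consists of the inhomogeneous terms, of weighted size at most \<open>A0\<close>.\<close>
    show "norm (\<Phi> (\<lambda>_ _. 0) \<theta> t - 0) \<le> A0 * ewt \<theta> t" for \<theta> t
      using \<Phi>_growth[OF zero, of 0 \<theta> t] by simp
    show "x \<in> states" if "\<And>n::nat. X n \<in> states" "r \<longlonglongrightarrow> 0"
      "\<And>n \<theta> t. norm (X n \<theta> t - x \<theta> t) \<le> r n * ewt \<theta> t" for X x r
      using that by (rule states_closed)
  qed (use ewt_nonneg zero \<Phi>_states \<Phi>_difference A0_bounds(3) in auto)
  then obtain x where x: "x \<in> states" "\<Phi> x = x" by auto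
  have "solves UNIV (\<lambda>\<omega>. x (Inl \<omega>)) (\<lambda>i. x (Inr i))"
    unfolding solves_def
  proof (intro conjI ballI allI)
    fix \<omega> t assume t: "t \<in> {0..T}"
    have "x (Inl \<omega>) t = \<xi> \<omega> t + integral {0..t} (BX x \<omega>)"
      using fun_cong[OF fun_cong[OF x(2)], of "Inl \<omega>" t] pr_id[OF t] by simp
    then show "(BX x \<omega> has_integral (x (Inl \<omega>) t - \<xi> \<omega> t)) {0..t}" using BX_has_integral[OF x(1)] by simp
  next
    fix i t assume t: "t \<in> {0..T}"
    have "x (Inr i) t = Y0 i + integral {0..t} (BY x i)"
      using fun_cong[OF fun_cong[OF x(2)], of "Inr i" t] pr_id[OF t] by simp
    then show "(BY x i has_integral (x (Inr i) t - Y0 i)) {0..t}" using BY_has_integral[OF x(1) t] by simp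
  qed (use x in \<open>auto simp: states_def\<close>)
  then show ?thesis
    using states_integrable[OF x(1)] BX_absolutely_integrable[OF x(1)] BY_absolutely_integrable[OF x(1)] x(1)
    by (intro that) (auto simp: states_def intro: continuous_on_subset)
qed

text \<open>
  The drifts along two paths differ by a Lipschitz term, so a single path with integrable drift
  controls the drift along all the others.
\<close>

lemma solves_imp_dominated:
  assumes S: "solves G X Y"
    and cont: "\<And>\<omega>. \<omega> \<in> G \<Longrightarrow> continuous_on {0..T} (X \<omega>)" "\<And>i. continuous_on {0..T} (Y i)"
    and int: "\<And>t. t \<in> {0..T} \<Longrightarrow> integrable M (\<lambda>\<omega>. X \<omega> t)"
    and abs: "\<And>\<omega>. \<omega> \<in> G \<Longrightarrow>
      driftX X Y \<omega> absolutely_integrable_on {0..T}"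
  obtains r where "dominated r G X Y"
proof -
  have "G \<noteq> {}"
  proof
    assume "G = {}"
    then have "AE \<omega> in M. False" using S by (simp add: solves_def)
    then show False by simp
  qed
  then obtain \<omega>0 where \<omega>0: "\<omega>0 \<in> G" by auto
  define b where "b \<omega> s = driftX X Y \<omega> s" for \<omega> s
  \<comment> \<open>\<open>h\<close> is one integrable function, independent of the outcome, that
    bounds the drift along every path up to \<open>2 * L\<close> times the norm of that
    path.\<close>
  define h where "h s = norm (b \<omega>0 s) + 2 * L * norm (X \<omega>0 s)" for s
  define D where "D = integral {0..T} h"
  \<comment> \<open>The law and the \<open>Y\<close> components are the same for both outcomes and
    cancel in the comparison, so \<open>2 * L\<close> takes the place of \<open>\<Lambda>\<close>
    and no mean of \<open>K\<close> enters the rate.\<close>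
  define \<beta> where "\<beta> = 4 * L + 1"
  have \<beta>: "2 * (2 * L) \<le> \<beta>" "0 < \<beta>" using L_nonneg by (auto simp: \<beta>_def)
  have hi: "h integrable_on {0..T}"
  proof -
    have "(\<lambda>s. norm (b \<omega>0 s)) absolutely_integrable_on {0..T}"
      using absolutely_integrable_norm[OF abs[OF \<omega>0]] by (simp add: o_def b_def)
    then have "(\<lambda>s. norm (b \<omega>0 s)) integrable_on {0..T}" by (rule set_lebesgue_integral_eq_integral(1))
    moreover have "(\<lambda>s. 2 * L * norm (X \<omega>0 s)) integrable_on {0..T}"
      by (intro integrable_continuous_interval continuous_intros cont \<omega>0)
    ultimately show ?thesis unfolding h_def by (rule integrable_add)
  qed
  have h0: "0 \<le> h s" for s using L_nonneg by (simp add: h_def)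
  have D0: "0 \<le> D" unfolding D_def by (intro integral_nonneg hi h0)
  have bb: "norm (b \<omega> s) \<le> h s + 2 * L * norm (X \<omega> s)" if s: "s \<in> {0..T}" for \<omega> s
  proof -
    have "norm (b \<omega> s - b \<omega>0 s) \<le> L * (2 * norm (X \<omega> s - X \<omega>0 s) + (LINT \<omega>|M. norm (X \<omega> s - X \<omega> s)) + 0)"
      unfolding b_def by (rule bX_diff) (use int s in auto)
    also have "\<dots> \<le> 2 * L * (norm (X \<omega> s) + norm (X \<omega>0 s))"
      using mult_left_mono[OF norm_triangle_ineq4[of "X \<omega> s" "X \<omega>0 s"], of "2 * L"] L_nonneg by (simp add: mult_ac)
    finally show ?thesis
      using norm_triangle_sub[of "b \<omega> s" "b \<omega>0 s"] by (simp add: h_def algebra_simps)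
  qed
  have X_le: "norm (X \<omega> t) \<le> 2 * (K \<omega> + D) * exp (\<beta> * t)" if \<omega>: "\<omega> \<in> G" and t: "t \<in> {0..T}" for \<omega> t
  proof -
    have "bounded (X \<omega> ` {0..T})"
      using cont(1)[OF \<omega>] by (intro compact_imp_bounded compact_continuous_image) auto
    \<comment> \<open>\<open>B\<close> depends on the outcome, but it only starts the halving; the
      limit \<open>2 * (K \<omega> + D)\<close> does not involve it.\<close>
    then obtain B where B: "B > 0" "\<And>t. t \<in> {0..T} \<Longrightarrow> norm (X \<omega> t) \<le> B"
      unfolding bounded_pos by auto
    have e1: "1 \<le> exp (\<beta> * s)" if "s \<in> {0..T}" for s using that \<beta> by simp
    have KD: "0 \<le> K \<omega> + D" using K(2)[of \<omega>] D0 by linarith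
    show ?thesis
    proof (rule halving_bound[where I = "{0..T}" and f = "\<lambda>t. norm (X \<omega> t)" and w = "\<lambda>t. exp (\<beta> * t)" and ?r0.0 = B])
      show "norm (X \<omega> t) \<le> B * exp (\<beta> * t)" if "t \<in> {0..T}" for t
        using B(2)[OF that] mult_left_mono[OF e1[OF that], of B] B(1) by linarith
      fix q t assume q: "0 \<le> q" and IH: "\<And>t. t \<in> {0..T} \<Longrightarrow> norm (X \<omega> t) \<le> q * exp (\<beta> * t)" and t: "t \<in> {0..T}"
      have "norm (X \<omega> t - \<xi> \<omega> t) \<le> D + q / 2 * exp (\<beta> * t)"
      proof (rule exp_weighted_integral_bound[OF _ t hi h0, where \<Lambda> = "2 * L" and g = "b \<omega>"])
        show "(b \<omega> has_integral (X \<omega> t - \<xi> \<omega> t)) {0..t}"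
          using S \<omega> t by (simp add: solves_def b_def[abs_def])
        fix s assume "s \<in> {0..t}"
        then have s: "s \<in> {0..T}" using t by auto
        have "2 * L * norm (X \<omega> s) \<le> 2 * L * (q * exp (\<beta> * s))"
          using IH[OF s] L_nonneg by (intro mult_left_mono) auto
        then show "norm (b \<omega> s) \<le> h s + 2 * L * q * exp (\<beta> * s)" using bb[OF s, of \<omega>] by (simp add: mult.assoc)
      qed (use q \<beta> L_nonneg D_def in auto)
      then have "norm (X \<omega> t) \<le> (K \<omega> + D) + q / 2 * exp (\<beta> * t)"
        using \<xi>_le[OF t, of \<omega>] norm_triangle_sub[of "X \<omega> t" "\<xi> \<omega> t"] by linarith
      then show "norm (X \<omega> t) \<le> (K \<omega> + D + q / 2) * exp (\<beta> * t)"
        using mult_left_mono[OF e1[OF t] KD] by (simp add: algebra_simps)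
    qed (use B KD t in auto)
  qed
  define r1 where "r1 = 2 * (1 + D) * exp (\<beta> * T)"
  have X_dom: "norm (X \<omega> t) \<le> r1 * K \<omega>" if \<omega>: "\<omega> \<in> G" and t: "t \<in> {0..T}" for \<omega> t
  proof -
    have K1: "1 \<le> K \<omega>" by (rule K)
    have "norm (X \<omega> t) \<le> 2 * (K \<omega> + D) * exp (\<beta> * t)" by (rule X_le[OF \<omega> t])
    also have "\<dots> \<le> 2 * ((1 + D) * K \<omega>) * exp (\<beta> * T)"
    proof (rule mult_mono)
      show "2 * (K \<omega> + D) \<le> 2 * ((1 + D) * K \<omega>)"
        using mult_left_mono[OF K1 D0] by (simp add: algebra_simps)
      show "exp (\<beta> * t) \<le> exp (\<beta> * T)" using t \<beta> by simp
    qed (use K1 D0 in auto)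
    finally show ?thesis by (simp add: r1_def mult_ac)
  qed
  have "\<exists>B>0. \<forall>t\<in>{0..T}. norm (Y i t) \<le> B" for i
  proof -
    have "bounded (Y i ` {0..T})"
      using cont(2) by (intro compact_imp_bounded compact_continuous_image) auto
    then show ?thesis unfolding bounded_pos by auto
  qed
  then obtain B where B: "\<And>i. B i > 0" "\<And>i t. t \<in> {0..T} \<Longrightarrow> norm (Y i t) \<le> B i" by metis
  have r1: "0 \<le> r1" using D0 by (simp add: r1_def)
  have sB: "0 \<le> sum B UNIV" by (rule sum_nonneg) (use B(1) less_imp_le in blast)
  have "dominated (r1 + sum B UNIV) G X Y"
    unfolding dominated_def
  proof (intro conjI ballI allI)
    fix \<omega> t assume "\<omega> \<in> G" "t \<in> {0..T}"
    then have "norm (X \<omega> t) \<le> r1 * K \<omega>" by (rule X_dom)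
    also have "\<dots> \<le> (r1 + sum B UNIV) * K \<omega>" using sB K(2)[of \<omega>] by (intro mult_right_mono) auto
    finally show "norm (X \<omega> t) \<le> (r1 + sum B UNIV) * K \<omega>" .
  next
    fix i t assume "t \<in> {0..T}"
    then have "norm (Y i t) \<le> B i" by (rule B)
    also have "\<dots> \<le> sum B UNIV" by (rule member_le_sum) (use B(1) less_imp_le in auto)
    finally show "norm (Y i t) \<le> r1 + sum B UNIV" using r1 by linarith
  qed
  then show ?thesis by (rule that)
qed

section \<open>Pathwise solutions and the integral equation\<close>

lemma drift_X_eq:
  assumes X: "X \<in> measurable M (path_borel T)" and s: "s \<in> {0..T}"
  shows "drift_X H1 K1 (path_law M T X) Y s x = bX (\<lambda>\<omega>. X \<omega> s) (\<lambda>j. Y j s) x"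
proof -
  have [measurable]: "(\<lambda>\<omega>. X \<omega> s) \<in> borel_measurable M" "H1 \<in> borel_measurable borel"
    using measurable_path_borel_eval[OF X s] lipschitz_borel[OF lip(1)] by auto
  show ?thesis unfolding drift_X_def conv_def bX_def marginal_path_law[OF X s]
    by (subst integral_distr) auto
qed

lemma drift_Y_eq:
  assumes X: "X \<in> measurable M (path_borel T)" and s: "s \<in> {0..T}"
  shows "drift_Y H2 K2 u (path_law M T X) Y i s = driftY X Y i s"
proof -
  have [measurable]: "(\<lambda>\<omega>. X \<omega> s) \<in> borel_measurable M" "K2 \<in> borel_measurable borel"
    using measurable_path_borel_eval[OF X s] lipschitz_borel[OF lip(4)] by auto
  show ?thesis unfolding drift_Y_def conv_def bY_def marginal_path_law[OF X s]
    by (subst integral_distr) auto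
qed

text \<open>\<open>G\<close> collects the outcomes where the equation written with
  \<open>\<xi>\<close> holds at all times. The ODE part becomes an integral equation by the
  fundamental theorem for absolutely continuous functions. Membership of the marginals in W_1 gives
  integrability of \<open>X\<close> at each time, from which domination is deduced.\<close>

lemma pathwise_solution_imp_solves:
  assumes P: "pathwise_solution T \<sigma> H1 H2 K1 K2 u M W X0 Y0 X Y"
    and \<xi>: "AE \<omega> in M. \<forall>t\<in>{0..T}. \<xi> \<omega> t = X0 \<omega> + sqrt (2 * \<sigma>) *\<^sub>R W t \<omega>"
  obtains G r where "G \<subseteq> space M" "solves G X Y" "dominated r G X Y"
proof -
  define \<mu> where "\<mu> = path_law M T X"
  note P' = P[unfolded pathwise_solution_def Let_def, folded \<mu>_def]
  have X: "X \<in> measurable M (path_borel T)" and Yc: "\<And>i. Y i \<in> mspace (C0 T)" using P' by auto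
  have Xe: "AE \<omega> in M. \<forall>t\<in>{0..T}.
      set_integrable lebesgue {0..t} (\<lambda>s. drift_X H1 K1 \<mu> Y s (X \<omega> s)) \<and>
      X \<omega> t = X0 \<omega> + (LINT s:{0..t}|lebesgue. drift_X H1 K1 \<mu> Y s (X \<omega> s)) + sqrt (2 * \<sigma>) *\<^sub>R W t \<omega>"
    using P' by auto
  define b where "b \<omega> s = driftX X Y \<omega> s" for \<omega> s
  define G where "G = {\<omega> \<in> space M. \<forall>t\<in>{0..T}. b \<omega> absolutely_integrable_on {0..t} \<and>
      X \<omega> t - \<xi> \<omega> t = (LINT s:{0..t}|lebesgue. b \<omega> s)}"
  have "AE \<omega> in M. \<omega> \<in> G"
    using Xe \<xi> AE_space
  proof eventually_elim
    case (elim \<omega>)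
    have "b \<omega> absolutely_integrable_on {0..t} \<and> X \<omega> t - \<xi> \<omega> t = (LINT s:{0..t}|lebesgue. b \<omega> s)"
      if t: "t \<in> {0..T}" for t
    proof -
      have eq: "drift_X H1 K1 \<mu> Y s (X \<omega> s) = b \<omega> s" if "s \<in> {0..t}" for s
        unfolding \<mu>_def b_def by (rule drift_X_eq[OF X]) (use that t in auto)
      have "(LINT s:{0..t}|lebesgue. drift_X H1 K1 \<mu> Y s (X \<omega> s)) = (LINT s:{0..t}|lebesgue. b \<omega> s)"
        by (rule set_lebesgue_integral_cong) (use eq in auto)
      moreover have "set_integrable lebesgue {0..t} (\<lambda>s. drift_X H1 K1 \<mu> Y s (X \<omega> s)) = set_integrable lebesgue {0..t} (b \<omega>)"
        by (rule set_integrable_cong) (use eq in auto)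
      ultimately show ?thesis using elim t by auto
    qed
    then show ?case using elim by (simp add: G_def)
  qed
  moreover have Xm: "(\<lambda>\<omega>. X \<omega> t) \<in> borel_measurable M" if "t \<in> {0..T}" for t
    using measurable_path_borel_eval[OF X that] .
  moreover have "(b \<omega> has_integral (X \<omega> t - \<xi> \<omega> t)) {0..t}" if "\<omega> \<in> G" "t \<in> {0..T}" for \<omega> t
    using that set_lebesgue_integral_eq_integral[of "{0..t}" "b \<omega>"] by (auto simp: G_def has_integral_iff)
  moreover have "(driftY X Y i has_integral (Y i t - Y0 i)) {0..t}"
    if t: "t \<in> {0..T}" for i t
  proof -
    have Y: "Y i 0 = Y0 i" "abs_continuous_on {0..T} (Y i)"
      "AE t in lebesgue_on {0..T}. (Y i has_vector_derivative drift_Y H2 K2 u \<mu> Y i t) (at t)"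
      using P' by auto
    have "AE t in lebesgue. t \<in> {0..T} \<longrightarrow> (Y i has_vector_derivative drift_Y H2 K2 u \<mu> Y i t) (at t)"
      using Y(3) by (subst (asm) AE_restrict_space_iff) auto
    then obtain N where N: "{t \<in> space lebesgue. \<not> (t \<in> {0..T} \<longrightarrow> (Y i has_vector_derivative drift_Y H2 K2 u \<mu> Y i t) (at t))} \<subseteq> N"
      "N \<in> null_sets lebesgue"
      unfolding eventually_ae_filter by blast
    have "(drift_Y H2 K2 u \<mu> Y i has_integral (Y i t - Y i 0)) {0..t}"
    proof (rule fundamental_theorem_of_calculus_abs_continuous)
      show "abs_continuous_on {0..t} (Y i)"
        using Y(2) t unfolding abs_continuous_on_def by (meson atLeastatMost_subset_iff order_refl subset_trans atLeastAtMost_iff)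
      show "negligible N" using N(2) by (simp add: negligible_iff_null_sets)
      show "(Y i has_vector_derivative drift_Y H2 K2 u \<mu> Y i s) (at s within {0..t})" if "s \<in> {0..t} - N" for s
      proof (rule has_vector_derivative_at_within)
        have "s \<in> {0..T}" "s \<notin> N" using that t by auto
        then show "(Y i has_vector_derivative drift_Y H2 K2 u \<mu> Y i s) (at s)"
          using N(1) unfolding subset_iff by (simp only: mem_Collect_eq space_completion space_lborel space_borel UNIV_I) blast
      qed
    qed (use t in auto)
    moreover have "drift_Y H2 K2 u \<mu> Y i s = driftY X Y i s" if "s \<in> {0..t}" for s
      unfolding \<mu>_def by (rule drift_Y_eq[OF X]) (use that t in auto)
    ultimately have "(driftY X Y i has_integral (Y i t - Y i 0)) {0..t}"
      by (rule has_integral_eq[rotated])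
    then show ?thesis using Y(1) by simp
  qed
  ultimately have S: "solves G X Y" unfolding solves_def b_def[abs_def] by (intro conjI) blast+
  have X\<omega>: "\<omega> \<in> G \<Longrightarrow> X \<omega> \<in> mspace (C0 T)" for \<omega>
    using measurable_space[OF X, of \<omega>] by (auto simp: G_def space_path_borel)
  have "\<exists>r. dominated r G X Y"
  proof (rule solves_imp_dominated[OF S])
    show "continuous_on {0..T} (X \<omega>)" if "\<omega> \<in> G" for \<omega> using X\<omega>[OF that] by (simp add: mspace_C0_iff)
    show "continuous_on {0..T} (Y i)" for i using Yc[of i] by (simp add: mspace_C0_iff)
    show "integrable M (\<lambda>\<omega>. X \<omega> t)" if t: "t \<in> {0..T}" for t
    proof -
      have "marginal \<mu> t \<in> wasserstein_space 1" using P' t by auto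
      then have "distr M borel (\<lambda>\<omega>. X \<omega> t) \<in> wasserstein_space 1"
        unfolding \<mu>_def marginal_path_law[OF X t] .
      then have "integrable (distr M borel (\<lambda>\<omega>. X \<omega> t)) (\<lambda>x. x)" by (rule wasserstein_space_integrable)
      then show ?thesis using Xm[OF t] by (subst (asm) integrable_distr_eq) auto
    qed
    show "driftX X Y \<omega> absolutely_integrable_on {0..T}" if "\<omega> \<in> G" for \<omega>
      using that T unfolding G_def b_def[abs_def] by auto
  qed blast
  then show ?thesis using that[of G] S by (auto simp: G_def)
qed

text \<open>The integral equation gives back both requirements of a Caratheodory solution: an
  indefinite integral is absolutely continuous, and almost everywhere it has the integrand as
  derivative.\<close>

lemma exists_pathwise_solution:
  assumes \<xi>: "AE \<omega> in M. \<forall>t\<in>{0..T}. \<xi> \<omega> t = X0 \<omega> + sqrt (2 * \<sigma>) *\<^sub>R W t \<omega>"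
  shows "\<exists>X Y. pathwise_solution T \<sigma> H1 H2 K1 K2 u M W X0 Y0 X Y"
proof -
  obtain X Y where S: "solves UNIV X Y"
    and c: "\<And>\<omega>. continuous_on {0..T} (X \<omega>)" "\<And>i. continuous_on {0..T} (Y i)"
    and int: "\<And>t. t \<in> {0..T} \<Longrightarrow> integrable M (\<lambda>\<omega>. X \<omega> t)"
    and aX: "\<And>\<omega> t. driftX X Y \<omega> absolutely_integrable_on {0..t}"
    and aY: "\<And>i. driftY X Y i absolutely_integrable_on {0..T}"
    by (rule existence) (rule that)
  \<comment> \<open>Elements of the path space are extensional, so the paths are cut off outside
    \<open>{0..T}\<close>; the drifts on \<open>{0..T}\<close> do not change.\<close>
  define X' where "X' \<omega> = restrict (X \<omega>) {0..T}" for \<omega>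
  define Y' where "Y' i = restrict (Y i) {0..T}" for i
  have X'[simp]: "X' \<omega> t = X \<omega> t" and Y'[simp]: "Y' i t = Y i t" if "t \<in> {0..T}" for \<omega> i t
    using that by (auto simp: X'_def Y'_def)
  have Xm: "(\<lambda>\<omega>. X \<omega> t) \<in> borel_measurable M" if "t \<in> {0..T}" for t using int[OF that] by auto
  have cX': "X' \<omega> \<in> mspace (C0 T)" for \<omega>
  proof -
    have "continuous_on {0..T} (X' \<omega>)" by (rule continuous_on_eq[OF c(1)[of \<omega>]]) simp
    then show ?thesis by (simp add: mspace_C0_iff X'_def)
  qed
  have cY': "Y' i \<in> mspace (C0 T)" for i
  proof -
    have "continuous_on {0..T} (Y' i)" by (rule continuous_on_eq[OF c(2)[of i]]) simp
    then show ?thesis by (simp add: mspace_C0_iff Y'_def)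
  qed
  have X'm: "X' \<in> measurable M (path_borel T)"
    by (rule measurable_path_borelI) (use T cX' Xm in \<open>auto simp: X'_def\<close>)
  define \<mu> where "\<mu> = path_law M T X'"
  have dX: "drift_X H1 K1 \<mu> Y' s (X' \<omega> s) = driftX X Y \<omega> s" if "s \<in> {0..T}" for \<omega> s
    unfolding \<mu>_def drift_X_eq[OF X'm that] using that by simp
  have dY: "drift_Y H2 K2 u \<mu> Y' i s = driftY X Y i s" if "s \<in> {0..T}" for i s
    unfolding \<mu>_def drift_Y_eq[OF X'm that] using that by simp
  have "marginal \<mu> t \<in> wasserstein_space 1" if t: "t \<in> {0..T}" for t
    unfolding \<mu>_def marginal_path_law[OF X'm t] using int[OF t] t
    by (simp add: distr_in_wasserstein_space prob_space_axioms)
  moreover have "AE \<omega> in M. \<forall>t\<in>{0..T}.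
      set_integrable lebesgue {0..t} (\<lambda>s. drift_X H1 K1 \<mu> Y' s (X' \<omega> s)) \<and>
      X' \<omega> t = X0 \<omega> + (LINT s:{0..t}|lebesgue. drift_X H1 K1 \<mu> Y' s (X' \<omega> s)) + sqrt (2 * \<sigma>) *\<^sub>R W t \<omega>"
    using \<xi>
  proof eventually_elim
    case (elim \<omega>)
    show ?case
    proof
      fix t assume t: "t \<in> {0..T}"
      have eq: "drift_X H1 K1 \<mu> Y' s (X' \<omega> s) = driftX X Y \<omega> s" if "s \<in> {0..t}" for s
        by (rule dX) (use that t in auto)
      have 1: "set_integrable lebesgue {0..t} (\<lambda>s. drift_X H1 K1 \<mu> Y' s (X' \<omega> s))"
      proof -
        have "set_integrable lebesgue {0..t} (\<lambda>s. drift_X H1 K1 \<mu> Y' s (X' \<omega> s))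
            = set_integrable lebesgue {0..t} (driftX X Y \<omega>)"
          by (rule set_integrable_cong) (use eq in auto)
        then show ?thesis using aX by blast
      qed
      have "(LINT s:{0..t}|lebesgue. drift_X H1 K1 \<mu> Y' s (X' \<omega> s))
          = (LINT s:{0..t}|lebesgue. driftX X Y \<omega> s)"
        by (rule set_lebesgue_integral_cong) (use eq in auto)
      also have "\<dots> = integral {0..t} (driftX X Y \<omega>)"
        by (rule set_lebesgue_integral_eq_integral(2)[OF aX])
      also have "\<dots> = X \<omega> t - \<xi> \<omega> t"
        using S t by (intro integral_unique) (auto simp: solves_def)
      finally show "set_integrable lebesgue {0..t} (\<lambda>s. drift_X H1 K1 \<mu> Y' s (X' \<omega> s)) \<and>
          X' \<omega> t = X0 \<omega> + (LINT s:{0..t}|lebesgue. drift_X H1 K1 \<mu> Y' s (X' \<omega> s)) + sqrt (2 * \<sigma>) *\<^sub>R W t \<omega>"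
        using 1 elim t by (auto simp: algebra_simps)
    qed
  qed
  moreover have "Y' i 0 = Y0 i \<and> abs_continuous_on {0..T} (Y' i) \<and>
      (AE t in lebesgue_on {0..T}. (Y' i has_vector_derivative drift_Y H2 K2 u \<mu> Y' i t) (at t))" for i
  proof -
    define g where "g s = driftY X Y i s" for s
    have g: "g absolutely_integrable_on {0..T}" using aY[of i] by (simp add: g_def[abs_def])
    have Yi: "Y' i t = Y0 i + integral {0..t} g" if t: "t \<in> {0..T}" for t
    proof -
      have "(g has_integral (Y i t - Y0 i)) {0..t}" using S t by (auto simp: solves_def g_def[abs_def])
      then show ?thesis using t by (simp add: integral_unique)
    qed
    have "Y' i 0 = Y0 i" using Yi[of 0] T by simp
    moreover have "abs_continuous_on {0..T} (Y' i)"
      by (rule abs_continuous_on_indefinite_integral[OF g Yi])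
    moreover have "AE t in lebesgue_on {0..T}. (Y' i has_vector_derivative drift_Y H2 K2 u \<mu> Y' i t) (at t)"
    proof -
      obtain N where N: "negligible N"
        "\<And>t. t \<in> {0<..<T} - N \<Longrightarrow> ((\<lambda>t. integral {0..t} g) has_vector_derivative g t) (at t)"
        using indefinite_integral_has_vector_derivative_ae[OF set_lebesgue_integral_eq_integral(1)[OF g]] by metis
      have *: "(Y' i has_vector_derivative drift_Y H2 K2 u \<mu> Y' i t) (at t)" if t: "t \<in> {0<..<T} - N" for t
      proof -
        have "((\<lambda>t. Y0 i + integral {0..t} g) has_vector_derivative 0 + g t) (at t)"
          by (intro has_vector_derivative_add has_vector_derivative_const N(2) t)
        then have "((\<lambda>t. Y0 i + integral {0..t} g) has_vector_derivative g t) (at t)" by simp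
        then have "(Y' i has_vector_derivative g t) (at t)"
          by (rule has_vector_derivative_transform_within_open[where S = "{0<..<T}"]) (use t Yi in auto)
        moreover have "drift_Y H2 K2 u \<mu> Y' i t = g t" unfolding g_def by (rule dY) (use t in auto)
        ultimately show ?thesis by simp
      qed
      \<comment> \<open>The derivative in the definition is two-sided while \<open>Y' i\<close> is
        cut off outside \<open>{0..T}\<close>, so the two endpoints join the exceptional
        set.\<close>
      have "N \<union> {0, T} \<in> null_sets lebesgue"
        using N(1) by (metis negligible_Un negligible_finite negligible_iff_null_sets finite.emptyI finite.insertI)
      then have "AE t in lebesgue. t \<in> {0..T} \<longrightarrow> (Y' i has_vector_derivative drift_Y H2 K2 u \<mu> Y' i t) (at t)"
      proof (rule AE_I', intro subsetI)
        fix t assume "t \<in> {t \<in> space lebesgue. \<not> (t \<in> {0..T} \<longrightarrow> (Y' i has_vector_derivative drift_Y H2 K2 u \<mu> Y' i t) (at t))}"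
        then have t: "t \<in> {0..T}" "\<not> (Y' i has_vector_derivative drift_Y H2 K2 u \<mu> Y' i t) (at t)" by simp_all
        then have "t \<notin> {0<..<T} - N" using * by blast
        then show "t \<in> N \<union> {0, T}" using t(1) by auto
      qed
      then show ?thesis by (subst AE_restrict_space_iff) auto
    qed
    ultimately show ?thesis by blast
  qed
  ultimately have "pathwise_solution T \<sigma> H1 H2 K1 K2 u M W X0 Y0 X' Y'"
    unfolding pathwise_solution_def Let_def \<mu>_def[symmetric] using X'm cY' by blast
  then show ?thesis by blast
qed

text \<open>Both solutions satisfy the integral equation with the same \<open>\<xi>\<close>, hence
  agree on \<open>{0..T}\<close>; extensionality turns this into equality of functions.\<close>

lemma pathwise_unique:
  assumes P: "pathwise_solution T \<sigma> H1 H2 K1 K2 u M W X0 Y0 X Y"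
      "pathwise_solution T \<sigma> H1 H2 K1 K2 u M W X0 Y0 X' Y'"
    and \<xi>: "AE \<omega> in M. \<forall>t\<in>{0..T}. \<xi> \<omega> t = X0 \<omega> + sqrt (2 * \<sigma>) *\<^sub>R W t \<omega>"
  shows "AE \<omega> in M. X \<omega> = X' \<omega>" "Y = Y'"
proof -
  obtain G r where G: "G \<subseteq> space M" "solves G X Y" "dominated r G X Y"
    using pathwise_solution_imp_solves[OF P(1) \<xi>] by metis
  obtain G' r' where G': "G' \<subseteq> space M" "solves G' X' Y'" "dominated r' G' X' Y'"
    using pathwise_solution_imp_solves[OF P(2) \<xi>] by metis
  note U = uniqueness[OF G(2) G'(2) G(3) G'(3)]
  have X: "X \<omega> \<in> extensional {0..T}" "X' \<omega> \<in> extensional {0..T}" if "\<omega> \<in> space M" for \<omega>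
  proof -
    have "X \<in> measurable M (path_borel T)" "X' \<in> measurable M (path_borel T)"
      using P by (auto simp: pathwise_solution_def)
    from this[THEN measurable_space, OF that]
    show "X \<omega> \<in> extensional {0..T}" "X' \<omega> \<in> extensional {0..T}"
      by (simp_all add: space_path_borel mspace_C0_iff)
  qed
  have Y: "Y i \<in> extensional {0..T}" "Y' i \<in> extensional {0..T}" for i
    using P by (auto simp: pathwise_solution_def mspace_C0_iff)
  have "AE \<omega> in M. \<omega> \<in> G" "AE \<omega> in M. \<omega> \<in> G'" using G G' by (auto simp: solves_def)
  then show "AE \<omega> in M. X \<omega> = X' \<omega>"
  proof eventually_elim
    case (elim \<omega>)
    show ?case by (rule extensionalityI[OF X]) (use elim G(1) U(1) in auto)
  qed
  show "Y = Y'"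
    by (rule ext, rule extensionalityI[OF Y]) (use U(2) in auto)
qed

lemma pathwise_solution_path_norm_bound:
  assumes P: "pathwise_solution T \<sigma> H1 H2 K1 K2 u M W X0 Y0 X Y"
    and \<xi>: "AE \<omega> in M. \<forall>t\<in>{0..T}. \<xi> \<omega> t = X0 \<omega> + sqrt (2 * \<sigma>) *\<^sub>R W t \<omega>"
  shows "AE \<omega> in M. path_norm T (X \<omega>) \<le> 2 * A0 * exp (l * T) * K \<omega>"
proof -
  obtain G r where G: "G \<subseteq> space M" "solves G X Y" "dominated r G X Y"
    using pathwise_solution_imp_solves[OF P \<xi>] by metis
  have D: "dominated (2 * A0 * exp (l * T)) G X Y" by (rule a_priori_bound[OF G(2,3)])
  have X: "X \<in> measurable M (path_borel T)" using P by (simp add: pathwise_solution_def)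
  have "AE \<omega> in M. \<omega> \<in> G" using G by (auto simp: solves_def)
  then show ?thesis
  proof eventually_elim
    case (elim \<omega>)
    have "continuous_on {0..T} (X \<omega>)"
      using measurable_space[OF X, of \<omega>] elim G(1) by (auto simp: space_path_borel mspace_C0_iff)
    then show ?case using D elim T by (subst path_norm_le_iff) (auto simp: dominated_def)
  qed
qed

end

section \<open>The moment bound\<close>

lemma le_one_plus_powr:
  fixes x p :: real
  assumes "0 \<le> x" "1 \<le> p"
  shows "x \<le> 1 + x powr p"
proof (cases "x \<le> 1")
  case False
  then have "x powr 1 \<le> x powr p" using assms by (intro powr_mono) auto
  then show ?thesis using assms by simp
qed (simp add: add_increasing2)

text \<open>\<open>2 * k\<close> is an even exponent of size at least \<open>p\<close>, with
  \<open>k \<ge> 3\<close> for the chaining series; the leading 1 comes from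
  \<open>x powr q \<le> 1 + x ^ (2 * k)\<close>. One constant thus bounds all moments of positive
  order up to \<open>p\<close>.\<close>

definition path_moment_const :: "nat \<Rightarrow> real \<Rightarrow> real \<Rightarrow> real" where
  "path_moment_const d p T = (let k = max 3 (nat \<lceil>p\<rceil>) in
     1 + 6 ^ (2 * k) * (real d ^ (2 * k + 1) * (fact (2 * k) / (2 ^ k * fact k)) * T ^ k / (1 - 2 * (18 / 25) ^ k)))"

lemma path_moment_const_ge_1:
  assumes "0 < T"
  shows "1 \<le> path_moment_const d p T"
proof -
  define k where "k = max 3 (nat \<lceil>p\<rceil>)"
  have "(18 / 25 :: real) ^ k \<le> (18 / 25) ^ 3" by (intro power_decreasing) (auto simp: k_def)
  also have "\<dots> < 1 / 2" by (simp add: power3_eq_cube)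
  finally have "0 < 1 - 2 * (18 / 25 :: real) ^ k" by simp
  then show ?thesis using assms by (simp add: path_moment_const_def Let_def k_def[symmetric])
qed

text \<open>Serves two exponents: \<open>q = 1\<close> bounds the mean of the weight
  \<open>K\<close>, and \<open>q = p\<close> the moment of the solution.\<close>

lemma brownian_path_norm_powr_moment:
  fixes W :: "real \<Rightarrow> 'w \<Rightarrow> 'b::euclidean_space"
  assumes M: "prob_space M" and bm: "brownian_motion M F T W" and T: "T > 0"
    and w: "\<And>\<omega>. w \<omega> \<in> mspace (C0 T)" "AE \<omega> in M. \<forall>t\<in>{0..T}. w \<omega> t = W t \<omega>"
      "w \<in> measurable M (path_borel T)"
    and q: "0 < q" "q \<le> p"
  shows "(\<integral>\<^sup>+ \<omega>. ennreal (path_norm T (w \<omega>) powr q) \<partial>M) \<le> ennreal (path_moment_const DIM('b) p T)"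
proof -
  interpret prob_space M by fact
  define k where "k = max 3 (nat \<lceil>p\<rceil>)"
  define c where "c = 6 ^ (2 * k) * (real DIM('b) ^ (2 * k + 1) * (fact (2 * k) / (2 ^ k * fact k)) * T ^ k
         / (1 - 2 * (18 / 25) ^ k))"
  have k3: "k \<ge> 3" by (simp add: k_def)
  have c: "path_moment_const DIM('b) p T = 1 + c" by (simp add: path_moment_const_def Let_def k_def c_def)
  then have c0: "0 \<le> c" using path_moment_const_ge_1[OF T, of "DIM('b)" p] by simp
  have "p \<le> real (nat \<lceil>p\<rceil>)" by linarith
  also have "\<dots> \<le> real (2 * k)" by (simp add: k_def)
  finally have qk: "q \<le> real (2 * k)" using q by simp
  have [measurable]: "(\<lambda>\<omega>. path_norm T (w \<omega>)) \<in> borel_measurable M"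
    using measurable_compose[OF w(3) measurable_path_norm] T by simp
  have pn: "0 \<le> path_norm T (w \<omega>)" for \<omega>
    using path_norm_nonneg[of T "w \<omega>"] T w(1)[of \<omega>] by (simp add: mspace_C0_iff)
  have "(\<integral>\<^sup>+ \<omega>. ennreal (path_norm T (w \<omega>) powr q) \<partial>M) \<le> (\<integral>\<^sup>+ \<omega>. 1 + ennreal (path_norm T (w \<omega>) ^ (2 * k)) \<partial>M)"
  proof (rule nn_integral_mono)
    fix \<omega>
    have "ennreal (path_norm T (w \<omega>) powr q) \<le> ennreal (1 + path_norm T (w \<omega>) ^ (2 * k))"
      by (intro ennreal_leI powr_le_one_plus_power pn q qk)
    then show "ennreal (path_norm T (w \<omega>) powr q) \<le> 1 + ennreal (path_norm T (w \<omega>) ^ (2 * k))"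
      using pn by simp
  qed
  also have "\<dots> = 1 + (\<integral>\<^sup>+ \<omega>. ennreal (path_norm T (w \<omega>) ^ (2 * k)) \<partial>M)"
    by (subst nn_integral_add) (auto simp: emeasure_space_1)
  also have "\<dots> \<le> 1 + ennreal c"
    using brownian_path_norm_moment[OF bm T k3 w(1,2)] by (intro add_left_mono) (simp add: c_def)
  also have "\<dots> = ennreal (path_moment_const DIM('b) p T)" using c0 by (simp add: c)
  finally show ?thesis .
qed

text \<open>The bound on the mean of \<open>K\<close> involves only \<open>p\<close>,
  \<open>T\<close>, \<open>\<sigma>\<close>, the dimension and the p-th moment of \<open>X0\<close>,
  not the probability space or the particular \<open>W\<close>; this makes the final constant
  uniform. Its 2 consists of the 1 in \<open>K\<close> and the 1 in
  \<open>x \<le> 1 + x powr p\<close>.\<close>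

lemma particle_system_of_data:
  fixes T \<sigma> p L :: real and H1 H2 K1 K2 :: "'b::euclidean_space \<Rightarrow> 'b"
    and u :: "'m::finite \<Rightarrow> real \<Rightarrow> 'b measure \<Rightarrow> 'b" and W :: "real \<Rightarrow> 'w \<Rightarrow> 'b"
  assumes T: "T > 0" and \<sigma>: "\<sigma> > 0" and p: "p > 1"
    and lip: "L-lipschitz_on UNIV H1" "L-lipschitz_on UNIV H2" "L-lipschitz_on UNIV K1" "L-lipschitz_on UNIV K2"
    and fp: "filtered_prob_space M F" and bm: "brownian_motion M F T W" and X0: "initial_datum p M F X0"
    and u: "\<And>i. admissible_control T L (u i)"
  defines "m \<equiv> (LINT \<omega>|M. norm (X0 \<omega>) powr p)" and "B \<equiv> path_moment_const DIM('b) p T"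
  obtains \<xi> S where
    "particle_system M T L H1 H2 K1 K2 u \<xi> (\<lambda>\<omega>. 1 + norm (X0 \<omega>) + sqrt (2 * \<sigma>) * S \<omega>) (2 + m + sqrt (2 * \<sigma>) * B)"
    "AE \<omega> in M. \<forall>t\<in>{0..T}. \<xi> \<omega> t = X0 \<omega> + sqrt (2 * \<sigma>) *\<^sub>R W t \<omega>"
    "S \<in> borel_measurable M" "\<And>\<omega>. 0 \<le> S \<omega>" "(\<integral>\<^sup>+ \<omega>. ennreal (S \<omega> powr p) \<partial>M) \<le> ennreal B"
proof -
  interpret prob_space M using fp by (simp add: filtered_prob_space_def)
  obtain w where w: "\<And>\<omega>. w \<omega> \<in> mspace (C0 T)" "\<And>t. t \<in> {0..T} \<Longrightarrow> (\<lambda>\<omega>. w \<omega> t) \<in> borel_measurable M"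
    "AE \<omega> in M. \<forall>t\<in>{0..T}. w \<omega> t = W t \<omega>"
    by (rule brownian_path_version[OF fp bm]) (rule that)
  have wm: "w \<in> measurable M (path_borel T)" by (rule measurable_path_borelI) (use T w in auto)
  define S where "S \<omega> = path_norm T (w \<omega>)" for \<omega>
  define \<xi> where "\<xi> \<omega> t = X0 \<omega> + sqrt (2 * \<sigma>) *\<^sub>R w \<omega> t" for \<omega> t
  define K where "K \<omega> = 1 + norm (X0 \<omega>) + sqrt (2 * \<sigma>) * S \<omega>" for \<omega>
  have wc: "continuous_on {0..T} (w \<omega>)" for \<omega> using w(1) by (simp add: mspace_C0_iff)
  have Sm[measurable]: "S \<in> borel_measurable M"
    unfolding S_def using measurable_compose[OF wm measurable_path_norm] T by simp
  have S0: "0 \<le> S \<omega>" for \<omega> unfolding S_def using path_norm_nonneg[OF _ wc] T by simp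
  have X0m[measurable]: "X0 \<in> borel_measurable M"
    using X0 fp measurable_from_subalg[of M "F 0"] by (auto simp: filtered_prob_space_def initial_datum_def)
  have X0p: "integrable M (\<lambda>\<omega>. norm (X0 \<omega>) powr p)" using X0 by (simp add: initial_datum_def)
  have X0_le: "norm (X0 \<omega>) \<le> 1 + norm (X0 \<omega>) powr p" for \<omega> using p by (intro le_one_plus_powr) auto
  have X0i: "integrable M (\<lambda>\<omega>. norm (X0 \<omega>))"
    by (rule Bochner_Integration.integrable_bound[where f = "\<lambda>\<omega>. 1 + norm (X0 \<omega>) powr p"])
      (use X0p X0_le in auto)
  have B: "1 \<le> B" unfolding B_def by (rule path_moment_const_ge_1[OF T])
  have S1: "(\<integral>\<^sup>+ \<omega>. ennreal (S \<omega>) \<partial>M) \<le> ennreal B"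
    using brownian_path_norm_powr_moment[OF prob_space_axioms bm T w(1) w(3) wm, of 1 p] p S0
    by (simp add: S_def B_def)
  have Si: "integrable M S"
    using S1 S0 by (intro integrableI_bounded) (auto simp: le_less_trans[OF _ ennreal_less_top])
  have SB: "expectation S \<le> B"
    using S1 Si S0 B by (subst (asm) nn_integral_eq_integral) auto
  have Ki: "integrable M K" unfolding K_def using X0i Si by simp
  have "expectation K = 1 + expectation (\<lambda>\<omega>. norm (X0 \<omega>)) + sqrt (2 * \<sigma>) * expectation S"
    unfolding K_def using X0i Si by (simp add: prob_space)
  also have "expectation (\<lambda>\<omega>. norm (X0 \<omega>)) \<le> expectation (\<lambda>\<omega>. 1 + norm (X0 \<omega>) powr p)"
    using X0i X0p X0_le by (intro integral_mono) auto
  also have "\<dots> = 1 + m" using X0p by (simp add: prob_space m_def)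
  also have "1 + (1 + m) + sqrt (2 * \<sigma>) * expectation S \<le> 2 + m + sqrt (2 * \<sigma>) * B"
    using mult_left_mono[OF SB, of "sqrt (2 * \<sigma>)"] \<sigma> by simp
  finally have EK: "expectation K \<le> 2 + m + sqrt (2 * \<sigma>) * B" by simp
  have "particle_system M T L H1 H2 K1 K2 u \<xi> K (2 + m + sqrt (2 * \<sigma>) * B)"
  proof
    show "continuous_on {0..T} (\<xi> \<omega>)" for \<omega> unfolding \<xi>_def by (intro continuous_intros wc)
    show "(\<lambda>\<omega>. \<xi> \<omega> t) \<in> borel_measurable M" if "t \<in> {0..T}" for t
    proof -
      have [measurable]: "(\<lambda>\<omega>. w \<omega> t) \<in> borel_measurable M" by (rule w(2)[OF that])
      show ?thesis unfolding \<xi>_def by measurable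
    qed
    show "norm (\<xi> \<omega> t) \<le> K \<omega>" if "t \<in> {0..T}" for \<omega> t
    proof -
      have "norm (\<xi> \<omega> t) \<le> norm (X0 \<omega>) + sqrt (2 * \<sigma>) * norm (w \<omega> t)"
        unfolding \<xi>_def using norm_triangle_ineq[of "X0 \<omega>" "sqrt (2 * \<sigma>) *\<^sub>R w \<omega> t"] \<sigma> by simp
      also have "\<dots> \<le> norm (X0 \<omega>) + sqrt (2 * \<sigma>) * S \<omega>"
        unfolding S_def using norm_le_path_norm[OF wc that] \<sigma> by (intro add_left_mono mult_left_mono) auto
      finally show ?thesis by (simp add: K_def)
    qed
    show "1 \<le> K \<omega>" for \<omega> using S0[of \<omega>] \<sigma> by (simp add: K_def)
  qed (use T lip u Ki EK in auto)
  moreover have "AE \<omega> in M. \<forall>t\<in>{0..T}. \<xi> \<omega> t = X0 \<omega> + sqrt (2 * \<sigma>) *\<^sub>R W t \<omega>"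
    using w(3) by eventually_elim (simp add: \<xi>_def)
  moreover have "(\<integral>\<^sup>+ \<omega>. ennreal (S \<omega> powr p) \<partial>M) \<le> ennreal B"
    unfolding S_def B_def using p by (intro brownian_path_norm_powr_moment[OF prob_space_axioms bm T w(1) w(3) wm]) auto
  ultimately show ?thesis using Sm S0 that[of \<xi> S] unfolding K_def[abs_def] by blast
qed

text \<open>This is \<open>2 * A0 * exp (l * T)\<close> written out, with \<open>c i\<close> for the
  integral of the i-th control at the Dirac mass, so that the constant is available before any
  control or probability space is fixed.\<close>

definition drift_growth_const where
  "drift_growth_const T L (H1 :: 'b::euclidean_space \<Rightarrow> 'b) H2 K1 K2 Y0 (c :: 'm::finite \<Rightarrow> real) \<kappa> =
     2 * (1 + T * norm (H1 0 + K1 0) + T * norm (K2 0 + H2 0) + (\<Sum>i\<in>UNIV. norm (Y0 i :: 'b)) + (\<Sum>i\<in>UNIV. c i))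
       * exp ((2 * (L * (3 + 2 * \<kappa>)) + 1) * T :: real)"

text \<open>The path norm is almost surely at most \<open>Q\<close> times the weight, a sum of three
  terms whose p-th power splits at the price of \<open>3 powr p\<close>; the moments of
  \<open>X0\<close> and \<open>S\<close> are then known.\<close>

lemma path_moment_bound:
  fixes T \<sigma> p L :: real and H1 H2 K1 K2 :: "'b::euclidean_space \<Rightarrow> 'b"
    and u :: "'m::finite \<Rightarrow> real \<Rightarrow> 'b measure \<Rightarrow> 'b" and W :: "real \<Rightarrow> 'w \<Rightarrow> 'b"
  assumes T: "T > 0" and \<sigma>: "\<sigma> > 0" and p: "p > 1"
    and lip: "L-lipschitz_on UNIV H1" "L-lipschitz_on UNIV H2" "L-lipschitz_on UNIV K1" "L-lipschitz_on UNIV K2"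
    and fp: "filtered_prob_space M F" and bm: "brownian_motion M F T W" and X0: "initial_datum p M F X0"
    and u: "\<And>i. admissible_control T L (u i)"
    and c: "\<And>i. (LINT t:{0..T}|lebesgue. norm (u i t (return borel 0))) = c i"
    and P: "pathwise_solution T \<sigma> H1 H2 K1 K2 u M W X0 Y0 X Y"
  defines "m \<equiv> (LINT x|distr M borel X0. norm x powr p)" and "B \<equiv> path_moment_const DIM('b) p T"
  shows "moment p (path_norm T) (path_law M T X) \<le>
    ennreal ((drift_growth_const T L H1 H2 K1 K2 Y0 c (2 + m + sqrt (2 * \<sigma>) * B) powr p
      * (3 powr p * (1 + m + sqrt (2 * \<sigma>) powr p * B))) powr (1 / p))"
proof -
  have X0m[measurable]: "X0 \<in> borel_measurable M"
    using X0 fp measurable_from_subalg[of M "F 0"] by (auto simp: filtered_prob_space_def initial_datum_def)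
  have m: "m = (LINT \<omega>|M. norm (X0 \<omega>) powr p)" unfolding m_def by (subst integral_distr) auto
  obtain \<xi> S where
    PS: "particle_system M T L H1 H2 K1 K2 u \<xi> (\<lambda>\<omega>. 1 + norm (X0 \<omega>) + sqrt (2 * \<sigma>) * S \<omega>) (2 + m + sqrt (2 * \<sigma>) * B)"
    and \<xi>: "AE \<omega> in M. \<forall>t\<in>{0..T}. \<xi> \<omega> t = X0 \<omega> + sqrt (2 * \<sigma>) *\<^sub>R W t \<omega>"
    and S[measurable]: "S \<in> borel_measurable M" and S0: "\<And>\<omega>. 0 \<le> S \<omega>"
    and Sp: "(\<integral>\<^sup>+ \<omega>. ennreal (S \<omega> powr p) \<partial>M) \<le> ennreal B"
    by (rule particle_system_of_data[OF T \<sigma> p lip fp bm X0 u, folded m B_def]) (rule that)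
  interpret particle_system M T L H1 H2 K1 K2 u Y0 \<xi> "\<lambda>\<omega>. 1 + norm (X0 \<omega>) + sqrt (2 * \<sigma>) * S \<omega>"
    "2 + m + sqrt (2 * \<sigma>) * B" by (rule PS)
  define Q where "Q = drift_growth_const T L H1 H2 K1 K2 Y0 c (2 + m + sqrt (2 * \<sigma>) * B)"
  \<comment> \<open>\<open>A0\<close> uses the gauge integral, the hypothesis on \<open>c\<close>
    the Lebesgue integral; they agree for a nonnegative integrable function.\<close>
  have "integral {0..T} (\<lambda>s. norm (u i s (return borel 0))) = c i" for i
  proof -
    have "(\<lambda>s. norm (u i s (return borel 0))) absolutely_integrable_on {0..T}"
      by (rule nonnegative_absolutely_integrable_1[OF u_zero_integrable]) auto
    then show ?thesis using c[of i] set_lebesgue_integral_eq_integral(2) by metis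
  qed
  then have Q: "2 * A0 * exp (l * T) = Q"
    by (simp add: A0_def l_def \<Lambda>_def Q_def drift_growth_const_def)
  then have Q0: "0 \<le> Q" using A0_bounds(3) by (simp add: Q[symmetric])
  have m0: "0 \<le> m" unfolding m by simp
  have B1: "1 \<le> B" unfolding B_def by (rule path_moment_const_ge_1[OF T])
  have X0p: "integrable M (\<lambda>\<omega>. norm (X0 \<omega>) powr p)" using X0 by (simp add: initial_datum_def)
  have enn: "ennreal (a * (1 + x + b * y)) = ennreal a * (1 + ennreal x + ennreal b * ennreal y)"
    if "0 \<le> a" "0 \<le> x" "0 \<le> b" "0 \<le> y" for a x b y :: real
  proof -
    have "ennreal (1 + x + b * y) = 1 + ennreal x + ennreal b * ennreal y"
      using that by (simp add: ennreal_mult add_nonneg_nonneg)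
    then show ?thesis using that by (simp add: ennreal_mult)
  qed
  define Z where "Z = Q powr p * (3 powr p * (1 + m + sqrt (2 * \<sigma>) powr p * B))"
  have Xm: "X \<in> measurable M (path_borel T)" using P by (simp add: pathwise_solution_def)
  have [measurable]: "path_norm T \<in> borel_measurable (path_borel T :: (real \<Rightarrow> 'b) measure)"
    by (rule measurable_path_norm) (use T in simp)
  have "(\<integral>\<^sup>+ f. ennreal (path_norm T f powr p) \<partial>path_law M T X) = (\<integral>\<^sup>+ \<omega>. ennreal (path_norm T (X \<omega>) powr p) \<partial>M)"
    unfolding path_law_def by (rule nn_integral_distr[OF Xm]) measurable
  also have "\<dots> \<le> (\<integral>\<^sup>+ \<omega>. ennreal (Q powr p * 3 powr p) *
      (1 + ennreal (norm (X0 \<omega>) powr p) + ennreal (sqrt (2 * \<sigma>) powr p) * ennreal (S \<omega> powr p)) \<partial>M)"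
  proof (rule nn_integral_mono_AE)
    show "AE \<omega> in M. ennreal (path_norm T (X \<omega>) powr p) \<le> ennreal (Q powr p * 3 powr p) *
      (1 + ennreal (norm (X0 \<omega>) powr p) + ennreal (sqrt (2 * \<sigma>) powr p) * ennreal (S \<omega> powr p))"
      using pathwise_solution_path_norm_bound[OF P \<xi>] AE_space
    proof eventually_elim
      case (elim \<omega>)
      have "continuous_on {0..T} (X \<omega>)"
        using measurable_space[OF Xm, of \<omega>] elim by (simp add: space_path_borel mspace_C0_iff)
      then have "0 \<le> path_norm T (X \<omega>)" by (rule path_norm_nonneg[rotated]) (use T in simp)
      then have "path_norm T (X \<omega>) powr p \<le> (Q * (1 + norm (X0 \<omega>) + sqrt (2 * \<sigma>) * S \<omega>)) powr p"
        using elim(1) p by (intro powr_mono2) (auto simp: Q)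
      also have "\<dots> = Q powr p * (1 + norm (X0 \<omega>) + sqrt (2 * \<sigma>) * S \<omega>) powr p"
        by (rule powr_mult)
      also have "\<dots> \<le> Q powr p * (3 powr p * (1 powr p + norm (X0 \<omega>) powr p + (sqrt (2 * \<sigma>) * S \<omega>) powr p))"
        using S0[of \<omega>] \<sigma> p by (intro mult_left_mono sum3_powr_le) auto
      also have "\<dots> = (Q powr p * 3 powr p) * (1 + norm (X0 \<omega>) powr p + sqrt (2 * \<sigma>) powr p * S \<omega> powr p)"
        by (simp add: powr_mult)
      finally have "ennreal (path_norm T (X \<omega>) powr p)
          \<le> ennreal ((Q powr p * 3 powr p) * (1 + norm (X0 \<omega>) powr p + sqrt (2 * \<sigma>) powr p * S \<omega> powr p))"
        by (rule ennreal_leI)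
      then show ?case by (simp only: enn powr_ge_zero mult_nonneg_nonneg)
    qed
  qed
  also have "\<dots> = ennreal (Q powr p * 3 powr p) * (1 + (\<integral>\<^sup>+ \<omega>. ennreal (norm (X0 \<omega>) powr p) \<partial>M)
      + ennreal (sqrt (2 * \<sigma>) powr p) * (\<integral>\<^sup>+ \<omega>. ennreal (S \<omega> powr p) \<partial>M))"
    by (simp add: nn_integral_cmult nn_integral_add emeasure_space_1)
  also have "(\<integral>\<^sup>+ \<omega>. ennreal (norm (X0 \<omega>) powr p) \<partial>M) = ennreal m"
    unfolding m by (rule nn_integral_eq_integral[OF X0p]) auto
  also have "ennreal (Q powr p * 3 powr p) * (1 + ennreal m
      + ennreal (sqrt (2 * \<sigma>) powr p) * (\<integral>\<^sup>+ \<omega>. ennreal (S \<omega> powr p) \<partial>M))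
    \<le> ennreal (Q powr p * 3 powr p) * (1 + ennreal m + ennreal (sqrt (2 * \<sigma>) powr p) * ennreal B)"
    by (intro mult_left_mono add_left_mono Sp) auto
  also have "\<dots> = ennreal Z"
    using enn[of "Q powr p * 3 powr p" m "sqrt (2 * \<sigma>) powr p" B] m0 B1 by (simp add: Z_def mult.assoc)
  finally have I: "(\<integral>\<^sup>+ f. ennreal (path_norm T f powr p) \<partial>path_law M T X) \<le> ennreal Z" .
  have Z0: "0 \<le> Z" unfolding Z_def using m0 B1 by simp
  have "enn2real (\<integral>\<^sup>+ f. ennreal (path_norm T f powr p) \<partial>path_law M T X) \<le> Z"
    using I Z0 by (intro enn2real_leI)
  then have "enn2real (\<integral>\<^sup>+ f. ennreal (path_norm T f powr p) \<partial>path_law M T X) powr (1 / p) \<le> Z powr (1 / p)"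
    using p by (intro powr_mono2) auto
  then show ?thesis
    using I unfolding moment_def Let_def Q_def[symmetric] Z_def[symmetric]
    by (auto simp: top_unique intro: ennreal_leI)
qed

theorem theorem3p1:
  fixes T \<sigma> p L :: real
    and H1 H2 K1 K2 :: "real ^ 'd \<Rightarrow> real ^ 'd"
    and Y0 :: "'m::finite \<Rightarrow> real ^ 'd"
    and law0 :: "(real ^ 'd) measure"
    and c :: "'m \<Rightarrow> real"
  assumes "T > 0" and "\<sigma> > 0" and "p > 1"
    and "L-lipschitz_on UNIV H1" and "L-lipschitz_on UNIV H2"
    and "L-lipschitz_on UNIV K1" and "L-lipschitz_on UNIV K2"
  shows
    "(\<forall>(M :: 'w measure) F W X0 u.
        filtered_prob_space M F \<and> brownian_motion M F T W \<and> initial_datum p M F X0 \<and>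
        (\<forall>i. admissible_control T L (u i)) \<longrightarrow>
        (\<exists>X Y. pathwise_solution T \<sigma> H1 H2 K1 K2 u M W X0 Y0 X Y) \<and>
        (\<forall>X Y X' Y'.
           pathwise_solution T \<sigma> H1 H2 K1 K2 u M W X0 Y0 X Y \<and>
           pathwise_solution T \<sigma> H1 H2 K1 K2 u M W X0 Y0 X' Y' \<longrightarrow>
           (AE \<omega> in M. X \<omega> = X' \<omega>) \<and> Y = Y')) \<and>
     (\<exists>C>0. \<forall>(M :: 'w measure) F W X0 u X Y.
        filtered_prob_space M F \<and> brownian_motion M F T W \<and> initial_datum p M F X0 \<and>
        (\<forall>i. admissible_control T L (u i)) \<and>
        distr M borel X0 = law0 \<and>
        (\<forall>i. (LINT t:{0..T}|lebesgue. norm (u i t (return borel 0))) = c i) \<and>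
        pathwise_solution T \<sigma> H1 H2 K1 K2 u M W X0 Y0 X Y \<longrightarrow>
        moment p (path_norm T) (path_law M T X) \<le> ennreal C)"
proof (intro conjI allI impI; (elim conjE)?)
  fix M :: "'w measure" and F and W :: "real \<Rightarrow> 'w \<Rightarrow> real ^ 'd" and X0 :: "'w \<Rightarrow> real ^ 'd"
    and u :: "'m \<Rightarrow> real \<Rightarrow> (real ^ 'd) measure \<Rightarrow> real ^ 'd"
  assume A: "filtered_prob_space M F" "brownian_motion M F T W" "initial_datum p M F X0"
    "\<forall>i. admissible_control T L (u i)"
  obtain \<xi> S \<kappa> where PS: "particle_system M T L H1 H2 K1 K2 u \<xi> (\<lambda>\<omega>. 1 + norm (X0 \<omega>) + sqrt (2 * \<sigma>) * S \<omega>) \<kappa>"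
    and \<xi>: "AE \<omega> in M. \<forall>t\<in>{0..T}. \<xi> \<omega> t = X0 \<omega> + sqrt (2 * \<sigma>) *\<^sub>R W t \<omega>"
  proof -
    have "admissible_control T L (u i)" for i using A(4) by blast
    then show ?thesis by (rule particle_system_of_data[OF assms A(1-3)]) (rule that)
  qed
  interpret particle_system M T L H1 H2 K1 K2 u Y0 \<xi> "\<lambda>\<omega>. 1 + norm (X0 \<omega>) + sqrt (2 * \<sigma>) * S \<omega>" \<kappa>
    by (rule PS)
  show "\<exists>X Y. pathwise_solution T \<sigma> H1 H2 K1 K2 u M W X0 Y0 X Y"
    by (rule exists_pathwise_solution[OF \<xi>])
  fix X Y X' Y'
  assume "pathwise_solution T \<sigma> H1 H2 K1 K2 u M W X0 Y0 X Y"
    "pathwise_solution T \<sigma> H1 H2 K1 K2 u M W X0 Y0 X' Y'"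
  from pathwise_unique[OF this \<xi>]
  show "AE \<omega> in M. X \<omega> = X' \<omega>" "Y = Y'" by auto
next
  \<comment> \<open>\<open>m\<close>, \<open>B\<close> and \<open>C\<close> are formed from
    \<open>law0\<close>, \<open>c\<close> and the fixed data only, before the probability space, the
    noise and the controls are introduced. The 1 added to \<open>C\<close> below makes the constant
    strictly positive.\<close>
  define m where "m = (LINT x|law0. norm x powr p)"
  define B where "B = path_moment_const DIM(real ^ 'd) p T"
  define C where "C = (drift_growth_const T L H1 H2 K1 K2 Y0 c (2 + m + sqrt (2 * \<sigma>) * B) powr p
      * (3 powr p * (1 + m + sqrt (2 * \<sigma>) powr p * B))) powr (1 / p)"
  have "moment p (path_norm T) (path_law M T X) \<le> ennreal (C + 1)"
    if "filtered_prob_space M F" "brownian_motion M F T W" "initial_datum p M F X0"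
      "\<forall>i. admissible_control T L (u i)" "distr M borel X0 = law0"
      "\<forall>i. (LINT t:{0..T}|lebesgue. norm (u i t (return borel 0))) = c i"
      "pathwise_solution T \<sigma> H1 H2 K1 K2 u M W X0 Y0 X Y"
    for M :: "'w measure" and F W X0 and u :: "'m \<Rightarrow> real \<Rightarrow> (real ^ 'd) measure \<Rightarrow> real ^ 'd" and X Y
  proof -
    have "moment p (path_norm T) (path_law M T X) \<le> ennreal C"
      using path_moment_bound[OF assms that(1-3) _ _ that(7), of c] that(4-6)
      unfolding C_def m_def B_def by auto
    also have "\<dots> \<le> ennreal (C + 1)" by (intro ennreal_leI) simp
    finally show ?thesis .
  qed
  moreover have "0 < C + 1" by (simp add: C_def add_nonneg_pos)
  ultimately show "\<exists>C>0. \<forall>(M :: 'w measure) F W X0 u X Y.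
        filtered_prob_space M F \<and> brownian_motion M F T W \<and> initial_datum p M F X0 \<and>
        (\<forall>i. admissible_control T L (u i)) \<and>
        distr M borel X0 = law0 \<and>
        (\<forall>i. (LINT t:{0..T}|lebesgue. norm (u i t (return borel 0))) = c i) \<and>
        pathwise_solution T \<sigma> H1 H2 K1 K2 u M W X0 Y0 X Y \<longrightarrow>
        moment p (path_norm T) (path_law M T X) \<le> ennreal C"
    by blast
qed

end
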